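(* Consider the dual-hop amplify-and-forward system with i.i.d. Rayleigh fading and residual additive transceiver hardware impairments described in the context, with $K$ single-antenna users, $M$ relay antennas and $N$ base-station antennas, under the per-user power constraints $[\mathbf Q_1]_{k,k}\le\mu$ for all $k=1,\dots,K$ and the relay input covariance $\mathbf Q_2=\nu\,\mathbb E[\mathbf y_1\mathbf y_1^{\mathsf H}]=\tilde\mu\nu K\,\mathbf I_M$. Its capacity per receive antenna is $$\mathrm C=\frac1N\,\mathbb E\left[\ln\det\left(\mathbf I_N+\frac{\mu\nu}{B}\mathbf H_2\mathbf H_1\mathbf H_1^{\mathsf H}\mathbf H_2^{\mathsf H}\boldsymbol\Phi^{-1}\right)\right]=\mathrm C_1-\mathrm C_2,$$ $$\mathrm C_1=\frac1N\,\mathbb E\left[\ln\det\left(\boldsymbol\Phi+\frac{\mu\nu}{B}\mathbf H_2\mathbf H_1\mathbf H_1^{\mathsf H}\mathbf H_2^{\mathsf H}\right)\right],\qquad \mathrm C_2=\frac1N\,\mathbb E\left[\ln\det\boldsymbol\Phi\right],$$ where $$\boldsymbol\Phi=f_2\mathbf H_2\mathbf H_1\mathbf H_1^{\mathsf H}\mathbf H_2^{\mathsf H}+f_3\mathbf H_2\mathbf H_2^{\mathsf H}+\mathbf I_N,$$ with $B=\delta_{\mathrm r_2}^2\tilde\mu\nu KM+1$, $f_1=\frac{f_2+f_4}{f_3}$, $f_2=f_4\delta_{\mathrm t_1}^2$, $f_3=\frac{\nu\left(\delta_{\mathrm t_2}^2\tilde\mu K+\delta_{\mathrm r_1}^2\mu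 K+1\right)}{B}$, and $f_4=\frac{\mu\nu}{B}$.
   Context: $(\cdot)^{\mathsf H}$ denotes conjugate transpose and $\mathcal{CN}$ the circularly symmetric complex Gaussian distribution. The expectation in the capacity formula is over the channel matrices. Channel model: $\mathbf H_1\in\mathbb C^{M\times K}$ (users to relay) and $\mathbf H_2\in\mathbb C^{N\times M}$ (relay to base station) have i.i.d. $\mathcal{CN}(0,1)$ entries (Rayleigh fast fading). The non-cooperative users transmit the Gaussian vector $\mathbf x_1\in\mathbb C^K$ with covariance $\mathbf Q_1=\mathbb E[\mathbf x_1\mathbf x_1^{\mathsf H}]=\frac{\rho}{K}\mathbf I_K$, and $\mu=\rho/K$ is the individual signal-to-noise ratio. The relay amplifies its received signal by the fixed gain $\sqrt\nu$. The relay and base station receive, respectively, $$\mathbf y_1=\mathbf H_1(\mathbf x_1+\boldsymbol\eta_{\mathrm t_1})+\boldsymbol\eta_{\mathrm r_1}+\mathbf z_1,\qquad \mathbf y_2=\mathbf H_2(\sqrt\nu\,\mathbf y_1+\boldsymbol\eta_{\mathrm t_2})+\boldsymbol\eta_{\mathrm r_2}+\mathbf z_2,$$ with thermal noises $\mathbf z_1\sim\mathcal{CN}(\mathbf 0,\mathbf I_M)$ and $\mathbf z_2\sim\mathcal{CN}(\mathbf 0,\mathbf I_N)$. Distortion noises: for hop $i=1,2$, let $T_i$ and $R_i$ be the numbers of transmit and receive antennas ($T_1=K$, $R_1=M$, $T_2=M$, $R_2=N$) and let $\mathbf Q_i$ be the transmit covariance matrix of that hop (that of $\mathbf x_1$ for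 $i=1$, of $\sqrt\nu\,\mathbf y_1$ for $i=2$), with diagonal entries $q_{i,1},\dots,q_{i,T_i}$. The distortion powers are proportional to the signal powers: $$\boldsymbol\eta_{\mathrm t_i}\sim\mathcal{CN}\left(\mathbf 0,\delta_{\mathrm t_i}^2\,\mathrm{diag}(q_{i,1},\dots,q_{i,T_i})\right),\qquad \boldsymbol\eta_{\mathrm r_i}\sim\mathcal{CN}\left(\mathbf 0,\delta_{\mathrm r_i}^2\,\mathrm{tr}(\mathbf Q_i)\,\mathbf I_{R_i}\right),$$ where $\delta_{\mathrm t_i}^2,\delta_{\mathrm r_i}^2$ measure the severity of the transmitter and receiver impairments of hop $i$. With $\mathbf Q_1=\frac{\rho}{K}\mathbf I_K$ and $\tilde\mu=\mu+\delta_{\mathrm t_1}^2\mu+\delta_{\mathrm r_1}^2\mu+\frac1K$ this gives $\mathbf Q_2=\nu\mathbb E[\mathbf y_1\mathbf y_1^{\mathsf H}]=\tilde\mu\nu K\,\mathbf I_M$, and $$\boldsymbol\eta_{\mathrm t_1}\sim\mathcal{CN}\left(\mathbf 0,\delta_{\mathrm t_1}^2\tfrac{\rho}{K}\mathbf I_K\right),\ \boldsymbol\eta_{\mathrm r_1}\sim\mathcal{CN}\left(\mathbf 0,\delta_{\mathrm r_1}^2\rho\,\mathbf I_M\right),\ \boldsymbol\eta_{\mathrm t_2}\sim\mathcal{CN}\left(\mathbf 0,\delta_{\mathrm t_2}^2\tilde\mu\nu K\,\mathbf I_M\right),\ \boldsymbol\eta_{\mathrm r_2}\sim\mathcal{CN}\left(\mathbf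 0,\delta_{\mathrm r_2}^2\tilde\mu\nu KM\,\mathbf I_N\right).$$ The fixed relay gain is given by $\nu=\frac{\alpha}{KM\tilde\mu}$, where $\frac{\alpha}{M}$ is the power constraint per relay antenna. The signal, thermal-noise and distortion terms are treated as mutually independent and independent of the channels, so that their covariances add. The base station knows the channels $\mathbf H_1,\mathbf H_2$ and the statistics of the distortion noises; the users and the relay have no channel knowledge. "Capacity per receive antenna" is the ergodic capacity of this channel (in nats) divided by $N$. *)

theory Defs
  imports "HOL-Probability.Probability"
begin

definition ctranspose :: "complex^'c^'r \<Rightarrow> complex^'r^'c" where
  "ctranspose A = (\<chi> i j. cnj (A $ j $ i))"

text \<open>Circularly symmetric complex Gaussian law of variance \<open>v \<ge> 0\<close>: independent real and
  imaginary parts of variance \<open>v / 2\<close>; it is the point mass at 0 for \<open>v = 0\<close>.\<close>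

definition cn :: "real \<Rightarrow> complex measure" where
  "cn v = distr (density lborel std_normal_density \<Otimes>\<^sub>M density lborel std_normal_density) borel
            (\<lambda>(a, b). Complex (sqrt (v / 2) * a) (sqrt (v / 2) * b))"

text \<open>Complex Gaussian vector with mean 0 and diagonal covariance matrix \<open>diag v\<close>.\<close>

definition cn_vec :: "('i \<Rightarrow> real) \<Rightarrow> (complex^'i) measure" where
  "cn_vec v = distr (\<Pi>\<^sub>M i\<in>UNIV. cn (v i)) borel vec_lambda"

definition rayleigh :: "(complex^'c^'r) measure" where
  "rayleigh = distr (\<Pi>\<^sub>M ij\<in>UNIV. cn 1) borel (\<lambda>h. \<chi> i j. h (i, j))"

text \<open>The matrix \<open>E[X X\<^sup>H]\<close>.\<close>

definition second_moment :: "'a measure \<Rightarrow> ('a \<Rightarrow> complex^'i) \<Rightarrow> complex^'i^'i" where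
  "second_moment M X = (\<chi> i j. \<integral>\<omega>. X \<omega> $ i * cnj (X \<omega> $ j) \<partial>M)"

text \<open>Law of \<open>(H, \<eta>\<^sub>t, \<eta>\<^sub>r, z)\<close> for one hop with \<open>'t\<close> transmit and \<open>'r\<close> receive antennas, where
  \<open>Q\<close> is the covariance matrix of the transmitted vector.\<close>

definition hop :: "real \<Rightarrow> real \<Rightarrow> complex^'t^'t \<Rightarrow>
    ((complex^'t^'r) \<times> (complex^'t) \<times> (complex^'r) \<times> (complex^'r)) measure" where
  "hop \<delta>t \<delta>r Q =
     rayleigh \<Otimes>\<^sub>M cn_vec (\<lambda>i. \<delta>t\<^sup>2 * Re (Q $ i $ i)) \<Otimes>\<^sub>M cn_vec (\<lambda>_. \<delta>r\<^sup>2 * Re (trace Q)) \<Otimes>\<^sub>M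
     cn_vec (\<lambda>_. 1)"

fun hop_output :: "complex^'t \<Rightarrow> (complex^'t^'r) \<times> (complex^'t) \<times> (complex^'r) \<times> (complex^'r) \<Rightarrow> complex^'r"
where
  "hop_output x (H, \<eta>t, \<eta>r, z) = H *v (x + \<eta>t) + \<eta>r + z"

text \<open>In the following, \<open>P\<close> is the law of the vector transmitted by the users. It is independent
  of the channels, since the users have no channel knowledge.\<close>

definition first_hop :: "real \<Rightarrow> real \<Rightarrow> (complex^'k) measure \<Rightarrow>
    ((complex^'k) \<times> (complex^'k^'m) \<times> (complex^'k) \<times> (complex^'m) \<times> (complex^'m)) measure" where
  "first_hop \<delta>t1 \<delta>r1 P = P \<Otimes>\<^sub>M hop \<delta>t1 \<delta>r1 (second_moment P (\<lambda>x. x))"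

definition relay_cov :: "real \<Rightarrow> real \<Rightarrow> real \<Rightarrow> (complex^'k) measure \<Rightarrow> complex^'m^'m" where
  "relay_cov \<nu> \<delta>t1 \<delta>r1 P =
     \<nu> *\<^sub>R second_moment (first_hop \<delta>t1 \<delta>r1 P) (\<lambda>(x, e). hop_output x e)"

definition dual_hop :: "real \<Rightarrow> real \<Rightarrow> real \<Rightarrow> real \<Rightarrow> real \<Rightarrow> (complex^'k) measure \<Rightarrow>
    (((complex^'k) \<times> (complex^'k^'m) \<times> (complex^'k) \<times> (complex^'m) \<times> (complex^'m)) \<times>
     ((complex^'m^'n) \<times> (complex^'m) \<times> (complex^'n) \<times> (complex^'n))) measure" where
  "dual_hop \<nu> \<delta>t1 \<delta>r1 \<delta>t2 \<delta>r2 P =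
     first_hop \<delta>t1 \<delta>r1 P \<Otimes>\<^sub>M hop \<delta>t2 \<delta>r2 (relay_cov \<nu> \<delta>t1 \<delta>r1 P)"

text \<open>The conditional mutual information \<open>I(x\<^sub>1; y\<^sub>2 | H\<^sub>1, H\<^sub>2)\<close> in nats. Conditioning on the
  channels expresses that the receiver knows them, and includes the average over them.\<close>

definition ergodic_rate :: "real \<Rightarrow> real \<Rightarrow> real \<Rightarrow> real \<Rightarrow> real \<Rightarrow>
    'm::finite itself \<Rightarrow> 'n::finite itself \<Rightarrow> (complex^'k) measure \<Rightarrow> real" where
  "ergodic_rate \<nu> \<delta>t1 \<delta>r1 \<delta>t2 \<delta>r2 (_ :: 'm itself) (_ :: 'n itself) P =
     prob_space.conditional_mutual_information (dual_hop \<nu> \<delta>t1 \<delta>r1 \<delta>t2 \<delta>r2 P) (exp 1)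
       borel borel borel
       (\<lambda>((x1, _), _). x1)
       (\<lambda>((x1, e1), e2). hop_output (sqrt \<nu> *\<^sub>R hop_output x1 e1) e2 :: complex^'n)
       (\<lambda>((_, H1, _), (H2, _)). (H1 :: complex^'k^'m, H2 :: complex^'m^'n))"

text \<open>Non-cooperation of the users means that the entries of the input are independent. The
  entries are centred, so that the second moment of the input is its covariance matrix. The input
  is not assumed to be Gaussian.\<close>

definition admissible_inputs ::
  "real \<Rightarrow> real \<Rightarrow> real \<Rightarrow> real \<Rightarrow> complex^'m^'m \<Rightarrow> (complex^'k) measure set" where
  "admissible_inputs \<nu> \<delta>t1 \<delta>r1 \<mu> Q2 = {P.
     prob_space P \<and> sets P = sets borel \<and>
     prob_space.indep_vars P (\<lambda>_. borel) (\<lambda>k x. x $ k) UNIV \<and>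
     (\<forall>k. integrable P (\<lambda>x. (cmod (x $ k))\<^sup>2)) \<and>
     (\<forall>k. (\<integral>x. x $ k \<partial>P) = 0) \<and>
     (\<forall>k. Re (second_moment P (\<lambda>x. x) $ k $ k) \<le> \<mu>) \<and>
     relay_cov \<nu> \<delta>t1 \<delta>r1 P = Q2}"

text \<open>Values in \<open>ereal\<close>, so that the supremum is meaningful without a boundedness side condition.\<close>

definition ergodic_capacity :: "real \<Rightarrow> real \<Rightarrow> real \<Rightarrow> real \<Rightarrow> real \<Rightarrow> real \<Rightarrow> complex^'m^'m \<Rightarrow>
    'k::finite itself \<Rightarrow> 'n::finite itself \<Rightarrow> ereal" where
  "ergodic_capacity \<nu> \<delta>t1 \<delta>r1 \<delta>t2 \<delta>r2 \<mu> Q2 (_ :: 'k itself) (_ :: 'n itself) =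
     (SUP P \<in> (admissible_inputs \<nu> \<delta>t1 \<delta>r1 \<mu> Q2 :: (complex^'k) measure set).
        ereal (ergodic_rate \<nu> \<delta>t1 \<delta>r1 \<delta>t2 \<delta>r2 TYPE('m) TYPE('n) P))"

text \<open>All determinants to which this is applied are real and positive.\<close>

definition lndet :: "complex^'i^'i \<Rightarrow> real" where
  "lndet A = ln (Re (det A))"

end

theory Submission
  imports Defs
begin

text \<open>Given the channels, the received vector is \<open>A x\<^sub>1\<close> plus complex Gaussian noise with covariance
  matrix \<open>\<Sigma> = B \<Phi>\<close>, where \<open>A = \<surd>\<nu> H\<^sub>2 H\<^sub>1\<close>; its density is computed by adding one complex Gaussian
  scalar at a time, which completes a square and updates the covariance by a matrix of rank one.
  With \<open>g\<close> the noise density and \<open>p\<close> the output density, the rate is the mean of \<open>ln (g / p)\<close>. By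
  Gibbs' inequality it is at most the mean of \<open>ln (g / q)\<close>, where \<open>q\<close> is the Gaussian density with
  covariance \<open>\<mu> A A\<^sup>H + \<Sigma>\<close>. The relay constraint forces every user to transmit with power exactly
  \<open>\<mu>\<close>, so the quadratic terms of \<open>ln (g / q)\<close> cancel in the mean and the difference of the
  log-determinants remains. For Gaussian inputs \<open>p = q\<close>, and the bound is attained.\<close>

section \<open>Positive definite matrices\<close>

text \<open>Every distortion variance may be zero, so a single distortion term need not have a
  density. Only the thermal noise at the base station is certain to be nondegenerate. Its identity
  covariance therefore starts the chain of rank-one updates: every later covariance stays positive
  definite, and a degenerate term is just an update with weight 0. The quadratic terms can cancel
  for an arbitrary input law because the mean of y^H S^{-1} y is tr(S^{-1} S), the dimension of y,
  as soon as S is the second moment matrix of y; no Gaussianity enters. This needs the full input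
  covariance to be \<open>\<mu>\<close> times the identity. The power constraints yield its diagonal
  only; the off-diagonal zeros come from independent, centred users. Laws are handled as nonnegative
  integrals for as long as possible, so that Fubini asks for no integrability. The real-valued
  information measures, by contrast, make it necessary to prove that the log-determinants are
  integrable. The normalisation by \<open>B\<close> in \<open>\<Phi>\<close> is harmless: it adds
  the same constant to both log-determinants of the difference.\<close>

definition hdot :: "complex^'n \<Rightarrow> complex^'n \<Rightarrow> complex" where
  "hdot x y = (\<Sum>i\<in>UNIV. cnj (x $ i) * y $ i)"

definition outer :: "complex^'n \<Rightarrow> complex^'n^'n" where
  "outer a = (\<chi> i j. a $ i * cnj (a $ j))"

lemma hdot_add_right: "hdot x (y + z) = hdot x y + hdot x z"
  and hdot_diff_right: "hdot x (y - z) = hdot x y - hdot x z"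
  and hdot_diff_left: "hdot (x - y) z = hdot x z - hdot y z"
  and hdot_scale_right: "hdot x (c *s y) = c * hdot x y"
  and hdot_scale_left: "hdot (c *s x) y = cnj c * hdot x y"
  by (simp_all add: hdot_def algebra_simps sum.distrib sum_subtractf sum_distrib_left)

lemma cnj_hdot: "cnj (hdot x y) = hdot y x"
  by (simp add: hdot_def mult.commute)

lemma hdot_self: "hdot x x = of_real (\<Sum>i\<in>UNIV. (cmod (x $ i))\<^sup>2)"
  by (simp add: hdot_def mult.commute flip: complex_norm_square)

lemma hdot_adjoint: "hdot x (A *v y) = hdot (ctranspose A *v x) y"
proof -
  have "hdot x (A *v y) = (\<Sum>i\<in>UNIV. \<Sum>j\<in>UNIV. cnj (x $ i) * (A $ i $ j * y $ j))"
    by (simp add: hdot_def matrix_vector_mult_def sum_distrib_left)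
  also have "\<dots> = (\<Sum>j\<in>UNIV. \<Sum>i\<in>UNIV. cnj (x $ i) * (A $ i $ j * y $ j))"
    by (rule sum.swap)
  also have "\<dots> = hdot (ctranspose A *v x) y"
    by (simp add: hdot_def matrix_vector_mult_def sum_distrib_left sum_distrib_right ctranspose_def mult_ac)
  finally show ?thesis .
qed

lemma outer_mult_vec: "outer a *v y = hdot a y *s a"
  by (simp add: vec_eq_iff outer_def hdot_def matrix_vector_mult_def sum_distrib_left mult_ac)

lemma ctranspose_outer: "ctranspose (outer a) = outer a"
  by (simp add: ctranspose_def outer_def vec_eq_iff)

lemma ctranspose_add: "ctranspose (A + B) = ctranspose A + ctranspose B"
  by (simp add: ctranspose_def vec_eq_iff)

lemma gram_eq_sum_outer: "A ** ctranspose A = (\<Sum>j\<in>UNIV. outer (column j A))"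
  by (simp add: vec_eq_iff matrix_matrix_mult_def ctranspose_def outer_def column_def)

text \<open>Row \<open>k\<close> equals \<open>v\<close>, so a multiple of \<open>v\<close> added to
  another row is an elementary row operation; the induction applies these one at a time.\<close>

lemma det_add_rows_other:
  fixes A :: "'a::field^'n^'n"
  assumes "finite J" "k \<notin> J"
  shows "det (\<chi> i. if i = k then v else if i \<in> J then A $ i + u i *s v else A $ i)
       = det (\<chi> i. if i = k then v else A $ i)"
  using assms
proof (induction J rule: finite_induct)
  case empty
  then show ?case by (simp cong: if_cong)
next
  case (insert l J)
  let ?X = "(\<chi> i. if i = k then v else if i \<in> J then A $ i + u i *s v else A $ i) :: 'a^'n^'n"
  have "(\<chi> i. if i = k then v else if i \<in> insert l J then A $ i + u i *s v else A $ i)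
      = (\<chi> i. if i = l then row l ?X + u l *s row k ?X else row i ?X)"
    using insert by (auto simp: vec_eq_iff row_def)
  moreover have "det (\<chi> i. if i = l then row l ?X + u l *s row k ?X else row i ?X) = det ?X"
    using insert by (intro det_row_operation) auto
  ultimately show ?case
    using insert by simp
qed

text \<open>The determinant is linear in each row, and a term with multiples of \<open>v\<close> in
  two rows vanishes. Hence the expansion stops after first order, which is what makes rank-one
  updates tractable.\<close>

lemma det_add_rows:
  fixes A :: "'a::field^'n^'n"
  assumes "finite J"
  shows "det (\<chi> i. if i \<in> J then A $ i + u i *s v else A $ i)
       = det A + (\<Sum>k\<in>J. u k * det (\<chi> i. if i = k then v else A $ i))"
  using assms
proof (induction J rule: finite_induct)
  case empty
  then show ?case by simp
next
  case (insert k J)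
  define c where "c i = (if i \<in> J then A $ i + u i *s v else A $ i)" for i
  have "(\<chi> i. if i \<in> insert k J then A $ i + u i *s v else A $ i)
      = (\<chi> i. if i = k then A $ i + u i *s v else c i)"
    by (auto simp: vec_eq_iff c_def)
  moreover have "det (\<chi> i. if i = k then A $ i + u i *s v else c i)
      = det (\<chi> i. if i = k then A $ i else c i) + det (\<chi> i. if i = k then u k *s v else c i)"
    using det_row_add[of k "\<lambda>i. A $ i" "\<lambda>i. u i *s v" c]
    by (simp cong: if_cong)
  moreover have "det (\<chi> i. if i = k then u k *s v else c i)
      = u k * det (\<chi> i. if i = k then v else c i)"
    using det_row_mul[of k "u k" "\<lambda>i. v" c] by simp
  moreover have "det (\<chi> i. if i = k then v else c i) = det (\<chi> i. if i = k then v else A $ i)"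
    using det_add_rows_other[OF insert(1,2), of v A u] unfolding c_def .
  moreover have "(\<chi> i. if i = k then A $ i else c i) = (\<chi> i. c i)"
    using insert by (auto simp: vec_eq_iff c_def)
  ultimately show ?case
    using insert by (simp add: c_def cong: if_cong)
qed

text \<open>This is the matrix determinant lemma. The vector S^{-1} a enters as a solution
  \<open>z\<close> of a linear system, so that Cramer's rule applies without an inverse
  matrix.\<close>

lemma det_add_outer:
  fixes S :: "complex^'n^'n"
  assumes "ctranspose S = S" "S *v z = a"
  shows "det (S + outer a) = det S * (1 + hdot z a)"
proof -
  \<comment> \<open>Hermitian symmetry turns \<open>S *v z = a\<close> into a combination of the
    rows of \<open>S\<close> that gives a^H, the form required by the transposed Cramer
    rule.\<close>
  have *: "(\<Sum>i\<in>UNIV. (cnj (z $ i)) *s row i S) = (\<chi> j. cnj (a $ j))"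
  proof -
    have "cnj (S $ j $ i) = S $ i $ j" for i j
      using arg_cong[OF assms(1), of "\<lambda>M. M $ i $ j"] by (simp add: ctranspose_def)
    then show ?thesis
      by (simp add: vec_eq_iff row_def assms(2)[symmetric] matrix_vector_mult_def mult_ac)
  qed
  have "S + outer a = (\<chi> i. if i \<in> UNIV then S $ i + a $ i *s (\<chi> j. cnj (a $ j)) else S $ i)"
    by (simp add: vec_eq_iff outer_def)
  also have "det \<dots> = det S + (\<Sum>k\<in>UNIV. a $ k * det (\<chi> i. if i = k then (\<chi> j. cnj (a $ j)) else S $ i))"
    by (rule det_add_rows) simp
  also have "(\<Sum>k\<in>UNIV. a $ k * det (\<chi> i. if i = k then (\<chi> j. cnj (a $ j)) else S $ i))
     = (\<Sum>k\<in>UNIV. a $ k * (cnj (z $ k) * det S))"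
  proof -
    have r: "row i S = S $ i" for i by (simp add: row_def vec_eq_iff)
    have "det (\<chi> i. if i = k then (\<chi> j. cnj (a $ j)) else row i S) = cnj (z $ k) * det S" for k
      using cramer_lemma_transpose[of k "\<chi> k. cnj (z $ k)" S] unfolding * vec_lambda_beta .
    then show ?thesis
      unfolding r by simp
  qed
  finally show ?thesis
    by (simp add: hdot_def sum_distrib_left algebra_simps)
qed

text \<open>Only positive definite matrices built from a multiple of the identity by rank-one updates are
  needed. Generating them inductively reduces every statement about determinants, inverses and
  Gaussian densities below to a single update.\<close>

inductive posdef :: "complex^'n^'n \<Rightarrow> bool" where
  posdef_scalar: "c > 0 \<Longrightarrow> posdef (mat (complex_of_real c))"
| posdef_add_outer: "posdef S \<Longrightarrow> posdef (S + outer a)"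

lemma mat_mult_vec: "mat c *v x = c *s (x :: 'a::semiring_1^'n)"
  by (simp add: vec_eq_iff matrix_vector_mult_def mat_def if_distrib if_distribR cong: if_cong)

lemma posdef_hermitian: "posdef S \<Longrightarrow> ctranspose S = S"
  by (induction rule: posdef.induct)
    (simp_all add: ctranspose_add ctranspose_outer, auto simp: vec_eq_iff ctranspose_def mat_def)

text \<open>One induction carries reality, nonnegativity and definiteness together: an update by
  \<open>outer a\<close> adds |a^H y|^2 to the form.\<close>

lemma posdef_quad: "posdef S \<Longrightarrow> \<exists>r\<ge>0. hdot y (S *v y) = of_real r \<and> (y \<noteq> 0 \<longrightarrow> r > 0)"
proof (induction rule: posdef.induct)
  case (posdef_scalar c)
  let ?s = "\<Sum>i\<in>UNIV. (cmod (y $ i))\<^sup>2"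
  have "?s > 0" if "y \<noteq> 0"
  proof -
    from that obtain i where i: "y $ i \<noteq> 0" by (auto simp: vec_eq_iff)
    then have "0 < (cmod (y $ i))\<^sup>2" by simp
    also have "\<dots> \<le> ?s" by (rule member_le_sum) auto
    finally show ?thesis .
  qed
  then show ?case
    using posdef_scalar
    by (intro exI[of _ "c * ?s"])
      (auto simp: mat_mult_vec hdot_scale_right hdot_self intro!: mult_nonneg_nonneg sum_nonneg)
next
  case (posdef_add_outer S a)
  then obtain r where r: "r \<ge> 0" "hdot y (S *v y) = of_real r" "y \<noteq> 0 \<longrightarrow> r > 0" by auto
  have "hdot y ((S + outer a) *v y) = of_real (r + (cmod (hdot a y))\<^sup>2)"
    using cnj_hdot[of a y] complex_norm_square[of "hdot a y"]
    by (simp add: matrix_vector_mult_add_rdistrib hdot_add_right r outer_mult_vec hdot_scale_right)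
  then show ?case
    using r by (intro exI[of _ "r + (cmod (hdot a y))\<^sup>2"]) (auto intro: add_pos_nonneg)
qed

lemma posdef_invertible:
  assumes "posdef S"
  shows "invertible S"
proof -
  have "S *v x = 0 \<longrightarrow> x = 0" for x
    using posdef_quad[OF assms, of x] by (auto simp: hdot_def)
  then have "\<exists>B. B ** S = mat 1"
    by (simp add: matrix_left_invertible_ker)
  then show ?thesis
    by (simp add: invertible_left_inverse)
qed

lemma matrix_inv_mult_vec:
  fixes S :: "complex^'n^'n"
  assumes "invertible S"
  shows "S *v (matrix_inv S *v y) = y" "matrix_inv S *v (S *v y) = y"
  using someI_ex[OF assms[unfolded invertible_def]]
  by (simp_all add: matrix_inv_def matrix_vector_mul_assoc)

text \<open>The negated exponent of the Gaussian density with covariance \<open>S\<close>. Taking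
  the real part loses nothing for positive definite \<open>S\<close>, by
  \<open>hdot_inv_eq\<close>.\<close>

definition inv_quad :: "complex^'n^'n \<Rightarrow> complex^'n \<Rightarrow> real" where
  "inv_quad S y = Re (hdot y (matrix_inv S *v y))"

text \<open>With z = S^{-1} y the form becomes z^H S z, to which \<open>posdef_quad\<close>
  applies.\<close>

lemma hdot_inv_eq:
  assumes "posdef S"
  shows "hdot y (matrix_inv S *v y) = of_real (inv_quad S y)" "inv_quad S y \<ge> 0"
proof -
  let ?z = "matrix_inv S *v y"
  have "hdot y ?z = hdot ?z (S *v ?z)"
    using matrix_inv_mult_vec(1)[OF posdef_invertible[OF assms]] posdef_hermitian[OF assms]
      hdot_adjoint[of ?z S ?z] by simp
  with posdef_quad[OF assms, of ?z]
  show "hdot y (matrix_inv S *v y) = of_real (inv_quad S y)" "inv_quad S y \<ge> 0"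
    by (auto simp: inv_quad_def)
qed

lemma hdot_inv_cnj:
  assumes "posdef S"
  shows "hdot y (matrix_inv S *v a) = cnj (hdot a (matrix_inv S *v y))"
proof -
  let ?z = "matrix_inv S *v y" and ?w = "matrix_inv S *v a"
  have "hdot y ?w = hdot (S *v ?z) ?w"
    using matrix_inv_mult_vec(1)[OF posdef_invertible[OF assms]] by simp
  also have "\<dots> = hdot ?z (S *v ?w)"
    using posdef_hermitian[OF assms] by (simp add: hdot_adjoint)
  also have "\<dots> = hdot ?z a"
    using matrix_inv_mult_vec(1)[OF posdef_invertible[OF assms]] by simp
  finally show ?thesis by (simp add: cnj_hdot)
qed

lemma det_posdef_add_outer:
  assumes "posdef S"
  shows "det (S + outer a) = det S * of_real (1 + inv_quad S a)"
  using det_add_outer[OF posdef_hermitian[OF assms] matrix_inv_mult_vec(1)[OF posdef_invertible[OF assms]], of a]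
    hdot_inv_eq(1)[OF assms, of a] hdot_inv_cnj[OF assms, of a a] cnj_hdot[of a "matrix_inv S *v a"]
  by simp

lemma det_mat: "det (mat c :: 'a::comm_ring_1^'n^'n) = c ^ CARD('n)"
  by (subst det_diagonal) (auto simp: mat_def)

lemma posdef_det:
  fixes S :: "complex^'n^'n"
  shows "posdef S \<Longrightarrow> Re (det S) > 0 \<and> det S = of_real (Re (det S))"
proof (induction rule: posdef.induct)
  case (posdef_scalar c)
  have "det (mat (complex_of_real c) :: complex^'n^'n) = of_real (c ^ CARD('n))"
    by (simp add: det_mat)
  with posdef_scalar show ?case by simp
next
  case (posdef_add_outer S a)
  then show ?case
    using hdot_inv_eq(2)[OF posdef_add_outer(1), of a]
      det_posdef_add_outer[OF posdef_add_outer(1), of a]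
    by (auto intro!: mult_pos_pos simp: complex_eq_iff)
qed

lemma posdef_add_sum_outer:
  assumes "posdef S" "finite J"
  shows "posdef (S + (\<Sum>j\<in>J. outer (a j)))"
  using assms(2)
proof (induction J rule: finite_induct)
  case (insert j J)
  then show ?case
    using posdef_add_outer[OF insert(3), of "a j"] by (simp add: add_ac)
qed (use assms in simp)

lemma outer_scaleR: "c \<ge> 0 \<Longrightarrow> outer (sqrt c *\<^sub>R a) = c *\<^sub>R outer a"
  unfolding outer_def vec_eq_iff vec_lambda_beta vector_scaleR_component
  by (metis (no_types, opaque_lifting) complex_cnj_scaleR mult_scaleR_left mult_scaleR_right real_sqrt_mult_self scaleR_scaleR abs_of_nonneg)

text \<open>A Gram matrix is the sum of the outer products of its columns, and the weight
  \<open>c\<close> is absorbed into the columns as \<open>sqrt c\<close>.\<close>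

lemma posdef_add_gram:
  assumes "posdef S" "c \<ge> 0"
  shows "posdef (S + c *\<^sub>R (A ** ctranspose A))"
  using posdef_add_sum_outer[OF assms(1), of UNIV "\<lambda>j. sqrt c *\<^sub>R column j A"] assms(2)
  by (simp add: gram_eq_sum_outer outer_scaleR scaleR_sum_right)

text \<open>Each update multiplies the determinant by 1 plus a nonnegative quadratic form. This
  later bounds the log-determinants from below by 0.\<close>

lemma det_add_sum_outer_ge:
  assumes "posdef S" "finite J"
  shows "Re (det S) \<le> Re (det (S + (\<Sum>j\<in>J. outer (a j))))"
  using assms(2)
proof (induction J rule: finite_induct)
  case (insert j J)
  let ?T = "S + (\<Sum>j\<in>J. outer (a j))"
  have p: "posdef ?T" using posdef_add_sum_outer[OF assms(1) insert(1)] .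
  have "Re (det ?T) \<le> Re (det (?T + outer (a j)))"
    using det_posdef_add_outer[OF p, of "a j"] hdot_inv_eq(2)[OF p, of "a j"] posdef_det[OF p]
    by simp
  with insert show ?case by (simp add: add_ac)
qed simp

lemma det_add_gram_ge:
  assumes "posdef S" "c \<ge> 0"
  shows "Re (det S) \<le> Re (det (S + c *\<^sub>R (A ** ctranspose A)))"
  using det_add_sum_outer_ge[OF assms(1), of UNIV "\<lambda>j. sqrt c *\<^sub>R column j A"] assms(2)
  by (simp add: gram_eq_sum_outer outer_scaleR scaleR_sum_right)

text \<open>The Sherman-Morrison formula, in terms of the quadratic form.\<close>

lemma inv_quad_add_outer:
  assumes "posdef S"
  shows "inv_quad (S + outer a) y
       = inv_quad S y - (cmod (hdot a (matrix_inv S *v y)))\<^sup>2 / (1 + inv_quad S a)"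
proof -
  let ?T = "matrix_inv S"
  define s where "s = complex_of_real (1 + inv_quad S a)"
  define \<beta> where "\<beta> = hdot a (?T *v y)"
  \<comment> \<open>The Sherman-Morrison candidate for the updated inverse applied to
    \<open>y\<close>; it is confirmed by multiplying with \<open>S + outer a\<close>.\<close>
  define z where "z = ?T *v y - (\<beta> / s) *s (?T *v a)"
  note inv = matrix_inv_mult_vec[OF posdef_invertible[OF assms]]
  have s: "s = 1 + hdot a (?T *v a)"
    using hdot_inv_eq(1)[OF assms, of a] by (simp add: s_def)
  have s0: "s \<noteq> 0"
    using hdot_inv_eq(2)[OF assms, of a] unfolding s_def of_real_eq_0_iff by linarith
  have "(S + outer a) *v z = y - (\<beta> / s) *s a + (\<beta> - (\<beta> / s) * (s - 1)) *s a"
    by (simp add: matrix_vector_mult_add_rdistrib outer_mult_vec z_def matrix_vector_mult_diff_distrib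
        vector_scalar_commute inv hdot_diff_right hdot_scale_right \<beta>_def[symmetric] s)
  also have "\<dots> = y"
    using s0 by (simp add: vec_eq_iff field_simps)
  finally have "(S + outer a) *v z = y" .
  then have "matrix_inv (S + outer a) *v y = z"
    using matrix_inv_mult_vec(2)[OF posdef_invertible[OF posdef_add_outer[OF assms, of a]], of z] by simp
  then have "hdot y (matrix_inv (S + outer a) *v y) = hdot y (?T *v y) - (\<beta> / s) * cnj \<beta>"
    by (simp add: z_def hdot_diff_right hdot_scale_right hdot_inv_cnj[OF assms, of y a] \<beta>_def)
  also have "\<dots> = of_real (inv_quad S y - (cmod \<beta>)\<^sup>2 / (1 + inv_quad S a))"
    using hdot_inv_eq(1)[OF assms, of y] complex_norm_square[of \<beta>] by (simp add: s_def)
  finally show ?thesis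
    by (simp add: inv_quad_def[of "S + outer a"] \<beta>_def)
qed

text \<open>Along the line \<open>y - v *s a\<close> the exponent is a quadratic polynomial in the
  complex scalar \<open>v\<close>; its square is completed in
  \<open>nn_integral_gauss_density_shift\<close>.\<close>

lemma inv_quad_diff_scale:
  assumes "posdef S"
  shows "inv_quad S (y - v *s a)
    = inv_quad S y - 2 * Re (cnj v * hdot a (matrix_inv S *v y)) + (cmod v)\<^sup>2 * inv_quad S a"
proof -
  let ?T = "matrix_inv S"
  have "hdot (y - v *s a) (?T *v (y - v *s a)) = hdot y (?T *v y) - cnj v * hdot a (?T *v y)
      - v * cnj (hdot a (?T *v y)) + v * cnj v * hdot a (?T *v a)"
    by (simp add: matrix_vector_mult_diff_distrib vector_scalar_commute hdot_diff_left hdot_diff_right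
        hdot_scale_left hdot_scale_right hdot_inv_cnj[OF assms, of y a] algebra_simps)
  moreover have "v * cnj v * hdot a (?T *v a) = of_real ((cmod v)\<^sup>2 * inv_quad S a)"
    using hdot_inv_eq(1)[OF assms, of a] complex_norm_square[of v] by simp
  ultimately show ?thesis
    by (simp add: inv_quad_def[of S "y - _"] inv_quad_def[of S y])
qed

text \<open>Cramer's rule makes the measurability in the matrix argument evident.\<close>

lemma inv_quad_cramer:
  assumes "invertible S"
  shows "inv_quad S y = Re (\<Sum>k\<in>UNIV. cnj (y $ k) * (det (\<chi> i j. if j = k then y $ i else S $ i $ j) / det S))"
proof -
  have "S *v (matrix_inv S *v y) = y"
    by (rule matrix_inv_mult_vec[OF assms])
  with assms have "matrix_inv S *v y = (\<chi> k. det (\<chi> i j. if j = k then y $ i else S $ i $ j) / det S)"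
    by (subst (asm) cramer) (auto simp: invertible_det_nz)
  then show ?thesis by (simp add: inv_quad_def hdot_def)
qed

section \<open>Complex Gaussian vectors\<close>

lemma borel_measurable_Complex [measurable (raw)]:
  "f \<in> borel_measurable M \<Longrightarrow> g \<in> borel_measurable M \<Longrightarrow> (\<lambda>x. Complex (f x) (g x)) \<in> borel_measurable M"
  by (simp add: borel_measurable_complex_iff)

lemma borel_measurable_vec_nth' [measurable (raw)]:
  fixes f :: "'a \<Rightarrow> 'b::real_normed_vector^'n"
  assumes "f \<in> borel_measurable M"
  shows "(\<lambda>x. f x $ i) \<in> borel_measurable M"
proof -
  have "(\<lambda>x :: 'b^'n. x $ i) \<in> borel_measurable borel"
    by (intro borel_measurable_continuous_onI continuous_intros)
  with assms show ?thesis by (rule measurable_compose)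
qed

lemma borel_measurable_vec_lambda [measurable (raw)]:
  fixes f :: "'n::finite \<Rightarrow> 'a \<Rightarrow> 'b::euclidean_space"
  assumes "\<And>i. f i \<in> borel_measurable M"
  shows "(\<lambda>x. \<chi> i. f i x) \<in> borel_measurable M"
proof (subst borel_measurable_euclidean_space, intro ballI)
  fix b :: "'b^'n" assume "b \<in> Basis"
  then obtain i c where "b = axis i c" "c \<in> Basis" by (auto simp: Basis_vec_def)
  with assms show "(\<lambda>x. (\<chi> i. f i x) \<bullet> b) \<in> borel_measurable M"
    by (simp add: inner_axis)
qed

lemma borel_measurable_vector_scalar_mult [measurable (raw)]:
  "f \<in> borel_measurable M \<Longrightarrow> (\<lambda>x. f x *s (a :: complex^'n::finite)) \<in> borel_measurable M"
  unfolding vector_scalar_mult_def by (intro borel_measurable_vec_lambda) simp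

section \<open>Lebesgue measure on complex scalars and vectors\<close>

lemma lborel_complex: "distr (lborel \<Otimes>\<^sub>M lborel) borel (\<lambda>(a, b). Complex a b) = lborel"
proof (rule lborel_eqI[symmetric])
  fix l u :: complex
  assume *: "\<And>b. b \<in> Basis \<Longrightarrow> l \<bullet> b \<le> u \<bullet> b"
  have "(\<lambda>(a, b). Complex a b) -` box l u = {Re l<..<Re u} \<times> {Im l<..<Im u}"
    by (auto simp: box_def Basis_complex_def)
  then have "emeasure (distr (lborel \<Otimes>\<^sub>M lborel) borel (\<lambda>(a, b). Complex a b)) (box l u)
      = emeasure (lborel \<Otimes>\<^sub>M lborel) ({Re l<..<Re u} \<times> {Im l<..<Im u})"
    by (subst emeasure_distr) (auto simp: space_pair_measure)
  also have "\<dots> = ennreal (Re u - Re l) * ennreal (Im u - Im l)"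
    using *[of 1] *[of \<i>] by (subst lborel.emeasure_pair_measure_Times) (auto simp: Basis_complex_def)
  also have "\<dots> = ennreal (\<Prod>b\<in>Basis. (u - l) \<bullet> b)"
    using *[of 1] *[of \<i>] by (simp add: Basis_complex_def ennreal_mult'')
  finally show "emeasure (distr (lborel \<Otimes>\<^sub>M lborel) borel (\<lambda>(a, b). Complex a b)) (box l u)
    = ennreal (\<Prod>b\<in>Basis. (u - l) \<bullet> b)" .
qed simp

lemma nn_integral_lborel_complex:
  assumes [measurable]: "F \<in> borel_measurable borel"
  shows "(\<integral>\<^sup>+z. F z \<partial>lborel) = (\<integral>\<^sup>+a. \<integral>\<^sup>+b. F (Complex a b) \<partial>lborel \<partial>lborel)"
proof -
  have "(\<integral>\<^sup>+z. F z \<partial>lborel) = (\<integral>\<^sup>+p. F (case p of (a, b) \<Rightarrow> Complex a b) \<partial>(lborel \<Otimes>\<^sub>M lborel))"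
    by (subst lborel_complex[symmetric]) (simp add: nn_integral_distr)
  also have "\<dots> = (\<integral>\<^sup>+a. \<integral>\<^sup>+b. F (Complex a b) \<partial>lborel \<partial>lborel)"
    by (subst lborel.nn_integral_fst[symmetric]) auto
  finally show ?thesis .
qed

lemma prod_Basis_vec:
  "(\<Prod>b\<in>(Basis :: ('a::euclidean_space^'n) set). f b) = (\<Prod>i\<in>UNIV. \<Prod>c\<in>Basis. f (axis i c))"
proof -
  have "(\<Prod>b\<in>(Basis :: ('a^'n) set). f b) = (\<Prod>b\<in>(\<lambda>(i, c). axis i c) ` (UNIV \<times> Basis). f b)"
    by (rule prod.cong) (auto simp: Basis_vec_def)
  also have "\<dots> = (\<Prod>(i, c)\<in>UNIV \<times> Basis. f (axis i c))"
    by (subst prod.reindex) (auto simp: inj_on_def axis_eq_axis split_def intro!: prod.cong)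
  finally show ?thesis by (simp add: prod.cartesian_product)
qed

lemma lborel_vec:
  "distr (\<Pi>\<^sub>M i\<in>UNIV. lborel) borel vec_lambda = (lborel :: ('a::euclidean_space^'n) measure)"
proof (rule lborel_eqI[symmetric])
  interpret product_sigma_finite "\<lambda>i::'n. lborel :: 'a measure" ..
  fix l u :: "'a^'n"
  assume *: "\<And>b. b \<in> Basis \<Longrightarrow> l \<bullet> b \<le> u \<bullet> b"
  then have le: "l $ i \<bullet> c \<le> u $ i \<bullet> c" if "c \<in> Basis" for i c
    using *[of "axis i c"] that by (simp add: inner_axis)
  have "vec_lambda -` box l u = (\<Pi>\<^sub>E i\<in>UNIV. box (l $ i) (u $ i))"
    by (auto simp: box_def Basis_vec_def inner_axis)
  then have "emeasure (distr (\<Pi>\<^sub>M i\<in>UNIV. lborel) borel vec_lambda) (box l u)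
      = emeasure (\<Pi>\<^sub>M i\<in>UNIV. lborel) (\<Pi>\<^sub>E i\<in>UNIV. box (l $ i) (u $ i))"
    by (subst emeasure_distr) (auto simp: space_PiM)
  also have "\<dots> = (\<Prod>i\<in>UNIV. emeasure lborel (box (l $ i) (u $ i)))"
    by (rule emeasure_PiM) auto
  also have "\<dots> = ennreal (\<Prod>b\<in>Basis. (u - l) \<bullet> b)"
    using le by (simp add: prod_Basis_vec inner_axis inner_diff_left prod_ennreal prod_nonneg)
  finally show "emeasure (distr (\<Pi>\<^sub>M i\<in>UNIV. lborel) borel vec_lambda) (box l u)
    = ennreal (\<Prod>b\<in>Basis. (u - l) \<bullet> b)" .
qed simp

section \<open>Complex Gaussian scalars\<close>

lemma sets_cn [measurable_cong]: "sets (cn v) = sets borel"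
  by (simp add: cn_def)

lemma space_cn [simp]: "space (cn v) = UNIV"
  by (simp add: cn_def)

lemma measurable_PiM_cn_component:
  "i \<in> I \<Longrightarrow> (\<lambda>h. h i) \<in> borel_measurable (\<Pi>\<^sub>M i\<in>I. cn (v i))"
  using measurable_component_singleton[of i I "\<lambda>j. cn (v j)"]
  by (simp add: measurable_cong_sets[OF refl sets_cn])

lemma prob_space_cn: "prob_space (cn v)"
proof -
  interpret N: prob_space "density lborel std_normal_density"
    by (rule prob_space_normal_density) simp
  interpret NN: pair_prob_space "density lborel std_normal_density" "density lborel std_normal_density" ..
  show ?thesis
    unfolding cn_def by (rule NN.prob_space_distr) simp
qed

lemma nn_integral_cn:
  assumes [measurable]: "F \<in> borel_measurable borel"
  shows "(\<integral>\<^sup>+z. F z \<partial>cn v) = (\<integral>\<^sup>+a. \<integral>\<^sup>+b. ennreal (std_normal_density a * std_normal_density b) *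
    F (Complex (sqrt (v / 2) * a) (sqrt (v / 2) * b)) \<partial>lborel \<partial>lborel)"
proof -
  interpret N: prob_space "density lborel std_normal_density"
    by (rule prob_space_normal_density) simp
  show ?thesis
    by (simp add: cn_def nn_integral_distr N.nn_integral_fst[symmetric] split_def nn_integral_density
      nn_integral_cmult[symmetric] ennreal_mult' mult_ac)
qed

text \<open>Moves the variance into a factor, which the rank-one updates absorb into the vector. The
  case \<open>v = 0\<close>, where \<open>cn v\<close> has no density, is included.\<close>

lemma cn_scale:
  assumes "v \<ge> 0"
  shows "cn v = distr (cn 1) borel (\<lambda>z. complex_of_real (sqrt v) * z)"
proof -
  have "complex_of_real (sqrt v) * Complex (sqrt (1 / 2) * a) (sqrt (1 / 2) * b)
      = Complex (sqrt (v / 2) * a) (sqrt (v / 2) * b)" for a b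
    using real_sqrt_mult[of v "1 / 2"] by (simp add: complex_eq_iff)
  then show ?thesis
    unfolding cn_def by (subst distr_distr) (auto simp: comp_def split_def)
qed

lemma cn_density:
  assumes "v > 0"
  shows "cn v = density lborel (\<lambda>z. ennreal (exp (- (cmod z)\<^sup>2 / v) / (pi * v)))"
proof (rule measure_eqI)
  fix A assume "A \<in> sets (cn v)"
  then have [measurable]: "A \<in> sets borel" by (simp add: sets_cn)
  let ?s = "sqrt (v / 2)"
  let ?f = "\<lambda>z. ennreal (exp (- (cmod z)\<^sup>2 / v) / (pi * v)) * indicator A z"
  have s: "?s > 0" "?s * ?s = v / 2" using assms by (auto simp: power2_eq_square[symmetric])
  \<comment> \<open>Scaling both real coordinates by \<open>?s\<close> contributes the factor
    \<open>v / 2\<close>, which turns 1 / (pi v) into the constant 1 / (2 pi) of two standard normal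
    densities.\<close>
  have eq: "ennreal \<bar>?s\<bar> * (ennreal \<bar>?s\<bar> * ?f (Complex (?s * a) (?s * b)))
     = ennreal (std_normal_density a * std_normal_density b) * indicator A (Complex (?s * a) (?s * b))" for a b
  proof -
    have "(?s * a)\<^sup>2 = v / 2 * a\<^sup>2" "(?s * b)\<^sup>2 = v / 2 * b\<^sup>2"
      using assms by (simp_all add: power_mult_distrib)
    then have "(cmod (Complex (?s * a) (?s * b)))\<^sup>2 / v = a\<^sup>2 / 2 + b\<^sup>2 / 2"
      unfolding cmod_power2 complex.sel using assms by (simp add: field_simps)
    then have e: "- (cmod (Complex (?s * a) (?s * b)))\<^sup>2 / v = - a\<^sup>2 / 2 + - b\<^sup>2 / 2"
      by simp
    have "?s * (?s * (exp (- (cmod (Complex (?s * a) (?s * b)))\<^sup>2 / v) / (pi * v)))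
      = std_normal_density a * std_normal_density b"
      unfolding e exp_add std_normal_density_def mult.assoc[symmetric] s using assms
      by (simp add: field_simps)
    then show ?thesis
      using s by (simp add: ennreal_mult'[symmetric] mult.assoc[symmetric])
  qed
  have "emeasure (cn v) A = (\<integral>\<^sup>+z. indicator A z \<partial>cn v)"
    by (simp add: sets_cn)
  also have "\<dots> = (\<integral>\<^sup>+a. \<integral>\<^sup>+b. ennreal \<bar>?s\<bar> * (ennreal \<bar>?s\<bar> * ?f (Complex (?s * a) (?s * b))) \<partial>lborel \<partial>lborel)"
    by (subst nn_integral_cn) (simp_all only: eq, measurable)
  also have "\<dots> = (\<integral>\<^sup>+a. ennreal \<bar>?s\<bar> * (\<integral>\<^sup>+b. ennreal \<bar>?s\<bar> * ?f (Complex (?s * a) (?s * b)) \<partial>lborel) \<partial>lborel)"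
    by (subst nn_integral_cmult) auto
  also have "\<dots> = (\<integral>\<^sup>+a. ennreal \<bar>?s\<bar> * (\<integral>\<^sup>+b. ?f (Complex (?s * a) b) \<partial>lborel) \<partial>lborel)"
    using s nn_integral_real_affine[of "\<lambda>b. ?f (Complex (?s * _) b)" ?s 0]
    by (subst nn_integral_cmult[symmetric]) (auto simp: nn_integral_cmult)
  also have "\<dots> = (\<integral>\<^sup>+a. \<integral>\<^sup>+b. ?f (Complex a b) \<partial>lborel \<partial>lborel)"
    using s nn_integral_real_affine[of "\<lambda>a. \<integral>\<^sup>+b. ?f (Complex a b) \<partial>lborel" ?s 0]
    by (simp add: nn_integral_cmult)
  also have "\<dots> = emeasure (density lborel (\<lambda>z. ennreal (exp (- (cmod z)\<^sup>2 / v) / (pi * v)))) A"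
    by (subst nn_integral_lborel_complex[symmetric]) (simp_all add: emeasure_density)
  finally show "emeasure (cn v) A = emeasure (density lborel (\<lambda>z. ennreal (exp (- (cmod z)\<^sup>2 / v) / (pi * v)))) A" .
qed (simp add: sets_cn)

text \<open>Translation removes \<open>b\<close>; the value is then read off from the total mass 1
  of \<open>cn (1 / s)\<close>.\<close>

lemma gaussian_integral_complex:
  assumes "s > 0"
  shows "(\<integral>\<^sup>+v. ennreal (exp (- s * (cmod (v - b))\<^sup>2)) \<partial>lborel) = ennreal (pi / s)"
proof -
  interpret prob_space "cn (1 / s)" by (rule prob_space_cn)
  have "(\<integral>\<^sup>+v. ennreal (exp (- s * (cmod (v - b))\<^sup>2)) \<partial>lborel)
      = (\<integral>\<^sup>+v. ennreal (exp (- s * (cmod (v - b))\<^sup>2)) \<partial>distr lborel borel ((+) b))"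
    by (simp add: lborel_distr_plus)
  also have "\<dots> = (\<integral>\<^sup>+v. ennreal (exp (- s * (cmod v)\<^sup>2)) \<partial>lborel)"
    by (subst nn_integral_distr) auto
  also have "\<dots> = (\<integral>\<^sup>+v. ennreal (pi / s) * ennreal (exp (- (cmod v)\<^sup>2 / (1 / s)) / (pi * (1 / s))) \<partial>lborel)"
    using assms by (intro nn_integral_cong) (simp add: ennreal_mult'[symmetric] mult.commute)
  also have "\<dots> = ennreal (pi / s) * (\<integral>\<^sup>+v. 1 \<partial>cn (1 / s))"
    using assms
    by (subst nn_integral_cmult, simp, subst cn_density, simp, subst nn_integral_density) simp_all
  also have "\<dots> = ennreal (pi / s)"
    using emeasure_space_1 by (simp del: space_cn)
  finally show ?thesis .
qed

lemma measure_eqI_nn_integral: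
  assumes "sets M = sets borel" "sets N = sets borel"
    and "\<And>F. F \<in> borel_measurable borel \<Longrightarrow> (\<integral>\<^sup>+x. F x \<partial>M) = (\<integral>\<^sup>+x. F x \<partial>N)"
  shows "M = N"
proof (rule measure_eqI)
  fix A assume A: "A \<in> sets M"
  then have "(\<integral>\<^sup>+x. indicator A x \<partial>M) = (\<integral>\<^sup>+x. indicator A x \<partial>N)"
    using assms by (intro assms(3)) auto
  with A assms show "emeasure M A = emeasure N A" by simp
qed (use assms in simp)

lemma measurable_vec_lambda_PiM [measurable]:
  assumes "\<And>i. sets (M i) = sets borel"
  shows "(vec_lambda :: _ \<Rightarrow> complex^'n) \<in> borel_measurable (\<Pi>\<^sub>M i\<in>UNIV. M i)"
proof -
  have "(\<lambda>f. f i) \<in> borel_measurable (\<Pi>\<^sub>M i\<in>UNIV. M i)" for i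
    using measurable_component_singleton[of i UNIV M] by (simp add: measurable_cong_sets[OF refl assms])
  from borel_measurable_vec_lambda[where f="\<lambda>i f. f i", OF this] show ?thesis by simp
qed

section \<open>Densities of complex Gaussian vectors\<close>

lemma sets_cn_vec [measurable_cong]: "sets (cn_vec v) = sets borel"
  by (simp add: cn_vec_def)

lemma space_cn_vec [simp]: "space (cn_vec v) = UNIV"
  by (simp add: cn_vec_def)

lemma prob_space_cn_vec: "prob_space (cn_vec v)"
proof -
  interpret product_prob_space "\<lambda>i. cn (v i)" UNIV
    by (intro product_prob_spaceI prob_space_cn)
  show ?thesis
    unfolding cn_vec_def by (intro prob_space_distr measurable_vec_lambda_PiM) (simp add: sets_cn)
qed

text \<open>The circularly symmetric normalisation: real and imaginary parts share each variance, so
  there is no 1/2 in the exponent and no square root of the determinant.\<close>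

definition gauss_density :: "complex^'n^'n \<Rightarrow> complex^'n \<Rightarrow> real" where
  "gauss_density S y = exp (- inv_quad S y) / (pi ^ CARD('n) * Re (det S))"

definition gauss_measure :: "complex^'n^'n \<Rightarrow> (complex^'n) measure" where
  "gauss_measure S = density lborel (\<lambda>y. ennreal (gauss_density S y))"

lemma measurable_inv_quad [measurable]: "inv_quad S \<in> borel_measurable borel"
proof -
  have "continuous_on UNIV (\<lambda>y. inv_quad S y)"
    unfolding inv_quad_def hdot_def matrix_vector_mult_def by (simp, intro continuous_intros)
  then show ?thesis by (rule borel_measurable_continuous_onI)
qed

lemma measurable_gauss_density [measurable]: "gauss_density S \<in> borel_measurable borel"
  unfolding gauss_density_def[abs_def] by measurable

lemma sets_gauss_measure [measurable_cong]: "sets (gauss_measure S) = sets borel"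
  and space_gauss_measure [simp]: "space (gauss_measure S) = UNIV"
  by (simp_all add: gauss_measure_def)

lemma gauss_density_pos: "posdef S \<Longrightarrow> 0 < gauss_density S y"
  using posdef_det[of S] by (auto simp: gauss_density_def intro!: divide_pos_pos mult_pos_pos)

lemma inv_quad_mat:
  assumes "c > 0"
  shows "inv_quad (mat (complex_of_real c)) y = (\<Sum>i\<in>UNIV. (cmod (y $ i))\<^sup>2 / c)"
proof -
  have "mat (complex_of_real c) *v (complex_of_real (1 / c) *s y) = y"
    using assms by (simp add: mat_mult_vec)
  with matrix_inv_mult_vec(2)[OF posdef_invertible[OF posdef_scalar[OF assms]], of "complex_of_real (1 / c) *s y"]
  have "matrix_inv (mat (complex_of_real c)) *v y = complex_of_real (1 / c) *s y" by simp
  then show ?thesis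
    by (simp add: inv_quad_def hdot_scale_right hdot_self sum_divide_distrib)
qed

lemma nn_integral_vec_lborel:
  fixes F :: "'a::euclidean_space^'n \<Rightarrow> ennreal"
  assumes [measurable]: "F \<in> borel_measurable borel"
  shows "(\<integral>\<^sup>+x. F x \<partial>lborel) = (\<integral>\<^sup>+x. F (vec_lambda x) \<partial>(\<Pi>\<^sub>M i\<in>UNIV. lborel))"
proof -
  have "(vec_lambda :: _ \<Rightarrow> 'a^'n) \<in> borel_measurable (\<Pi>\<^sub>M i\<in>UNIV. lborel)"
  proof -
    have "(\<lambda>f :: 'n \<Rightarrow> 'a. f i) \<in> borel_measurable (\<Pi>\<^sub>M i\<in>UNIV. lborel)" for i
      using measurable_component_singleton[of i UNIV "\<lambda>_. lborel :: 'a measure"] by simp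
    from borel_measurable_vec_lambda[where f="\<lambda>i f. f i", OF this] show ?thesis by simp
  qed
  then show ?thesis
    by (subst lborel_vec[symmetric]) (simp add: nn_integral_distr)
qed

text \<open>Base case for inductions over \<open>posdef\<close>: for a multiple of the identity the
  density factorises over the coordinates.\<close>

lemma gauss_measure_mat:
  assumes "c > 0"
  shows "gauss_measure (mat (complex_of_real c)) = cn_vec (\<lambda>_::'n::finite. c)"
proof -
  interpret P: product_sigma_finite "\<lambda>i::'n. lborel :: complex measure" ..
  interpret C: product_prob_space "\<lambda>i::'n. cn c" UNIV
    by (intro product_prob_spaceI prob_space_cn)
  let ?g = "\<lambda>z. ennreal (exp (- (cmod z)\<^sup>2 / c) / (pi * c))"
  let ?S = "mat (complex_of_real c) :: complex^'n^'n"
  have g: "ennreal (gauss_density ?S y) = (\<Prod>i\<in>UNIV. ?g (y $ i))" for y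
  proof -
    have "gauss_density ?S y = (\<Prod>i\<in>UNIV. exp (- (cmod (y $ i))\<^sup>2 / c) / (pi * c))"
      using assms by (simp add: gauss_density_def inv_quad_mat det_mat prod_dividef exp_sum power_mult_distrib
          sum_negf[symmetric] flip: of_real_power)
    then show ?thesis using assms by (simp add: prod_ennreal)
  qed
  have nth: "(($) :: complex^'n \<Rightarrow> _) \<in> measurable borel (\<Pi>\<^sub>M i\<in>UNIV. cn c)"
    by (rule measurable_PiM_single') (auto simp: sets_cn cong: measurable_cong_sets)
  \<comment> \<open>The comparison takes place on functions rather than vectors, where a product
    measure is determined by its values on rectangles; \<open>vec_lambda\<close> then transports the
    equality back.\<close>
  have "distr (gauss_measure ?S) (\<Pi>\<^sub>M i\<in>UNIV. cn c) ($) = (\<Pi>\<^sub>M i\<in>UNIV. cn c)"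
  proof (rule C.PiM_eqI)
    fix A :: "'n \<Rightarrow> complex set" assume "\<And>i. i \<in> UNIV \<Longrightarrow> A i \<in> sets (cn c)"
    then have A [measurable]: "A i \<in> sets borel" for i by (simp add: sets_cn)
    have "emeasure (distr (gauss_measure ?S) (\<Pi>\<^sub>M i\<in>UNIV. cn c) ($)) (Pi\<^sub>E UNIV A)
       = (\<integral>\<^sup>+y. indicator (Pi\<^sub>E UNIV A) (($) y) \<partial>gauss_measure ?S)"
      using nth A by (subst nn_integral_distr[symmetric, where T="($)" and M="gauss_measure ?S" and M'="\<Pi>\<^sub>M i\<in>UNIV. cn c"])
        (auto simp: sets_cn gauss_measure_def intro!: sets_PiM_I_finite)
    also have "\<dots> = (\<integral>\<^sup>+y. (\<Prod>i\<in>UNIV. indicator (A i) (y $ i)) \<partial>gauss_measure ?S)"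
      by (intro nn_integral_cong) (auto simp: indicator_def PiE_iff)
    also have "\<dots> = (\<integral>\<^sup>+y. (\<Prod>i\<in>UNIV. ?g (y $ i) * indicator (A i) (y $ i)) \<partial>lborel)"
      by (simp add: gauss_measure_def nn_integral_density g prod.distrib)
    also have "\<dots> = (\<integral>\<^sup>+y. (\<Prod>i\<in>UNIV. ?g (y i) * indicator (A i) (y i)) \<partial>(\<Pi>\<^sub>M i\<in>UNIV. lborel))"
      by (subst nn_integral_vec_lborel) auto
    also have "\<dots> = (\<Prod>i\<in>UNIV. (\<integral>\<^sup>+z. ?g z * indicator (A i) z \<partial>lborel))"
      by (rule P.product_nn_integral_prod) auto
    also have "\<dots> = (\<Prod>i\<in>UNIV. emeasure (cn c) (A i))"
      using assms by (simp add: cn_density emeasure_density)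
    finally show "emeasure (distr (gauss_measure ?S) (\<Pi>\<^sub>M i\<in>UNIV. cn c) ($)) (Pi\<^sub>E UNIV A)
       = (\<Prod>i\<in>UNIV. emeasure (cn c) (A i))" .
  qed auto
  then have "cn_vec (\<lambda>_::'n. c) = distr (distr (gauss_measure ?S) (\<Pi>\<^sub>M i\<in>UNIV. cn c) ($)) borel vec_lambda"
    by (simp add: cn_vec_def)
  also have "\<dots> = distr (gauss_measure ?S) borel (vec_lambda \<circ> ($))"
    using nth by (intro distr_distr measurable_vec_lambda_PiM) (simp_all add: sets_cn gauss_measure_def)
  also have "\<dots> = gauss_measure ?S"
    by (simp add: comp_def gauss_measure_def distr_id2)
  finally show ?thesis ..
qed

text \<open>Adding an independent scalar \<open>v\<close> along \<open>a\<close> updates the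
  covariance by \<open>outer a\<close>. Completing the square in \<open>v\<close> leaves the
  Sherman-Morrison exponent, and the remaining scalar integral supplies the factor demanded by the
  matrix determinant lemma.\<close>

lemma nn_integral_gauss_density_shift:
  assumes S: "posdef S"
  shows "(\<integral>\<^sup>+v. ennreal (gauss_density S (y - v *s a)) \<partial>cn 1) = ennreal (gauss_density (S + outer a) y)"
proof -
  define s where "s = 1 + inv_quad S a"
  define b where "b = hdot a (matrix_inv S *v y)"
  define C where "C = pi ^ CARD('a) * Re (det S)"
  have s: "s > 0" using hdot_inv_eq(2)[OF S, of a] by (simp add: s_def)
  have C: "C > 0" using posdef_det[OF S] by (simp add: C_def)
  have det: "Re (det (S + outer a)) = Re (det S) * s"
    using det_posdef_add_outer[OF S, of a] posdef_det[OF S] by (simp add: s_def)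
  \<comment> \<open>The coefficient of |v|^2 is \<open>s\<close>, with 1 coming from the density of
    \<open>cn 1\<close> and the rest from \<open>inv_quad_diff_scale\<close>; the linear term puts
    the centre at \<open>b / s\<close>.\<close>
  have sq: "- (cmod v)\<^sup>2 + - inv_quad S (y - v *s a)
     = - s * (cmod (v - b / of_real s))\<^sup>2 + - inv_quad (S + outer a) y" for v
  proof -
    have "(cmod (v - b / of_real s))\<^sup>2 = (cmod v)\<^sup>2 - 2 * Re (cnj v * b) / s + (cmod b)\<^sup>2 / s\<^sup>2"
      using s unfolding cmod_power2
      by (simp add: field_simps power2_eq_square Re_divide_of_real Im_divide_of_real)
    then have "s * (cmod (v - b / of_real s))\<^sup>2 = s * (cmod v)\<^sup>2 - 2 * Re (cnj v * b) + (cmod b)\<^sup>2 / s"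
      using s by (simp add: field_simps power2_eq_square)
    then show ?thesis
      unfolding inv_quad_diff_scale[OF S] inv_quad_add_outer[OF S] b_def[symmetric] s_def[symmetric]
      by (simp add: s_def algebra_simps)
  qed
  have "(\<integral>\<^sup>+v. ennreal (gauss_density S (y - v *s a)) \<partial>cn 1)
      = (\<integral>\<^sup>+v. ennreal (exp (- (cmod v)\<^sup>2) / pi) * ennreal (gauss_density S (y - v *s a)) \<partial>lborel)"
    by (subst cn_density, simp, subst nn_integral_density) (auto simp: vector_scalar_mult_def)
  also have "\<dots> = (\<integral>\<^sup>+v. ennreal (exp (- inv_quad (S + outer a) y) / (pi * C)) *
        ennreal (exp (- s * (cmod (v - b / of_real s))\<^sup>2)) \<partial>lborel)"
  proof (intro nn_integral_cong)
    fix v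
    have "exp (- (cmod v)\<^sup>2) / pi * gauss_density S (y - v *s a) = exp (- (cmod v)\<^sup>2 + - inv_quad S (y - v *s a)) / (pi * C)"
      by (simp add: gauss_density_def C_def exp_add[symmetric])
    also have "\<dots> = exp (- inv_quad (S + outer a) y) / (pi * C) * exp (- s * (cmod (v - b / of_real s))\<^sup>2)"
      unfolding sq exp_add by simp
    finally show "ennreal (exp (- (cmod v)\<^sup>2) / pi) * ennreal (gauss_density S (y - v *s a)) =
      ennreal (exp (- inv_quad (S + outer a) y) / (pi * C)) * ennreal (exp (- s * (cmod (v - b / of_real s))\<^sup>2))"
      using C by (simp add: ennreal_mult'[symmetric])
  qed
  \<comment> \<open>Of pi / s, the pi cancels the normalisation of \<open>cn 1\<close>, while 1 / s
    changes the determinant of \<open>S\<close> into that of \<open>S + outer a\<close>.\<close>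
  also have "\<dots> = ennreal (exp (- inv_quad (S + outer a) y) / (pi * C)) * ennreal (pi / s)"
    using gaussian_integral_complex[OF s, of "b / of_real s"] by (simp add: nn_integral_cmult)
  also have "\<dots> = ennreal (gauss_density (S + outer a) y)"
    using C s by (simp add: ennreal_mult'[symmetric] gauss_density_def det C_def mult_ac)
  finally show ?thesis .
qed

lemma nn_integral_gauss_measure_translate:
  assumes [measurable]: "F \<in> borel_measurable borel"
  shows "(\<integral>\<^sup>+w. F (s + w) \<partial>gauss_measure S) = (\<integral>\<^sup>+y. ennreal (gauss_density S (y - s)) * F y \<partial>lborel)"
proof -
  have "(\<integral>\<^sup>+y. ennreal (gauss_density S (y - s)) * F y \<partial>lborel)
    = (\<integral>\<^sup>+y. ennreal (gauss_density S (y - s)) * F y \<partial>distr lborel borel ((+) s))"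
    by (simp add: lborel_distr_plus)
  also have "\<dots> = (\<integral>\<^sup>+w. ennreal (gauss_density S w) * F (s + w) \<partial>lborel)"
    by (subst nn_integral_distr) auto
  finally show ?thesis by (simp add: gauss_measure_def nn_integral_density)
qed

lemma nn_integral_gauss_measure_add_outer:
  assumes S: "posdef S" and F [measurable]: "F \<in> borel_measurable borel"
  shows "(\<integral>\<^sup>+v. \<integral>\<^sup>+w. F (v *s a + w) \<partial>gauss_measure S \<partial>cn 1) = (\<integral>\<^sup>+w. F w \<partial>gauss_measure (S + outer a))"
proof -
  interpret C: prob_space "cn 1" by (rule prob_space_cn)
  interpret P: pair_sigma_finite "cn 1" lborel ..
  have "(\<integral>\<^sup>+v. \<integral>\<^sup>+w. F (v *s a + w) \<partial>gauss_measure S \<partial>cn 1)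
     = (\<integral>\<^sup>+v. \<integral>\<^sup>+w. ennreal (gauss_density S (w - v *s a)) * F w \<partial>lborel \<partial>cn 1)"
    by (simp add: nn_integral_gauss_measure_translate)
  also have "\<dots> = (\<integral>\<^sup>+w. \<integral>\<^sup>+v. ennreal (gauss_density S (w - v *s a)) * F w \<partial>cn 1 \<partial>lborel)"
    by (rule P.Fubini'[symmetric]) measurable
  also have "\<dots> = (\<integral>\<^sup>+w. ennreal (gauss_density (S + outer a) w) * F w \<partial>lborel)"
    by (intro nn_integral_cong, subst nn_integral_multc) (simp_all add: nn_integral_gauss_density_shift[OF S])
  also have "\<dots> = (\<integral>\<^sup>+w. F w \<partial>gauss_measure (S + outer a))"
    by (simp add: gauss_measure_def nn_integral_density)
  finally show ?thesis .
qed

text \<open>Convolution with a probability law preserves the total mass, so the constant integrand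
  in \<open>nn_integral_gauss_measure_add_outer\<close> replaces the evaluation of a multivariate
  Gaussian integral.\<close>

lemma prob_space_gauss_measure: "posdef S \<Longrightarrow> prob_space (gauss_measure S)"
proof (induction rule: posdef.induct)
  case (posdef_scalar c)
  then show ?case by (simp add: gauss_measure_mat prob_space_cn_vec)
next
  case (posdef_add_outer S a)
  interpret prob_space "gauss_measure S" by fact
  interpret C: prob_space "cn 1" by (rule prob_space_cn)
  from nn_integral_gauss_measure_add_outer[OF posdef_add_outer(1), of "\<lambda>_. 1" a] show ?case
    by (intro prob_spaceI) (simp add: emeasure_space_1[simplified] C.emeasure_space_1[simplified])
qed

lemma nn_integral_gauss_measure_add_cn:
  assumes S: "posdef S" and F [measurable]: "F \<in> borel_measurable borel" and v: "v \<ge> 0"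
  shows "(\<integral>\<^sup>+z. \<integral>\<^sup>+w. F (z *s a + w) \<partial>gauss_measure S \<partial>cn v) = (\<integral>\<^sup>+w. F w \<partial>gauss_measure (S + v *\<^sub>R outer a))"
proof -
  interpret prob_space "gauss_measure S" using prob_space_gauss_measure[OF S] .
  have "(\<integral>\<^sup>+z. \<integral>\<^sup>+w. F (z *s a + w) \<partial>gauss_measure S \<partial>cn v)
     = (\<integral>\<^sup>+z. \<integral>\<^sup>+w. F ((complex_of_real (sqrt v) * z) *s a + w) \<partial>gauss_measure S \<partial>cn 1)"
    unfolding cn_scale[OF v] by (subst nn_integral_distr) auto
  also have "\<dots> = (\<integral>\<^sup>+z. \<integral>\<^sup>+w. F (z *s (sqrt v *\<^sub>R a) + w) \<partial>gauss_measure S \<partial>cn 1)"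
    by (simp add: vector_scalar_mult_def scaleR_vec_def scaleR_conv_of_real mult_ac)
  also have "\<dots> = (\<integral>\<^sup>+w. F w \<partial>gauss_measure (S + v *\<^sub>R outer a))"
    using v by (simp add: nn_integral_gauss_measure_add_outer[OF S] outer_scaleR)
  finally show ?thesis .
qed

lemma posdef_add_sum_scaleR_outer:
  assumes "posdef S" "finite J" "\<And>j. j \<in> J \<Longrightarrow> 0 \<le> v j"
  shows "posdef (S + (\<Sum>j\<in>J. v j *\<^sub>R outer (a j)))"
proof -
  have "(\<Sum>j\<in>J. v j *\<^sub>R outer (a j)) = (\<Sum>j\<in>J. outer (sqrt (v j) *\<^sub>R a j))"
    using assms(3) by (simp add: outer_scaleR)
  then show ?thesis using posdef_add_sum_outer[OF assms(1,2), of "\<lambda>j. sqrt (v j) *\<^sub>R a j"] by simp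
qed

lemma nn_integral_gauss_measure_add_cn_sum:
  assumes S: "posdef S" and F [measurable]: "F \<in> borel_measurable borel"
    and v: "\<And>j. v j \<ge> 0" and J: "finite J"
  shows "(\<integral>\<^sup>+x. \<integral>\<^sup>+w. F ((\<Sum>j\<in>J. x j *s a j) + w) \<partial>gauss_measure S \<partial>(\<Pi>\<^sub>M j\<in>J. cn (v j)))
       = (\<integral>\<^sup>+w. F w \<partial>gauss_measure (S + (\<Sum>j\<in>J. v j *\<^sub>R outer (a j))))"
  using J F
\<comment> \<open>\<open>F\<close> is generalised because splitting off coordinate \<open>k\<close>
  leaves the translated integrand \<open>F (z *s a k + _)\<close> for the induction
  hypothesis.\<close>
proof (induction J arbitrary: F rule: finite_induct)
  case empty
  then show ?case
    by (simp add: PiM_empty nn_integral_count_space_finite)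
next
  case (insert k J)
  note [measurable] = insert.prems
  interpret P: product_prob_space "\<lambda>j. cn (v j)" UNIV
    by (intro product_prob_spaceI prob_space_cn)
  have p: "posdef (S + (\<Sum>j\<in>J. v j *\<^sub>R outer (a j)))"
    by (rule posdef_add_sum_scaleR_outer[OF S insert(1) v])
  interpret prob_space "gauss_measure S" using prob_space_gauss_measure[OF S] .
  have c': "(\<lambda>x. \<Sum>j\<in>I. x j *s a j) \<in> borel_measurable (\<Pi>\<^sub>M j\<in>I. cn (v j))" for I
    by (intro borel_measurable_sum borel_measurable_vector_scalar_mult measurable_PiM_cn_component)
  note c'[measurable]
  have "(\<integral>\<^sup>+x. \<integral>\<^sup>+w. F ((\<Sum>j\<in>insert k J. x j *s a j) + w) \<partial>gauss_measure S \<partial>(\<Pi>\<^sub>M j\<in>insert k J. cn (v j)))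
    = (\<integral>\<^sup>+z. \<integral>\<^sup>+x. \<integral>\<^sup>+w. F ((\<Sum>j\<in>insert k J. (x(k := z)) j *s a j) + w) \<partial>gauss_measure S \<partial>(\<Pi>\<^sub>M j\<in>J. cn (v j)) \<partial>cn (v k))"
    by (rule P.product_nn_integral_insert_rev[OF insert(1,2)]) measurable
  also have "\<dots> = (\<integral>\<^sup>+z. \<integral>\<^sup>+x. \<integral>\<^sup>+w. F (z *s a k + ((\<Sum>j\<in>J. x j *s a j) + w)) \<partial>gauss_measure S \<partial>(\<Pi>\<^sub>M j\<in>J. cn (v j)) \<partial>cn (v k))"
  proof -
    have "(\<Sum>j\<in>insert k J. (x(k := z)) j *s a j) = z *s a k + (\<Sum>j\<in>J. x j *s a j)" for x :: "_ \<Rightarrow> complex" and z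
      using insert(1,2) by (simp add: sum.insert) (intro sum.cong, auto)
    then show ?thesis by (simp only: add.assoc)
  qed
  also have "\<dots> = (\<integral>\<^sup>+z. \<integral>\<^sup>+w. F (z *s a k + w) \<partial>gauss_measure (S + (\<Sum>j\<in>J. v j *\<^sub>R outer (a j))) \<partial>cn (v k))"
    by (intro nn_integral_cong insert.IH) measurable
  also have "\<dots> = (\<integral>\<^sup>+w. F w \<partial>gauss_measure (S + (\<Sum>j\<in>insert k J. v j *\<^sub>R outer (a j))))"
    using insert(1,2) nn_integral_gauss_measure_add_cn[OF p insert.prems v, of k "a k"] by (simp add: add_ac)
  finally show ?case .
qed

text \<open>\<open>A *v x\<close> is the sum of the columns of \<open>A\<close> weighted by the
  independent entries of \<open>x\<close>, so every entry contributes one rank-one update.\<close>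

lemma nn_integral_gauss_measure_add_cn_vec:
  fixes A :: "complex^'j^'n"
  assumes S: "posdef S" and F [measurable]: "F \<in> borel_measurable borel" and v: "\<And>j. v j \<ge> 0"
  shows "(\<integral>\<^sup>+x. \<integral>\<^sup>+w. F (A *v x + w) \<partial>gauss_measure S \<partial>cn_vec v)
       = (\<integral>\<^sup>+w. F w \<partial>gauss_measure (S + (\<Sum>j\<in>UNIV. v j *\<^sub>R outer (column j A))))"
proof -
  interpret prob_space "gauss_measure S" using prob_space_gauss_measure[OF S] .
  have [measurable]: "(\<lambda>x. A *v x) \<in> borel_measurable borel"
    unfolding matrix_vector_mult_def by measurable
  have "(\<integral>\<^sup>+x. \<integral>\<^sup>+w. F (A *v x + w) \<partial>gauss_measure S \<partial>cn_vec v)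
     = (\<integral>\<^sup>+x. \<integral>\<^sup>+w. F (A *v vec_lambda x + w) \<partial>gauss_measure S \<partial>(\<Pi>\<^sub>M j\<in>UNIV. cn (v j)))"
    unfolding cn_vec_def by (subst nn_integral_distr) (auto simp: sets_cn)
  also have "\<dots> = (\<integral>\<^sup>+x. \<integral>\<^sup>+w. F ((\<Sum>j\<in>UNIV. x j *s column j A) + w) \<partial>gauss_measure S \<partial>(\<Pi>\<^sub>M j\<in>UNIV. cn (v j)))"
    by (simp add: matrix_mult_sum)
  also have "\<dots> = (\<integral>\<^sup>+w. F w \<partial>gauss_measure (S + (\<Sum>j\<in>UNIV. v j *\<^sub>R outer (column j A))))"
    by (rule nn_integral_gauss_measure_add_cn_sum[OF S F v]) simp
  finally show ?thesis .
qed

lemma nn_integral_gauss_measure_add_cn_vec_const: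
  fixes A :: "complex^'j^'n"
  assumes "posdef S" and "F \<in> borel_measurable borel" and "v \<ge> 0"
  shows "(\<integral>\<^sup>+x. \<integral>\<^sup>+w. F (A *v x + w) \<partial>gauss_measure S \<partial>cn_vec (\<lambda>_. v))
       = (\<integral>\<^sup>+w. F w \<partial>gauss_measure (S + v *\<^sub>R (A ** ctranspose A)))"
  using nn_integral_gauss_measure_add_cn_vec[OF assms(1,2), of "\<lambda>_. v" A] assms(3)
  by (simp add: gram_eq_sum_outer scaleR_sum_right)

section \<open>Second moments\<close>

lemma borel_measurable_cnj [measurable (raw)]:
  "f \<in> borel_measurable M \<Longrightarrow> (\<lambda>x. cnj (f x)) \<in> borel_measurable M"
  by (simp add: borel_measurable_complex_iff)

text \<open>Integrability is part of the notion, because \<open>second_moment\<close> gives 0 for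
  entries that are not integrable. No centring is included: it is required separately, through
  \<open>centred\<close>, where cross terms have to vanish.\<close>

definition has_cov :: "'a measure \<Rightarrow> ('a \<Rightarrow> complex^'i) \<Rightarrow> complex^'i^'i \<Rightarrow> bool" where
  "has_cov M X Q \<longleftrightarrow> X \<in> borel_measurable M \<and>
     (\<forall>i j. has_bochner_integral M (\<lambda>\<omega>. X \<omega> $ i * cnj (X \<omega> $ j)) (Q $ i $ j))"

definition centred :: "'a measure \<Rightarrow> ('a \<Rightarrow> complex^'i) \<Rightarrow> bool" where
  "centred M X \<longleftrightarrow> (\<forall>i. has_bochner_integral M (\<lambda>\<omega>. X \<omega> $ i) 0)"

definition diag :: "('i \<Rightarrow> real) \<Rightarrow> complex^'i^'i" where
  "diag v = (\<chi> i j. if i = j then complex_of_real (v i) else 0)"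

lemma has_cov_second_moment: "has_cov M X Q \<Longrightarrow> second_moment M X = Q"
  by (auto simp: has_cov_def second_moment_def vec_eq_iff dest: has_bochner_integral_integral_eq)

lemma has_cov_measurable: "has_cov M X Q \<Longrightarrow> X \<in> borel_measurable M"
  by (simp add: has_cov_def)

lemma has_covD: "has_cov M X Q \<Longrightarrow> has_bochner_integral M (\<lambda>\<omega>. X \<omega> $ i * cnj (X \<omega> $ j)) (Q $ i $ j)"
  by (simp add: has_cov_def)

lemma integrable_mult_cnj:
  fixes f g :: "'a \<Rightarrow> complex"
  assumes [measurable]: "f \<in> borel_measurable M" "g \<in> borel_measurable M"
    and "integrable M (\<lambda>x. (cmod (f x))\<^sup>2)" "integrable M (\<lambda>x. (cmod (g x))\<^sup>2)"
  shows "integrable M (\<lambda>x. f x * cnj (g x))"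
proof (rule Bochner_Integration.integrable_bound)
  show "integrable M (\<lambda>x. (cmod (f x))\<^sup>2 + (cmod (g x))\<^sup>2)" using assms by auto
  have "cmod (f x) * cmod (g x) \<le> (cmod (f x))\<^sup>2 + (cmod (g x))\<^sup>2" for x
    using sum_squares_bound[of "cmod (f x)" "cmod (g x)"]
      mult_nonneg_nonneg[OF norm_ge_zero norm_ge_zero, of "f x" "g x"] by linarith
  then show "AE x in M. norm (f x * cnj (g x)) \<le> norm ((cmod (f x))\<^sup>2 + (cmod (g x))\<^sup>2)"
    by (simp add: norm_mult)
qed measurable

lemma has_cov_integrable_sq:
  assumes "has_cov M X Q"
  shows "integrable M (\<lambda>\<omega>. (cmod (X \<omega> $ i))\<^sup>2)"
proof -
  have "integrable M (\<lambda>\<omega>. Re (X \<omega> $ i * cnj (X \<omega> $ i)))"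
    using has_covD[OF assms, of i i] by (intro integrable_Re) (simp add: has_bochner_integral_iff)
  then show ?thesis by (simp add: complex_norm_square[symmetric])
qed

lemma has_covI:
  assumes "X \<in> borel_measurable M" "\<And>i. integrable M (\<lambda>\<omega>. (cmod (X \<omega> $ i))\<^sup>2)"
    "\<And>i j. (\<integral>\<omega>. X \<omega> $ i * cnj (X \<omega> $ j) \<partial>M) = Q $ i $ j"
  shows "has_cov M X Q"
proof -
  note [measurable] = assms(1)
  show ?thesis
    using assms by (auto simp: has_cov_def has_bochner_integral_iff intro!: integrable_mult_cnj)
qed

lemma has_bochner_integral_distr_iff:
  fixes f :: "'b \<Rightarrow> 'c::{banach, second_countable_topology}"
  assumes "T \<in> measurable M N" "f \<in> borel_measurable N"
  shows "has_bochner_integral (distr M N T) f a \<longleftrightarrow> has_bochner_integral M (\<lambda>x. f (T x)) a"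
  using assms by (simp add: has_bochner_integral_iff integrable_distr_eq integral_distr)

lemma has_bochner_integral_pair_mult:
  fixes f :: "'a \<Rightarrow> 'c::{real_normed_field, banach, second_countable_topology}"
  assumes "sigma_finite_measure M1" "sigma_finite_measure M2"
    and "has_bochner_integral M1 f a" "has_bochner_integral M2 g b"
  shows "has_bochner_integral (M1 \<Otimes>\<^sub>M M2) (\<lambda>p. f (fst p) * g (snd p)) (a * b)"
proof -
  interpret M1: sigma_finite_measure M1 by fact
  interpret M2: sigma_finite_measure M2 by fact
  interpret P: pair_sigma_finite M1 M2 ..
  from assms have i: "integrable M1 f" "integrable M2 g" and "integral\<^sup>L M1 f = a" "integral\<^sup>L M2 g = b"
    by (auto simp: has_bochner_integral_iff)
  note [measurable] = borel_measurable_integrable[OF i(1)] borel_measurable_integrable[OF i(2)]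
  have int: "integrable (M1 \<Otimes>\<^sub>M M2) (\<lambda>p. f (fst p) * g (snd p))"
    using i by (intro P.Fubini_integrable) (auto simp: norm_mult)
  moreover have "(\<integral>p. f (fst p) * g (snd p) \<partial>(M1 \<Otimes>\<^sub>M M2)) = a * b"
    using P.integral_fst'[OF int] i assms by (simp add: has_bochner_integral_iff)
  ultimately show ?thesis by (simp add: has_bochner_integral_iff)
qed

lemma has_bochner_integral_one: "prob_space M \<Longrightarrow> has_bochner_integral M (\<lambda>_. 1 :: 'c::{real_normed_field, banach, second_countable_topology}) 1"
  using prob_space.prob_space[of M] finite_measure.integrable_const[OF prob_space.finite_measure]
  by (auto simp: has_bochner_integral_iff)

lemma has_bochner_integral_fst:
  fixes f :: "'a \<Rightarrow> 'c::{real_normed_field, banach, second_countable_topology}"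
  assumes "prob_space M1" "prob_space M2" "has_bochner_integral M1 f a"
  shows "has_bochner_integral (M1 \<Otimes>\<^sub>M M2) (\<lambda>p. f (fst p)) a"
  using has_bochner_integral_pair_mult[OF _ _ assms(3) has_bochner_integral_one[OF assms(2)]] assms(1,2)
  by (simp add: prob_space_imp_sigma_finite)

lemma has_bochner_integral_snd:
  fixes f :: "'a \<Rightarrow> 'c::{real_normed_field, banach, second_countable_topology}"
  assumes "prob_space M1" "prob_space M2" "has_bochner_integral M2 f a"
  shows "has_bochner_integral (M1 \<Otimes>\<^sub>M M2) (\<lambda>p. f (snd p)) a"
  using has_bochner_integral_pair_mult[OF _ _ has_bochner_integral_one[OF assms(1)] assms(3)] assms(1,2)
  by (simp add: prob_space_imp_sigma_finite)

lemma has_cov_fst: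
  assumes "prob_space M1" "prob_space M2" "has_cov M1 X Q"
  shows "has_cov (M1 \<Otimes>\<^sub>M M2) (\<lambda>p. X (fst p)) Q"
  using has_bochner_integral_fst[OF assms(1,2) has_covD[OF assms(3)]] has_cov_measurable[OF assms(3)]
  by (auto simp: has_cov_def)

lemma has_cov_snd:
  assumes "prob_space M1" "prob_space M2" "has_cov M2 X Q"
  shows "has_cov (M1 \<Otimes>\<^sub>M M2) (\<lambda>p. X (snd p)) Q"
  using has_bochner_integral_snd[OF assms(1,2) has_covD[OF assms(3)]] has_cov_measurable[OF assms(3)]
  by (auto simp: has_cov_def)

lemma centred_fst: "prob_space M1 \<Longrightarrow> prob_space M2 \<Longrightarrow> centred M1 X \<Longrightarrow> centred (M1 \<Otimes>\<^sub>M M2) (\<lambda>p. X (fst p))"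
  using has_bochner_integral_fst[of M1 M2 "\<lambda>\<omega>. X \<omega> $ _"] by (auto simp: centred_def)

text \<open>On a probability space square integrability suffices: the entry is paired with the
  constant 1 in \<open>integrable_mult_cnj\<close>.\<close>

lemma has_cov_integrable:
  assumes "prob_space M" "has_cov M X Q"
  shows "integrable M (\<lambda>\<omega>. X \<omega> $ i)"
proof -
  interpret prob_space M by fact
  note [measurable] = has_cov_measurable[OF assms(2)]
  from integrable_mult_cnj[OF _ _ has_cov_integrable_sq[OF assms(2)], of i "\<lambda>_. 1"]
  show ?thesis by simp
qed

lemma has_bochner_integral_cnj:
  "has_bochner_integral M f a \<Longrightarrow> has_bochner_integral M (\<lambda>x. cnj (f x)) (cnj a)"
  by (auto simp: has_bochner_integral_iff integral_cnj)

text \<open>On a product space each cross term factors into two means, one of which is a mean of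
  \<open>Y\<close> or its conjugate. Centring one summand is therefore enough.\<close>

lemma has_cov_add_pair:
  assumes M: "prob_space M1" "prob_space M2" and X: "has_cov M1 X Q1" and Y: "has_cov M2 Y Q2" "centred M2 Y"
  shows "has_cov (M1 \<Otimes>\<^sub>M M2) (\<lambda>p. X (fst p) + Y (snd p)) (Q1 + Q2)"
proof -
  note [measurable] = has_cov_measurable[OF X] has_cov_measurable[OF Y(1)]
  have "has_bochner_integral (M1 \<Otimes>\<^sub>M M2) (\<lambda>p. X (fst p) $ i * cnj (X (fst p) $ j) +
     (X (fst p) $ i * cnj (Y (snd p) $ j) + (cnj (X (fst p) $ j) * Y (snd p) $ i + Y (snd p) $ i * cnj (Y (snd p) $ j))))
     (Q1 $ i $ j + ((\<integral>\<omega>. X \<omega> $ i \<partial>M1) * cnj 0 + (cnj (\<integral>\<omega>. X \<omega> $ j \<partial>M1) * 0 + Q2 $ i $ j)))" for i j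
    using has_cov_integrable[OF M(1) X] Y M
    by (intro has_bochner_integral_add has_bochner_integral_fst[OF M has_covD[OF X]]
        has_bochner_integral_snd[OF M has_covD[OF Y(1)]] has_bochner_integral_pair_mult has_bochner_integral_cnj)
      (auto simp: centred_def has_bochner_integral_iff prob_space_imp_sigma_finite)
  then show ?thesis
    unfolding has_cov_def by (simp add: algebra_simps)
qed

lemma has_cov_linear:
  assumes "has_cov M X Q"
  shows "has_cov M (\<lambda>\<omega>. A *v X \<omega>) (A ** Q ** ctranspose A)"
proof -
  note [measurable] = has_cov_measurable[OF assms]
  have "has_bochner_integral M (\<lambda>\<omega>. \<Sum>l\<in>UNIV. \<Sum>k\<in>UNIV. A $ i $ k * cnj (A $ j $ l) * (X \<omega> $ k * cnj (X \<omega> $ l)))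
     (\<Sum>l\<in>UNIV. \<Sum>k\<in>UNIV. A $ i $ k * cnj (A $ j $ l) * (Q $ k $ l))" for i j
    by (intro has_bochner_integral_sum has_bochner_integral_mult_right has_covD[OF assms])
  moreover have "(A *v X \<omega>) $ i * cnj ((A *v X \<omega>) $ j)
      = (\<Sum>l\<in>UNIV. \<Sum>k\<in>UNIV. A $ i $ k * cnj (A $ j $ l) * (X \<omega> $ k * cnj (X \<omega> $ l)))" for \<omega> i j
    by (subst sum.swap) (simp add: matrix_vector_mult_def sum_product mult_ac)
  moreover have "(A ** Q ** ctranspose A) $ i $ j = (\<Sum>l\<in>UNIV. \<Sum>k\<in>UNIV. A $ i $ k * cnj (A $ j $ l) * (Q $ k $ l))" for i j
    by (simp add: matrix_matrix_mult_def ctranspose_def sum_distrib_right sum_distrib_left mult_ac)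
  ultimately show ?thesis
    unfolding has_cov_def matrix_vector_mult_def by simp
qed

text \<open>The mean of y^H S^{-1} y is tr(S^{-1} S). Since only second moments matter, the value is
  the same for every input law with the prescribed covariance.\<close>

lemma integral_inv_quad:
  assumes S: "posdef (S :: complex^'n^'n)" and X: "has_cov M X S"
  shows "has_bochner_integral M (\<lambda>\<omega>. inv_quad S (X \<omega>)) (real CARD('n))"
proof -
  let ?T = "matrix_inv S"
  have "has_bochner_integral M (\<lambda>\<omega>. \<Sum>i\<in>UNIV. \<Sum>j\<in>UNIV. ?T $ i $ j * (X \<omega> $ j * cnj (X \<omega> $ i)))
     (\<Sum>i\<in>UNIV. \<Sum>j\<in>UNIV. ?T $ i $ j * S $ j $ i)"
    by (intro has_bochner_integral_sum has_bochner_integral_mult_right has_covD[OF X])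
  moreover have "(\<Sum>i\<in>UNIV. \<Sum>j\<in>UNIV. ?T $ i $ j * (X \<omega> $ j * cnj (X \<omega> $ i))) = hdot (X \<omega>) (?T *v X \<omega>)" for \<omega>
    by (simp add: hdot_def matrix_vector_mult_def sum_distrib_left mult_ac)
  moreover have "(\<Sum>i\<in>UNIV. \<Sum>j\<in>UNIV. ?T $ i $ j * S $ j $ i) = of_nat CARD('n)"
  proof -
    have "?T ** S = mat 1"
      using someI_ex[OF posdef_invertible[OF S, unfolded invertible_def]] by (simp add: matrix_inv_def)
    then have "(\<Sum>j\<in>UNIV. ?T $ i $ j * S $ j $ i) = 1" for i
      unfolding matrix_matrix_mult_def vec_eq_iff by (simp add: mat_def)
    then show ?thesis by simp
  qed
  ultimately have "has_bochner_integral M (\<lambda>\<omega>. hdot (X \<omega>) (?T *v X \<omega>)) (of_nat CARD('n))"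
    by simp
  then show ?thesis
    unfolding inv_quad_def by (auto simp: has_bochner_integral_iff)
qed

section \<open>Moments of Gaussian and Rayleigh laws\<close>

lemma std_normal_moments:
  defines "N \<equiv> density lborel std_normal_density"
  shows "has_bochner_integral N (\<lambda>x. x) 0" "has_bochner_integral N (\<lambda>x. x\<^sup>2) 1"
proof -
  have "has_bochner_integral lborel (\<lambda>x. std_normal_density x *\<^sub>R x) 0"
    using std_normal_moment_odd[of 0] by simp
  moreover have "has_bochner_integral lborel (\<lambda>x. std_normal_density x *\<^sub>R x\<^sup>2) 1"
    using std_normal_moment_even[of 1] by (simp add: numeral_2_eq_2)
  ultimately show "has_bochner_integral N (\<lambda>x. x) 0" "has_bochner_integral N (\<lambda>x. x\<^sup>2) 1"
    unfolding N_def by (auto intro!: has_bochner_integral_density)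
qed

lemma cn_moments:
  assumes "v \<ge> 0"
  shows "has_bochner_integral (cn v) (\<lambda>z. z) 0" "has_bochner_integral (cn v) (\<lambda>z. (cmod z)\<^sup>2) v"
proof -
  let ?N = "density lborel std_normal_density"
  let ?s = "sqrt (v / 2)"
  let ?f = "\<lambda>p. Complex (?s * fst p) (?s * snd p)"
  have N: "prob_space ?N" by (rule prob_space_normal_density) simp
  have cn: "cn v = distr (?N \<Otimes>\<^sub>M ?N) borel ?f" by (simp add: cn_def split_def)
  note m = std_normal_moments
  have "has_bochner_integral (?N \<Otimes>\<^sub>M ?N) (\<lambda>p. of_real (?s * fst p) + \<i> * of_real (?s * snd p)) (of_real (?s * 0) + \<i> * of_real (?s * 0))"
    by (intro has_bochner_integral_add has_bochner_integral_mult_right has_bochner_integral_of_real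
      has_bochner_integral_fst[OF N N m(1)] has_bochner_integral_snd[OF N N m(1)])
  then have "has_bochner_integral (?N \<Otimes>\<^sub>M ?N) ?f 0"
    by (simp add: Complex_eq)
  then show "has_bochner_integral (cn v) (\<lambda>z. z) 0"
    unfolding cn by (auto simp: has_bochner_integral_iff integrable_distr_eq integral_distr)
  have "has_bochner_integral (?N \<Otimes>\<^sub>M ?N) (\<lambda>p. v / 2 * (fst p)\<^sup>2 + v / 2 * (snd p)\<^sup>2) (v / 2 * 1 + v / 2 * 1)"
    by (intro has_bochner_integral_add has_bochner_integral_mult_right
      has_bochner_integral_fst[OF N N m(2)] has_bochner_integral_snd[OF N N m(2)])
  then have "has_bochner_integral (?N \<Otimes>\<^sub>M ?N) (\<lambda>p. (cmod (?f p))\<^sup>2) v"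
    using assms by (simp add: cmod_power2 power_mult_distrib)
  then show "has_bochner_integral (cn v) (\<lambda>z. (cmod z)\<^sup>2) v"
    unfolding cn by (auto simp: has_bochner_integral_iff integrable_distr_eq integral_distr)
qed

lemma PiM_cn_moments:
  fixes v :: "'i::finite \<Rightarrow> real"
  assumes v: "\<And>i. v i \<ge> 0"
  shows "has_bochner_integral (\<Pi>\<^sub>M i\<in>UNIV. cn (v i)) (\<lambda>h. h i) 0"
    and "has_bochner_integral (\<Pi>\<^sub>M i\<in>UNIV. cn (v i)) (\<lambda>h. h i * cnj (h j)) (if i = j then of_real (v i) else 0)"
proof -
  interpret P: product_prob_space "\<lambda>i. cn (v i)" UNIV
    by (intro product_prob_spaceI prob_space_cn)
  have d: "distr (\<Pi>\<^sub>M i\<in>UNIV. cn (v i)) (cn (v i)) (\<lambda>h. h i) = cn (v i)" for i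
    by (rule P.PiM_component) simp
  have [measurable]: "(\<lambda>h. h i) \<in> borel_measurable (\<Pi>\<^sub>M i\<in>UNIV. cn (v i))" for i
    by (rule measurable_PiM_cn_component) simp
  have comp: "has_bochner_integral (\<Pi>\<^sub>M i\<in>UNIV. cn (v i)) (\<lambda>h. f (h i)) a"
    if "has_bochner_integral (cn (v i)) f a" for f :: "complex \<Rightarrow> complex" and a i
  proof -
    have "f \<in> borel_measurable (cn (v i))" using that by (auto simp: has_bochner_integral_iff)
    then show ?thesis
      using that has_bochner_integral_distr_iff[of "\<lambda>h. h i" "\<Pi>\<^sub>M i\<in>UNIV. cn (v i)" "cn (v i)" f a]
      by (simp add: d)
  qed
  show "has_bochner_integral (\<Pi>\<^sub>M i\<in>UNIV. cn (v i)) (\<lambda>h. h i) 0"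
    by (intro comp cn_moments v)
  show "has_bochner_integral (\<Pi>\<^sub>M i\<in>UNIV. cn (v i)) (\<lambda>h. h i * cnj (h j)) (if i = j then of_real (v i) else 0)"
  proof (cases "i = j")
    case True
    have "has_bochner_integral (cn (v i)) (\<lambda>z. complex_of_real ((cmod z)\<^sup>2)) (of_real (v i))"
      by (intro has_bochner_integral_of_real cn_moments v)
    then have "has_bochner_integral (cn (v i)) (\<lambda>z. z * cnj z) (of_real (v i))"
      unfolding complex_norm_square .
    from comp[OF this] True show ?thesis by simp
  next
    case False
    \<comment> \<open>Padding with the constant 1 writes \<open>h i * cnj (h j)\<close> as a product
      over all coordinates, to which the factorisation of integrals over product measures
      applies.\<close>
    let ?f = "\<lambda>k z. if k = i then z else if k = j then cnj z else (1::complex)"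
    have pr: "(\<Prod>k\<in>UNIV. F k) = F i * F j" if "\<And>k. k \<noteq> i \<Longrightarrow> k \<noteq> j \<Longrightarrow> F k = 1" for F :: "'i \<Rightarrow> complex"
    proof -
      have "(\<Prod>k\<in>UNIV. F k) = (\<Prod>k\<in>{i, j}. F k)"
        using that by (intro prod.mono_neutral_right) auto
      with False show ?thesis by simp
    qed
    have int: "integrable (cn (v k)) (?f k)" for k
      using cn_moments(1)[OF v, of k] prob_space.finite_measure[OF prob_space_cn, THEN finite_measure.integrable_const, of "v k" "1::complex"]
      by (cases "k = i"; cases "k = j") (auto simp: has_bochner_integral_iff)
    have "integrable (\<Pi>\<^sub>M i\<in>UNIV. cn (v i)) (\<lambda>h. \<Prod>k\<in>UNIV. ?f k (h k))"
      using int by (intro P.product_integrable_prod) auto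
    moreover have "(\<integral>h. (\<Prod>k\<in>UNIV. ?f k (h k)) \<partial>(\<Pi>\<^sub>M i\<in>UNIV. cn (v i))) = (\<Prod>k\<in>UNIV. integral\<^sup>L (cn (v k)) (?f k))"
      using int by (intro P.product_integral_prod) auto
    moreover have "(\<Prod>k\<in>UNIV. integral\<^sup>L (cn (v k)) (?f k)) = 0"
      using cn_moments(1)[OF v, of i] by (intro prod_zero) (auto simp: has_bochner_integral_iff intro!: exI[of _ i])
    ultimately show ?thesis
      using False by (simp add: pr has_bochner_integral_iff)
  qed
qed

lemma has_cov_cn_vec:
  assumes "\<And>i. v i \<ge> 0"
  shows "has_cov (cn_vec v) (\<lambda>x. x) (diag v)" "centred (cn_vec v) (\<lambda>x. x)"
proof -
  have [measurable]: "(\<lambda>h. h i) \<in> borel_measurable (\<Pi>\<^sub>M i\<in>UNIV. cn (v i))" for i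
    by (rule measurable_PiM_cn_component) simp
  show "has_cov (cn_vec v) (\<lambda>x. x) (diag v)"
    using PiM_cn_moments(2)[of v] assms unfolding has_cov_def cn_vec_def
    by (subst has_bochner_integral_distr_iff) (auto simp: sets_cn diag_def)
  show "centred (cn_vec v) (\<lambda>x. x)"
    using PiM_cn_moments(1)[of v] assms unfolding centred_def cn_vec_def
    by (subst has_bochner_integral_distr_iff) (auto simp: sets_cn)
qed

lemma measurable_rayleigh_map [measurable]:
  "(\<lambda>h. (\<chi> i j. h (i, j)) :: complex^'c^'r) \<in> borel_measurable (\<Pi>\<^sub>M ij\<in>UNIV. cn 1)"
proof -
  have [measurable]: "(\<lambda>h. h ij) \<in> borel_measurable (\<Pi>\<^sub>M ij\<in>UNIV. cn 1)" for ij :: "'r \<times> 'c"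
    by (rule measurable_PiM_cn_component) simp
  show ?thesis by measurable
qed

lemma sets_rayleigh [measurable_cong]: "sets rayleigh = sets borel"
  and space_rayleigh [simp]: "space rayleigh = UNIV"
  by (simp_all add: rayleigh_def)

lemma prob_space_rayleigh: "prob_space rayleigh"
proof -
  interpret product_prob_space "\<lambda>ij. cn 1" UNIV
    by (intro product_prob_spaceI prob_space_cn)
  show ?thesis
    unfolding rayleigh_def by (intro prob_space_distr measurable_rayleigh_map)
qed

lemma rayleigh_moments:
  "has_bochner_integral rayleigh (\<lambda>H. H $ i $ k) 0"
  "has_bochner_integral rayleigh (\<lambda>H. H $ i $ k * cnj (H $ j $ l)) (if i = j \<and> k = l then 1 else 0)"
  using PiM_cn_moments(1)[of "\<lambda>_. 1" "(i, k)"] PiM_cn_moments(2)[of "\<lambda>_. 1" "(i, k)" "(j, l)"]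
  unfolding rayleigh_def
  by (simp_all add: has_bochner_integral_distr_iff cong: if_cong)

text \<open>Uncorrelated unit-variance channel entries average H Q H^H to tr(Q) times the identity,
  whatever the correlations in \<open>Q\<close>. The cross terms vanish because the channel is
  centred and independent of both vectors; \<open>X\<close> and \<open>Z\<close> may depend on each
  other.\<close>

lemma has_cov_rayleigh:
  assumes M: "prob_space M" and X: "has_cov M X Q" and Z: "has_cov M Z Q'"
  shows "has_cov (rayleigh \<Otimes>\<^sub>M M) (\<lambda>p. fst p *v X (snd p) + Z (snd p)) (mat (trace Q) + Q')"
proof -
  note [measurable] = has_cov_measurable[OF X] has_cov_measurable[OF Z]
  note sf = prob_space_imp_sigma_finite[OF prob_space_rayleigh] prob_space_imp_sigma_finite[OF M]
  have XZ: "has_bochner_integral M (\<lambda>\<omega>. X \<omega> $ k * cnj (Z \<omega> $ j)) (\<integral>\<omega>. X \<omega> $ k * cnj (Z \<omega> $ j) \<partial>M)" for k j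
    using has_cov_integrable_sq[OF X] has_cov_integrable_sq[OF Z]
    by (intro has_bochner_integral_integrable integrable_mult_cnj) auto
  have "has_bochner_integral (rayleigh \<Otimes>\<^sub>M M) (\<lambda>p. ((\<Sum>k\<in>UNIV. \<Sum>l\<in>UNIV.
      (fst p $ i $ k * cnj (fst p $ j $ l)) * (X (snd p) $ k * cnj (X (snd p) $ l)))
     + (\<Sum>k\<in>UNIV. fst p $ i $ k * (X (snd p) $ k * cnj (Z (snd p) $ j))))
     + ((\<Sum>k\<in>UNIV. cnj (fst p $ j $ k) * cnj (X (snd p) $ k * cnj (Z (snd p) $ i)))
     + Z (snd p) $ i * cnj (Z (snd p) $ j)))
     (((\<Sum>k\<in>UNIV. \<Sum>l\<in>UNIV. (if i = j \<and> k = l then 1 else 0) * Q $ k $ l)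
      + (\<Sum>k\<in>UNIV. 0 * (\<integral>\<omega>. X \<omega> $ k * cnj (Z \<omega> $ j) \<partial>M)))
      + ((\<Sum>k\<in>UNIV. cnj 0 * cnj (\<integral>\<omega>. X \<omega> $ k * cnj (Z \<omega> $ i) \<partial>M)) + Q' $ i $ j))" for i j
    by (intro has_bochner_integral_add has_bochner_integral_sum has_bochner_integral_pair_mult sf
       has_bochner_integral_snd[OF prob_space_rayleigh M] has_covD[OF X] has_covD[OF Z] XZ
       has_bochner_integral_cnj rayleigh_moments)
  moreover have "((\<Sum>k\<in>UNIV. \<Sum>l\<in>UNIV.
      (fst p $ i $ k * cnj (fst p $ j $ l)) * (X (snd p) $ k * cnj (X (snd p) $ l)))
     + (\<Sum>k\<in>UNIV. fst p $ i $ k * (X (snd p) $ k * cnj (Z (snd p) $ j))))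
     + ((\<Sum>k\<in>UNIV. cnj (fst p $ j $ k) * cnj (X (snd p) $ k * cnj (Z (snd p) $ i)))
     + Z (snd p) $ i * cnj (Z (snd p) $ j))
     = (fst p *v X (snd p) + Z (snd p)) $ i * cnj ((fst p *v X (snd p) + Z (snd p)) $ j)" for i j p
    by (simp add: matrix_vector_mult_def distrib_left distrib_right sum_product sum_distrib_left sum_distrib_right mult_ac)
      (rule sum.swap)
  moreover have "((\<Sum>k\<in>UNIV. \<Sum>l\<in>UNIV. (if i = j \<and> k = l then 1 else 0) * Q $ k $ l)
      + (\<Sum>k\<in>UNIV. 0 * (\<integral>\<omega>. X \<omega> $ k * cnj (Z \<omega> $ j) \<partial>M)))
      + ((\<Sum>k\<in>UNIV. cnj 0 * cnj (\<integral>\<omega>. X \<omega> $ k * cnj (Z \<omega> $ i) \<partial>M)) + Q' $ i $ j)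
      = (mat (trace Q) + Q') $ i $ j" for i j
    by (auto simp: mat_def trace_def if_distrib if_distribR cong: if_cong)
  ultimately show ?thesis
    unfolding has_cov_def matrix_vector_mult_def by simp
qed

section \<open>The covariance produced by one hop, and admissible inputs\<close>

lemma prob_space_pair:
  assumes "prob_space M" "prob_space N"
  shows "prob_space (M \<Otimes>\<^sub>M N)"
proof -
  interpret M: prob_space M by fact
  interpret N: prob_space N by fact
  show ?thesis
    by (rule prob_spaceI) (simp add: space_pair_measure N.emeasure_pair_measure_Times M.emeasure_space_1 N.emeasure_space_1)
qed

text \<open>In \<open>first_hop\<close> the input stands before the channel, while
  \<open>has_cov_rayleigh\<close> needs the channel in front of all the rest.\<close>

lemma nn_integral_pair_left_commute:
  assumes P: "prob_space P" and R: "prob_space R" and N: "prob_space N"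
    and F [measurable]: "F \<in> borel_measurable (P \<Otimes>\<^sub>M (R \<Otimes>\<^sub>M N))"
  shows "(\<integral>\<^sup>+p. F p \<partial>(P \<Otimes>\<^sub>M (R \<Otimes>\<^sub>M N))) = (\<integral>\<^sup>+p. F (fst (snd p), (fst p, snd (snd p))) \<partial>(R \<Otimes>\<^sub>M (P \<Otimes>\<^sub>M N)))"
proof -
  interpret P: prob_space P by fact
  interpret R: prob_space R by fact
  interpret N: prob_space N by fact
  interpret PR: pair_sigma_finite P R ..
  interpret RNs: prob_space "R \<Otimes>\<^sub>M N" by (intro prob_space_pair R N)
  interpret PNs: prob_space "P \<Otimes>\<^sub>M N" by (intro prob_space_pair P N)
  have "(\<integral>\<^sup>+p. F p \<partial>(P \<Otimes>\<^sub>M (R \<Otimes>\<^sub>M N))) = (\<integral>\<^sup>+x. \<integral>\<^sup>+h. \<integral>\<^sup>+n. F (x, (h, n)) \<partial>N \<partial>R \<partial>P)"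
    by (subst RNs.nn_integral_fst[symmetric], measurable, intro nn_integral_cong, subst N.nn_integral_fst[symmetric]) auto
  also have "\<dots> = (\<integral>\<^sup>+h. \<integral>\<^sup>+x. \<integral>\<^sup>+n. F (x, (h, n)) \<partial>N \<partial>P \<partial>R)"
    by (rule PR.Fubini'[symmetric]) measurable
  also have "\<dots> = (\<integral>\<^sup>+p. F (fst (snd p), (fst p, snd (snd p))) \<partial>(R \<Otimes>\<^sub>M (P \<Otimes>\<^sub>M N)))"
    by (subst PNs.nn_integral_fst[symmetric], measurable, intro nn_integral_cong, subst N.nn_integral_fst[symmetric]) auto
  finally show ?thesis .
qed

lemma distr_pair_left_commute:
  assumes "prob_space P" "prob_space R" "prob_space N"
  shows "distr (R \<Otimes>\<^sub>M (P \<Otimes>\<^sub>M N)) (P \<Otimes>\<^sub>M (R \<Otimes>\<^sub>M N)) (\<lambda>p. (fst (snd p), (fst p, snd (snd p)))) = P \<Otimes>\<^sub>M (R \<Otimes>\<^sub>M N)"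
    (is "?L = ?R")
proof (rule measure_eqI)
  fix A assume "A \<in> sets ?L"
  then have A [measurable]: "A \<in> sets (P \<Otimes>\<^sub>M (R \<Otimes>\<^sub>M N))" by simp
  have "emeasure ?L A = (\<integral>\<^sup>+p. indicator A p \<partial>?L)" using A by simp
  also have "\<dots> = (\<integral>\<^sup>+p. indicator A (fst (snd p), (fst p, snd (snd p))) \<partial>(R \<Otimes>\<^sub>M (P \<Otimes>\<^sub>M N)))"
    by (subst nn_integral_distr) auto
  also have "\<dots> = (\<integral>\<^sup>+p. indicator A p \<partial>?R)"
    by (rule nn_integral_pair_left_commute[OF assms, symmetric]) measurable
  finally show "emeasure ?L A = emeasure ?R A" using A by simp
qed simp

lemma has_cov_distr_iff:
  assumes [measurable]: "T \<in> measurable M N" "X \<in> borel_measurable N"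
  shows "has_cov (distr M N T) X Q \<longleftrightarrow> has_cov M (\<lambda>x. X (T x)) Q"
  by (simp add: has_cov_def has_bochner_integral_distr_iff)

lemma measurable_matrix_vector_mult [measurable (raw)]:
  fixes f :: "'a \<Rightarrow> complex^'c^'r"
  assumes [measurable]: "f \<in> borel_measurable M" "g \<in> borel_measurable M"
  shows "(\<lambda>x. f x *v g x) \<in> borel_measurable M"
  unfolding matrix_vector_mult_def by measurable

lemma hop_output_eq: "hop_output x e = fst e *v (x + fst (snd e)) + fst (snd (snd e)) + snd (snd (snd e))"
  by (cases e) simp

text \<open>The transmit distortion joins the input before the channel, so it enters only through
  the trace; receive distortion and thermal noise are added after it. The result is a multiple of
  the identity even for correlated inputs.\<close>

lemma has_cov_hop_output:
  fixes P :: "(complex^'k) measure"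
  assumes P: "prob_space P" "sets P = sets borel" and Q: "has_cov P (\<lambda>x. x) Q"
    and nonneg: "\<And>k. 0 \<le> Re (Q $ k $ k)"
  shows "has_cov (P \<Otimes>\<^sub>M hop \<delta>t \<delta>r Q) (\<lambda>(x, e). hop_output x e)
     (mat (trace Q + of_real (\<delta>t\<^sup>2 * (\<Sum>k\<in>UNIV. Re (Q $ k $ k)) + \<delta>r\<^sup>2 * Re (trace Q) + 1)) :: complex^'m^'m)"
proof -
  let ?N1 = "cn_vec (\<lambda>i. \<delta>t\<^sup>2 * Re (Q $ i $ i)) :: (complex^'k) measure"
  let ?N2 = "cn_vec (\<lambda>_. \<delta>r\<^sup>2 * Re (trace Q)) :: (complex^'m) measure"
  let ?N3 = "cn_vec (\<lambda>_. 1) :: (complex^'m) measure"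
  let ?N = "?N1 \<Otimes>\<^sub>M (?N2 \<Otimes>\<^sub>M ?N3)"
  have tr: "0 \<le> Re (trace Q)" using nonneg by (simp add: trace_def sum_nonneg)
  have p: "prob_space ?N1" "prob_space ?N2" "prob_space ?N3" "prob_space (?N2 \<Otimes>\<^sub>M ?N3)" "prob_space ?N" "prob_space (P \<Otimes>\<^sub>M ?N)"
    by (intro prob_space_pair prob_space_cn_vec P(1))+
  have [measurable_cong]: "sets P = sets borel" by fact
  have X: "has_cov (P \<Otimes>\<^sub>M ?N) (\<lambda>p. fst p + fst (snd p)) (Q + diag (\<lambda>i. \<delta>t\<^sup>2 * Re (Q $ i $ i)))"
    using has_cov_add_pair[OF P(1) p(5) Q has_cov_fst[OF p(1,4) has_cov_cn_vec(1)] centred_fst[OF p(1,4) has_cov_cn_vec(2)]] nonneg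
    by simp
  have Z: "has_cov (P \<Otimes>\<^sub>M ?N) (\<lambda>p. fst (snd (snd p)) + snd (snd (snd p))) (diag (\<lambda>_. \<delta>r\<^sup>2 * Re (trace Q)) + diag (\<lambda>_. 1))"
    using has_cov_snd[OF P(1) p(5) has_cov_snd[OF p(1,4) has_cov_add_pair[OF p(2,3) has_cov_cn_vec(1) has_cov_cn_vec(1,2)]]] tr
    by simp
  have m: "(\<lambda>(x, e). hop_output x e :: complex^'m) \<in> borel_measurable (P \<Otimes>\<^sub>M (rayleigh \<Otimes>\<^sub>M ?N))"
    unfolding hop_output_eq by measurable
  have "has_cov (rayleigh \<Otimes>\<^sub>M (P \<Otimes>\<^sub>M ?N))
      (\<lambda>p. fst p *v (fst (snd p) + fst (snd (snd p))) + (fst (snd (snd (snd p))) + snd (snd (snd (snd p)))))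
      (mat (trace (Q + diag (\<lambda>i. \<delta>t\<^sup>2 * Re (Q $ i $ i)))) + (diag (\<lambda>_. \<delta>r\<^sup>2 * Re (trace Q)) + diag (\<lambda>_. 1)))"
    by (rule has_cov_rayleigh[OF p(6) X Z])
  moreover have "mat (trace (Q + diag (\<lambda>i. \<delta>t\<^sup>2 * Re (Q $ i $ i)))) + (diag (\<lambda>_. \<delta>r\<^sup>2 * Re (trace Q)) + diag (\<lambda>_. 1))
     = (mat (trace Q + of_real (\<delta>t\<^sup>2 * (\<Sum>k\<in>UNIV. Re (Q $ k $ k)) + \<delta>r\<^sup>2 * Re (trace Q) + 1)) :: complex^'m^'m)"
    by (simp add: vec_eq_iff mat_def diag_def trace_def sum.distrib sum_distrib_left)
  ultimately have "has_cov (distr (rayleigh \<Otimes>\<^sub>M (P \<Otimes>\<^sub>M ?N)) (P \<Otimes>\<^sub>M (rayleigh \<Otimes>\<^sub>M ?N)) (\<lambda>p. (fst (snd p), (fst p, snd (snd p)))))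
      (\<lambda>(x, e). hop_output x e)
      (mat (trace Q + of_real (\<delta>t\<^sup>2 * (\<Sum>k\<in>UNIV. Re (Q $ k $ k)) + \<delta>r\<^sup>2 * Re (trace Q) + 1)) :: complex^'m^'m)"
    using m by (subst has_cov_distr_iff) (simp_all add: hop_output_eq add.assoc split_def)
  then show ?thesis
    unfolding hop_def
    by (subst (asm) distr_pair_left_commute) (auto intro: P p prob_space_rayleigh)
qed

lemma has_cov_self:
  assumes "sets P = sets borel" "\<And>k. integrable P (\<lambda>x. (cmod (x $ k))\<^sup>2)"
  shows "has_cov P (\<lambda>x. x) (second_moment P (\<lambda>x. x))"
  using assms by (intro has_covI) (auto simp: second_moment_def measurable_ident_sets)

lemma second_moment_diag:
  "second_moment P X $ k $ k = of_real (\<integral>x. (cmod (X x $ k))\<^sup>2 \<partial>P)"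
  by (simp add: second_moment_def complex_norm_square[symmetric] del: of_real_power)

text \<open>The relay covariance sees the input only through its total power. A prescribed relay
  covariance is thus a single scalar equation.\<close>

lemma relay_cov_eq:
  fixes P :: "(complex^'k) measure"
  assumes P: "prob_space P" "sets P = sets borel" and int: "\<And>k. integrable P (\<lambda>x. (cmod (x $ k))\<^sup>2)"
  shows "relay_cov \<nu> \<delta>t \<delta>r P = (mat (of_real (\<nu> * ((1 + \<delta>t\<^sup>2 + \<delta>r\<^sup>2) *
     (\<Sum>k\<in>UNIV. Re (second_moment P (\<lambda>x. x) $ k $ k)) + 1))) :: complex^'m^'m)"
proof -
  let ?Q = "second_moment P (\<lambda>x. x)"
  have nn: "0 \<le> Re (?Q $ k $ k)" for k by (simp add: second_moment_diag)
  have tr: "trace ?Q = of_real (\<Sum>k\<in>UNIV. Re (?Q $ k $ k))"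
    by (simp add: trace_def second_moment_diag)
  show ?thesis
    using has_cov_second_moment[OF has_cov_hop_output[OF P has_cov_self[OF P(2) int] nn, of \<delta>t \<delta>r, where 'm='m]]
    unfolding relay_cov_def first_hop_def tr
    by (simp add: vec_eq_iff mat_def scaleR_complex.ctr complex_eq_iff algebra_simps)
qed

lemma distr_gauss_measure_add_outer:
  assumes S: "posdef S"
  shows "distr (cn 1 \<Otimes>\<^sub>M gauss_measure S) borel (\<lambda>p. fst p *s a + snd p) = gauss_measure (S + outer a)"
proof (rule measure_eqI_nn_integral)
  fix F :: "complex^'a \<Rightarrow> ennreal" assume [measurable]: "F \<in> borel_measurable borel"
  interpret prob_space "gauss_measure S" by (rule prob_space_gauss_measure[OF S])
  show "(\<integral>\<^sup>+x. F x \<partial>distr (cn 1 \<Otimes>\<^sub>M gauss_measure S) borel (\<lambda>p. fst p *s a + snd p)) = (\<integral>\<^sup>+x. F x \<partial>gauss_measure (S + outer a))"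
    by (subst nn_integral_distr) (simp_all add: nn_integral_fst[symmetric] nn_integral_gauss_measure_add_outer[OF S])
qed (simp_all add: sets_gauss_measure)

text \<open>The induction uses the representation as an independent sum from
  \<open>distr_gauss_measure_add_outer\<close>, which avoids moment integrals of the multivariate
  density.\<close>

lemma has_cov_gauss_measure:
  fixes S :: "complex^'n^'n"
  shows "posdef S \<Longrightarrow> has_cov (gauss_measure S) (\<lambda>x. x) S \<and> centred (gauss_measure S) (\<lambda>x. x)"
proof (induction rule: posdef.induct)
  case (posdef_scalar c)
  moreover have "diag (\<lambda>_::'n. c) = mat (complex_of_real c)"
    by (simp add: diag_def mat_def vec_eq_iff)
  ultimately show ?case
    using has_cov_cn_vec[of "\<lambda>_::'n. c"] by (simp add: gauss_measure_mat)
next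
  case (posdef_add_outer S a)
  have "has_bochner_integral (cn 1) (\<lambda>z. complex_of_real ((cmod z)\<^sup>2)) (of_real 1)"
    by (intro has_bochner_integral_of_real cn_moments) simp
  then have c: "has_bochner_integral (cn 1) (\<lambda>z. z * cnj z) 1"
    unfolding complex_norm_square by simp
  have "has_bochner_integral (cn 1) (\<lambda>z. (a $ i * cnj (a $ j)) * (z * cnj z)) ((a $ i * cnj (a $ j)) * 1)" for i j
    by (intro has_bochner_integral_mult_right c)
  then have X: "has_cov (cn 1) (\<lambda>z. z *s a) (outer a)"
    unfolding has_cov_def by (auto simp: outer_def mult_ac)
  have "has_bochner_integral (cn 1) (\<lambda>z. z * a $ i) (0 * a $ i)" for i
    by (intro has_bochner_integral_mult_left cn_moments(1)) simp
  then have X0: "centred (cn 1) (\<lambda>z. z *s a)"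
    by (simp add: centred_def)
  note p = prob_space_cn[of 1] prob_space_gauss_measure[OF posdef_add_outer(1)]
  from posdef_add_outer.IH have Y: "has_cov (gauss_measure S) (\<lambda>x. x) S" "centred (gauss_measure S) (\<lambda>x. x)" by auto
  have "has_cov (distr (cn 1 \<Otimes>\<^sub>M gauss_measure S) borel (\<lambda>p. fst p *s a + snd p)) (\<lambda>x. x) (S + outer a)"
    using has_cov_add_pair[OF p X Y]
    by (subst has_cov_distr_iff) (simp_all add: add.commute)
  moreover have "centred (distr (cn 1 \<Otimes>\<^sub>M gauss_measure S) borel (\<lambda>p. fst p *s a + snd p)) (\<lambda>x. x)"
  proof -
    have "has_bochner_integral (cn 1 \<Otimes>\<^sub>M gauss_measure S) (\<lambda>p. (fst p *s a) $ i + snd p $ i) (0 + 0)" for i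
      using X0 Y(2) unfolding centred_def
      by (intro has_bochner_integral_add has_bochner_integral_fst[OF p, of "\<lambda>z. (z *s a) $ i"] has_bochner_integral_snd[OF p]) auto
    then show ?thesis
      unfolding centred_def by (subst has_bochner_integral_distr_iff) auto
  qed
  ultimately show ?case
    by (simp add: distr_gauss_measure_add_outer[OF posdef_add_outer(1)])
qed

text \<open>The prescribed relay covariance fixes the total input power, so that all the individual power
  constraints hold with equality.\<close>

lemma admissible_has_cov:
  fixes P :: "(complex^'k) measure" and \<nu> \<mu> \<delta>t \<delta>r :: real
  assumes P: "P \<in> admissible_inputs \<nu> \<delta>t \<delta>r \<mu> (mat (of_real (\<nu> * ((1 + \<delta>t\<^sup>2 + \<delta>r\<^sup>2) * (real CARD('k) * \<mu>) + 1))) :: complex^'m^'m)"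
    and \<nu>: "\<nu> > 0"
  shows "prob_space P" "sets P = sets borel" "has_cov P (\<lambda>x. x) (mat (of_real \<mu>))"
proof -
  let ?Q = "second_moment P (\<lambda>x. x)"
  from P show p: "prob_space P" and s: "sets P = sets borel" by (auto simp: admissible_inputs_def)
  from P have int: "\<And>k. integrable P (\<lambda>x. (cmod (x $ k))\<^sup>2)" and le: "\<And>k. Re (?Q $ k $ k) \<le> \<mu>"
    and ind: "prob_space.indep_vars P (\<lambda>_. borel) (\<lambda>k x. x $ k) UNIV"
    and zero: "\<And>k. (\<integral>x. x $ k \<partial>P) = 0"
    and eq: "relay_cov \<nu> \<delta>t \<delta>r P = (mat (of_real (\<nu> * ((1 + \<delta>t\<^sup>2 + \<delta>r\<^sup>2) * (real CARD('k) * \<mu>) + 1))) :: complex^'m^'m)"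
    by (auto simp: admissible_inputs_def)
  interpret prob_space P by fact
  note cov = has_cov_self[OF s int]
  \<comment> \<open>Both sides of the relay constraint are multiples of the identity, so one
    arbitrary diagonal entry, here at index \<open>undefined\<close>, contains all its
    information.\<close>
  have "\<nu> * ((1 + \<delta>t\<^sup>2 + \<delta>r\<^sup>2) * (\<Sum>k\<in>UNIV. Re (?Q $ k $ k)) + 1) = \<nu> * ((1 + \<delta>t\<^sup>2 + \<delta>r\<^sup>2) * (real CARD('k) * \<mu>) + 1)"
    using arg_cong[OF eq[unfolded relay_cov_eq[OF p s int, where 'm='m]], of "\<lambda>A. Re (A $ undefined $ undefined)"]
    by (simp only: mat_def vec_lambda_beta if_True Re_complex_of_real simp_thms)
  moreover have "1 + \<delta>t\<^sup>2 + \<delta>r\<^sup>2 > 0" by (simp add: add_pos_nonneg)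
  ultimately have sum: "(\<Sum>k\<in>UNIV. Re (?Q $ k $ k)) = (\<Sum>k\<in>(UNIV::'k set). \<mu>)"
    using \<nu> by simp
  have "(\<Sum>k\<in>UNIV. \<mu> - Re (?Q $ k $ k)) = 0" using sum by (simp add: sum_subtractf)
  then have "Re (?Q $ k $ k) = \<mu>" for k
    using sum_nonneg_eq_0_iff[of UNIV "\<lambda>k. \<mu> - Re (?Q $ k $ k)"] le by auto
  then have d: "?Q $ k $ k = of_real \<mu>" for k
    using second_moment_diag[of P "\<lambda>x. x" k] by (metis Re_complex_of_real)
  \<comment> \<open>Non-cooperation enters here: the mean of the product factors by independence,
    and the factors vanish by centring. \<open>?Y\<close> puts the conjugate on the entry
    \<open>j\<close> only.\<close>
  have o: "?Q $ i $ j = 0" if ij: "i \<noteq> j" for i j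
  proof -
    let ?Y = "\<lambda>k (z::complex). if k = i then z else cnj z"
    have "indep_vars (\<lambda>_. borel) (\<lambda>k x. ?Y k (x $ k)) {i, j}"
      by (rule indep_vars_compose2[OF indep_vars_subset[OF ind subset_UNIV]]) measurable
    moreover have "integrable P (\<lambda>x. ?Y k (x $ k))" for k
      using has_cov_integrable[OF p cov, of k] by (cases "k = i") auto
    ultimately have "(\<integral>x. (\<Prod>k\<in>{i, j}. ?Y k (x $ k)) \<partial>P) = (\<Prod>k\<in>{i, j}. \<integral>x. ?Y k (x $ k) \<partial>P)"
      by (intro indep_vars_lebesgue_integral) auto
    with ij zero[of i] show ?thesis by (simp add: second_moment_def)
  qed
  have "?Q = mat (of_real \<mu>)"
    using d o by (simp add: vec_eq_iff mat_def)
  with cov show "has_cov P (\<lambda>x. x) (mat (of_real \<mu>))" by simp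
qed

text \<open>Supplies the input at which the supremum is attained. Independence of the entries is
  read off from their joint law being the product of its marginals.\<close>

lemma cn_vec_admissible:
  fixes \<nu> \<mu> \<delta>t \<delta>r :: real
  assumes \<mu>: "\<mu> \<ge> 0"
  shows "(cn_vec (\<lambda>_. \<mu>) :: (complex^'k) measure) \<in>
    admissible_inputs \<nu> \<delta>t \<delta>r \<mu> (mat (of_real (\<nu> * ((1 + \<delta>t\<^sup>2 + \<delta>r\<^sup>2) * (real CARD('k) * \<mu>) + 1))) :: complex^'m^'m)"
proof -
  let ?P = "cn_vec (\<lambda>_. \<mu>) :: (complex^'k) measure"
  interpret prob_space ?P by (rule prob_space_cn_vec)
  interpret C: product_prob_space "\<lambda>k::'k. cn \<mu>" UNIV
    by (intro product_prob_spaceI prob_space_cn)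
  note cov = has_cov_cn_vec[of "\<lambda>_::'k. \<mu>"]
  have Q: "second_moment ?P (\<lambda>x. x) $ k $ k = of_real \<mu>" for k
    using has_cov_second_moment[OF cov(1)] \<mu> by (simp add: diag_def)
  have int: "integrable ?P (\<lambda>x. (cmod (x $ k))\<^sup>2)" for k
    using has_cov_integrable_sq[OF cov(1)] \<mu> by simp
  have [measurable]: "(\<lambda>h. h i) \<in> borel_measurable (\<Pi>\<^sub>M i\<in>UNIV. cn \<mu>)" for i :: 'k
    by (rule measurable_PiM_cn_component) simp
  have vl: "(vec_lambda :: _ \<Rightarrow> complex^'k) \<in> borel_measurable (\<Pi>\<^sub>M i\<in>UNIV. cn \<mu>)"
    by (rule measurable_vec_lambda_PiM) (simp add: sets_cn)
  have comp: "distr ?P borel (\<lambda>x. x $ k) = cn \<mu>" for k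
  proof -
    have "distr ?P borel (\<lambda>x. x $ k) = distr (\<Pi>\<^sub>M i\<in>UNIV. cn \<mu>) borel (\<lambda>h. h k)"
      unfolding cn_vec_def using vl by (subst distr_distr) (auto simp: comp_def)
    also have "\<dots> = distr (\<Pi>\<^sub>M i\<in>UNIV. cn \<mu>) (cn \<mu>) (\<lambda>h. h k)"
      by (rule distr_cong) (auto simp: sets_cn)
    finally show ?thesis using C.PiM_component[of k] by simp
  qed
  have "distr ?P (\<Pi>\<^sub>M k\<in>UNIV. borel) (\<lambda>x. \<lambda>k\<in>UNIV. x $ k) = (\<Pi>\<^sub>M k\<in>UNIV. distr ?P borel (\<lambda>x. x $ k))"
  proof -
    have "distr ?P (\<Pi>\<^sub>M k\<in>UNIV. borel) (\<lambda>x. \<lambda>k\<in>UNIV. x $ k)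
      = distr (\<Pi>\<^sub>M i\<in>UNIV. cn \<mu>) (\<Pi>\<^sub>M k\<in>UNIV. borel) ((\<lambda>x. \<lambda>k\<in>UNIV. x $ k) \<circ> vec_lambda)"
      unfolding cn_vec_def using vl by (intro distr_distr) (auto intro!: measurable_PiM_single')
    also have "\<dots> = (\<Pi>\<^sub>M i\<in>UNIV. cn \<mu>)"
    proof -
      have "((\<lambda>x. \<lambda>k\<in>UNIV. x $ k) \<circ> vec_lambda) = (\<lambda>x :: 'k \<Rightarrow> complex. x)"
        by (simp add: fun_eq_iff)
      moreover have "sets (\<Pi>\<^sub>M k\<in>(UNIV::'k set). borel :: complex measure) = sets (\<Pi>\<^sub>M i\<in>UNIV. cn \<mu>)"
        by (intro sets_PiM_cong) (simp_all add: sets_cn)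
      ultimately show ?thesis by (simp add: distr_id2)
    qed
    finally show ?thesis unfolding comp .
  qed
  then have ind: "indep_vars (\<lambda>_. borel) (\<lambda>k x. x $ k) (UNIV :: 'k set)"
    by (subst indep_vars_iff_distr_eq_PiM) auto
  have "relay_cov \<nu> \<delta>t \<delta>r ?P = (mat (of_real (\<nu> * ((1 + \<delta>t\<^sup>2 + \<delta>r\<^sup>2) * (real CARD('k) * \<mu>) + 1))) :: complex^'m^'m)"
    by (subst relay_cov_eq) (simp_all add: prob_space_axioms sets_cn_vec int Q)
  moreover have "(\<integral>x. x $ k \<partial>?P) = 0" for k
    using cov(2) \<mu> by (auto simp: centred_def has_bochner_integral_iff)
  ultimately show ?thesis
    using ind int Q by (auto simp: admissible_inputs_def prob_space_axioms sets_cn_vec)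
qed

section \<open>Mutual information over a channel with known random state\<close>

text \<open>From ln u <= u - 1. With \<open>U\<close> a likelihood ratio this is Gibbs' inequality;
  the nonnegative integral also yields the integrability of \<open>U\<close>.\<close>

lemma (in prob_space) expectation_ln_le_0:
  assumes [measurable]: "U \<in> borel_measurable M" and pos: "\<And>\<omega>. \<omega> \<in> space M \<Longrightarrow> U \<omega> > 0"
    and one: "(\<integral>\<^sup>+\<omega>. ennreal (U \<omega>) \<partial>M) = 1" and int: "integrable M (\<lambda>\<omega>. ln (U \<omega>))"
  shows "expectation (\<lambda>\<omega>. ln (U \<omega>)) \<le> 0"
proof -
  have U: "has_bochner_integral M U 1"
    using one pos by (intro has_bochner_integral_nn_integral) (auto intro!: AE_I2 less_imp_le)
  then have iU: "integrable M U" and eU: "expectation U = 1" by (auto simp: has_bochner_integral_iff)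
  have "expectation (\<lambda>\<omega>. ln (U \<omega>)) \<le> expectation (\<lambda>\<omega>. U \<omega> - 1)"
    using int iU pos by (intro integral_mono) (auto intro!: ln_le_minus_one)
  also have "\<dots> = 0" using iU eU by (simp add: prob_space)
  finally show ?thesis .
qed

text \<open>Isolates the information theory from the relay model: \<open>P\<close> is the input law,
  \<open>C\<close> the law of the channel state and \<open>g h x\<close> the output density given
  state and input. The single formula \<open>law\<close> encodes both the independence of
  \<open>X\<close> and \<open>Z\<close> and the conditional density. Positivity everywhere keeps
  null sets out of the logarithms of quotients.\<close>

locale channel_law = prob_space \<Omega>
  for \<Omega> :: "'w measure"
    and P :: "'x::euclidean_space measure" and C :: "'h::euclidean_space measure"
    and X :: "'w \<Rightarrow> 'x" and Y :: "'w \<Rightarrow> 'y::euclidean_space" and Z :: "'w \<Rightarrow> 'h"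
    and g :: "'h \<Rightarrow> 'x \<Rightarrow> 'y \<Rightarrow> real" +
  assumes prob_P: "prob_space P" and prob_C: "prob_space C"
    and sets_P [measurable_cong]: "sets P = sets borel" and sets_C [measurable_cong]: "sets C = sets borel"
    and X [measurable]: "X \<in> borel_measurable \<Omega>"
    and Y [measurable]: "Y \<in> borel_measurable \<Omega>"
    and Z [measurable]: "Z \<in> borel_measurable \<Omega>"
    and g [measurable]: "(\<lambda>(h, x, y). g h x y) \<in> borel_measurable (borel \<Otimes>\<^sub>M borel \<Otimes>\<^sub>M borel)"
    and g_pos: "g h x y > 0"
    and g_int: "integrable P (\<lambda>x. g h x y)"
    and g_one: "(\<integral>\<^sup>+y. g h x y \<partial>lborel) = 1"
    and law: "F \<in> borel_measurable (borel \<Otimes>\<^sub>M borel \<Otimes>\<^sub>M borel) \<Longrightarrow>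
       (\<integral>\<^sup>+\<omega>. F (X \<omega>, Y \<omega>, Z \<omega>) \<partial>\<Omega>) = (\<integral>\<^sup>+h. \<integral>\<^sup>+x. \<integral>\<^sup>+y. ennreal (g h x y) * F (x, y, h) \<partial>lborel \<partial>P \<partial>C)"
begin

sublocale P: prob_space P by (rule prob_P)
sublocale C: prob_space C by (rule prob_C)

text \<open>The output density given only the channel state \<open>h\<close>.\<close>

definition p :: "'h \<Rightarrow> 'y \<Rightarrow> real" where
  "p h y = (\<integral>x. g h x y \<partial>P)"

lemma measurable_g [measurable (raw)]:
  assumes "a \<in> borel_measurable M" "b \<in> borel_measurable M" "c \<in> borel_measurable M"
  shows "(\<lambda>x. g (a x) (b x) (c x)) \<in> borel_measurable M"
  using measurable_compose[OF _ g, of "\<lambda>x. (a x, b x, c x)" M] assms by simp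

lemma measurable_p [measurable (raw)]:
  assumes [measurable]: "a \<in> borel_measurable M" "c \<in> borel_measurable M"
  shows "(\<lambda>x. p (a x) (c x)) \<in> borel_measurable M"
  unfolding p_def by measurable

lemma p_pos: "p h y > 0"
proof -
  have "p h y \<noteq> 0"
  proof
    assume "p h y = 0"
    then have "AE x in P. g h x y = 0"
      using g_int[of h y] g_pos[of h _ y]
      by (subst integral_nonneg_eq_0_iff_AE[symmetric]) (auto simp: p_def less_imp_le)
    moreover have "AE x in P. g h x y \<noteq> 0" using g_pos[of h _ y] by (auto simp: less_imp_neq[symmetric])
    ultimately have "AE x in P. False" by eventually_elim auto
    then show False by simp
  qed
  moreover have "p h y \<ge> 0" unfolding p_def
    by (rule Bochner_Integration.integral_nonneg) (use g_pos[of h _ y] in \<open>simp add: less_imp_le\<close>)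
  ultimately show ?thesis by simp
qed

lemma g_nonzero: "g h x y \<noteq> 0" and p_nonzero: "p h y \<noteq> 0"
  using g_pos[of h x y] p_pos[of h y] by auto

lemma nn_integral_g: "(\<integral>\<^sup>+x. ennreal (g h x y) \<partial>P) = ennreal (p h y)"
  unfolding p_def using g_int[of h y] g_pos[of h _ y]
  by (intro nn_integral_eq_integral) (auto simp: less_imp_le)

section \<open>Marginal laws and the information formula\<close>

lemma nn_integral_law_YZ:
  assumes [measurable]: "F \<in> borel_measurable (borel \<Otimes>\<^sub>M borel)"
  shows "(\<integral>\<^sup>+\<omega>. F (Y \<omega>, Z \<omega>) \<partial>\<Omega>) = (\<integral>\<^sup>+h. \<integral>\<^sup>+y. ennreal (p h y) * F (y, h) \<partial>lborel \<partial>C)"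
proof -
  interpret PL: pair_sigma_finite P lborel ..
  have "(\<integral>\<^sup>+\<omega>. F (Y \<omega>, Z \<omega>) \<partial>\<Omega>) = (\<integral>\<^sup>+h. \<integral>\<^sup>+x. \<integral>\<^sup>+y. ennreal (g h x y) * F (y, h) \<partial>lborel \<partial>P \<partial>C)"
    using law[of "\<lambda>(x, y, h). F (y, h)"] by simp
  also have "\<dots> = (\<integral>\<^sup>+h. \<integral>\<^sup>+y. \<integral>\<^sup>+x. ennreal (g h x y) * F (y, h) \<partial>P \<partial>lborel \<partial>C)"
    by (intro nn_integral_cong PL.Fubini'[symmetric]) measurable
  also have "\<dots> = (\<integral>\<^sup>+h. \<integral>\<^sup>+y. ennreal (p h y) * F (y, h) \<partial>lborel \<partial>C)"
    by (intro nn_integral_cong) (simp add: nn_integral_multc nn_integral_g)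
  finally show ?thesis .
qed

lemma nn_integral_law_XZ:
  assumes [measurable]: "F \<in> borel_measurable (borel \<Otimes>\<^sub>M borel)"
  shows "(\<integral>\<^sup>+\<omega>. F (X \<omega>, Z \<omega>) \<partial>\<Omega>) = (\<integral>\<^sup>+h. \<integral>\<^sup>+x. F (x, h) \<partial>P \<partial>C)"
  using law[of "\<lambda>(x, y, h). F (x, h)"] by (simp add: nn_integral_multc g_one)

lemma distr_X: "distr \<Omega> borel X = P"
proof (rule measure_eqI_nn_integral)
  fix F :: "'x \<Rightarrow> ennreal" assume [measurable]: "F \<in> borel_measurable borel"
  show "(\<integral>\<^sup>+x. F x \<partial>distr \<Omega> borel X) = (\<integral>\<^sup>+x. F x \<partial>P)"
    using nn_integral_law_XZ[of "\<lambda>(x, h). F x"] by (simp add: nn_integral_distr C.emeasure_space_1)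
qed (simp_all add: sets_P)

lemma distr_Z: "distr \<Omega> borel Z = C"
proof (rule measure_eqI_nn_integral)
  fix F :: "'h \<Rightarrow> ennreal" assume [measurable]: "F \<in> borel_measurable borel"
  show "(\<integral>\<^sup>+x. F x \<partial>distr \<Omega> borel Z) = (\<integral>\<^sup>+x. F x \<partial>C)"
    using nn_integral_law_XZ[of "\<lambda>(x, h). F h"] by (simp add: nn_integral_distr P.emeasure_space_1)
qed (simp_all add: sets_C)

lemma distr_XZ: "distr \<Omega> (borel \<Otimes>\<^sub>M borel) (\<lambda>\<omega>. (X \<omega>, Z \<omega>)) = P \<Otimes>\<^sub>M C"
proof (rule measure_eqI_nn_integral)
  interpret PC: pair_sigma_finite P C ..
  fix F :: "'x \<times> 'h \<Rightarrow> ennreal" assume "F \<in> borel_measurable borel"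
  then have [measurable]: "F \<in> borel_measurable (borel \<Otimes>\<^sub>M borel)" by (simp add: borel_prod)
  have "(\<integral>\<^sup>+x. F x \<partial>distr \<Omega> (borel \<Otimes>\<^sub>M borel) (\<lambda>\<omega>. (X \<omega>, Z \<omega>))) = (\<integral>\<^sup>+h. \<integral>\<^sup>+x. F (x, h) \<partial>P \<partial>C)"
    by (simp add: nn_integral_distr nn_integral_law_XZ)
  also have "\<dots> = (\<integral>\<^sup>+x. F x \<partial>(P \<Otimes>\<^sub>M C))"
    by (rule PC.nn_integral_snd) measurable
  finally show "(\<integral>\<^sup>+x. F x \<partial>distr \<Omega> (borel \<Otimes>\<^sub>M borel) (\<lambda>\<omega>. (X \<omega>, Z \<omega>))) = (\<integral>\<^sup>+x. F x \<partial>(P \<Otimes>\<^sub>M C))" .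
qed (simp_all add: borel_prod[symmetric] sets_P sets_C cong: sets_pair_measure_cong)

lemma distr_YZ: "distr \<Omega> (borel \<Otimes>\<^sub>M borel) (\<lambda>\<omega>. (Y \<omega>, Z \<omega>)) = density (lborel \<Otimes>\<^sub>M C) (\<lambda>(y, h). ennreal (p h y))"
proof (rule measure_eqI_nn_integral)
  interpret LC: pair_sigma_finite "lborel :: 'y measure" C ..
  fix F :: "'y \<times> 'h \<Rightarrow> ennreal" assume "F \<in> borel_measurable borel"
  then have [measurable]: "F \<in> borel_measurable (borel \<Otimes>\<^sub>M borel)" by (simp add: borel_prod)
  have "(\<integral>\<^sup>+x. F x \<partial>distr \<Omega> (borel \<Otimes>\<^sub>M borel) (\<lambda>\<omega>. (Y \<omega>, Z \<omega>))) = (\<integral>\<^sup>+h. \<integral>\<^sup>+y. ennreal (p h y) * F (y, h) \<partial>lborel \<partial>C)"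
    by (simp add: nn_integral_distr nn_integral_law_YZ)
  also have "\<dots> = (\<integral>\<^sup>+z. ennreal (p (snd z) (fst z)) * F z \<partial>(lborel \<Otimes>\<^sub>M C))"
    by (subst LC.nn_integral_snd[symmetric]) auto
  also have "\<dots> = (\<integral>\<^sup>+z. F z \<partial>density (lborel \<Otimes>\<^sub>M C) (\<lambda>(y, h). ennreal (p h y)))"
    by (subst nn_integral_density) (auto simp: split_def)
  finally show "(\<integral>\<^sup>+x. F x \<partial>distr \<Omega> (borel \<Otimes>\<^sub>M borel) (\<lambda>\<omega>. (Y \<omega>, Z \<omega>)))
     = (\<integral>\<^sup>+z. F z \<partial>density (lborel \<Otimes>\<^sub>M C) (\<lambda>(y, h). ennreal (p h y)))" .
qed (simp_all add: borel_prod[symmetric] sets_C cong: sets_pair_measure_cong)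

lemma distr_XYZ:
  "distr \<Omega> (borel \<Otimes>\<^sub>M (borel \<Otimes>\<^sub>M borel)) (\<lambda>\<omega>. (X \<omega>, Y \<omega>, Z \<omega>))
   = density (P \<Otimes>\<^sub>M (lborel \<Otimes>\<^sub>M C)) (\<lambda>(x, y, h). ennreal (g h x y))"
proof (rule measure_eqI_nn_integral)
  interpret LC: pair_sigma_finite "lborel :: 'y measure" C ..
  interpret LCs: sigma_finite_measure "lborel \<Otimes>\<^sub>M C" by (rule sigma_finite_pair_measure) standard+
  interpret PLC: pair_sigma_finite P "lborel \<Otimes>\<^sub>M C" ..
  interpret PC: pair_sigma_finite P C ..
  fix F :: "'x \<times> 'y \<times> 'h \<Rightarrow> ennreal" assume "F \<in> borel_measurable borel"
  then have [measurable]: "F \<in> borel_measurable (borel \<Otimes>\<^sub>M (borel \<Otimes>\<^sub>M borel))" by (simp add: borel_prod)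
  have "(\<integral>\<^sup>+x. F x \<partial>distr \<Omega> (borel \<Otimes>\<^sub>M (borel \<Otimes>\<^sub>M borel)) (\<lambda>\<omega>. (X \<omega>, Y \<omega>, Z \<omega>)))
     = (\<integral>\<^sup>+h. \<integral>\<^sup>+x. \<integral>\<^sup>+y. ennreal (g h x y) * F (x, y, h) \<partial>lborel \<partial>P \<partial>C)"
    by (subst nn_integral_distr) (simp_all add: law)
  also have "\<dots> = (\<integral>\<^sup>+x. \<integral>\<^sup>+h. \<integral>\<^sup>+y. ennreal (g h x y) * F (x, y, h) \<partial>lborel \<partial>C \<partial>P)"
    by (rule PC.Fubini') measurable
  also have "\<dots> = (\<integral>\<^sup>+x. \<integral>\<^sup>+z. ennreal (g (snd z) x (fst z)) * F (x, z) \<partial>(lborel \<Otimes>\<^sub>M C) \<partial>P)"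
    by (intro nn_integral_cong, subst LC.nn_integral_snd[symmetric]) auto
  also have "\<dots> = (\<integral>\<^sup>+z. ennreal (g (snd (snd z)) (fst z) (fst (snd z))) * F z \<partial>(P \<Otimes>\<^sub>M (lborel \<Otimes>\<^sub>M C)))"
    by (subst LCs.nn_integral_fst[symmetric]) auto
  also have "\<dots> = (\<integral>\<^sup>+z. F z \<partial>density (P \<Otimes>\<^sub>M (lborel \<Otimes>\<^sub>M C)) (\<lambda>(x, y, h). ennreal (g h x y)))"
    by (subst nn_integral_density) (auto simp: split_def)
  finally show "(\<integral>\<^sup>+x. F x \<partial>distr \<Omega> (borel \<Otimes>\<^sub>M (borel \<Otimes>\<^sub>M borel)) (\<lambda>\<omega>. (X \<omega>, Y \<omega>, Z \<omega>)))
    = (\<integral>\<^sup>+z. F z \<partial>density (P \<Otimes>\<^sub>M (lborel \<Otimes>\<^sub>M C)) (\<lambda>(x, y, h). ennreal (g h x y)))" .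
qed (simp_all add: borel_prod[symmetric] sets_P sets_C cong: sets_pair_measure_cong)

text \<open>Conditional mutual information is defined as I(X; (Y, Z)) - I(X; Z). The subtracted term
  vanishes because the input is independent of the channels.\<close>

lemma mutual_information_XZ: "mutual_information b borel borel X Z = 0"
proof -
  interpret PC: prob_space "P \<Otimes>\<^sub>M C" by (intro prob_space_pair prob_P prob_C)
  show ?thesis
    unfolding mutual_information_def distr_X distr_Z distr_XZ by (rule PC.KL_same_eq_0)
qed

text \<open>Relative to the reference measure
  \<open>P \<Otimes>\<^sub>M (lborel \<Otimes>\<^sub>M C)\<close> the joint law has density
  \<open>g\<close> and the product of marginals has density \<open>p\<close>, so the divergence is
  the mean of ln (g / p). With \<open>P\<close> itself in the reference measure the input needs no
  density, so discrete inputs are covered.\<close>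

lemma conditional_mutual_information_eq_expectation:
  "conditional_mutual_information (exp 1) borel borel borel X Y Z
   = expectation (\<lambda>\<omega>. ln (g (Z \<omega>) (X \<omega>) (Y \<omega>) / p (Z \<omega>) (Y \<omega>)))"
proof -
  let ?M = "P \<Otimes>\<^sub>M (lborel \<Otimes>\<^sub>M C)"
  interpret LCs: sigma_finite_measure "lborel \<Otimes>\<^sub>M C" by (rule sigma_finite_pair_measure) standard+
  interpret M: sigma_finite_measure ?M by (rule sigma_finite_pair_measure) standard+
  have gm [measurable]: "(\<lambda>(x, y, h). g h x y) \<in> borel_measurable ?M" by measurable
  have pm [measurable]: "(\<lambda>(x, y, h). p h y) \<in> borel_measurable ?M" by measurable
  have "prob_space (distr \<Omega> (borel \<Otimes>\<^sub>M borel) (\<lambda>\<omega>. (Y \<omega>, Z \<omega>)))"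
    by (intro prob_space_distr) measurable
  then have sf: "sigma_finite_measure (density (lborel \<Otimes>\<^sub>M C) (\<lambda>(y, h). ennreal (p h y)))"
    unfolding distr_YZ by (rule prob_space_imp_sigma_finite)
  have prod: "P \<Otimes>\<^sub>M density (lborel \<Otimes>\<^sub>M C) (\<lambda>(y, h). ennreal (p h y)) = density ?M (\<lambda>(x, y, h). ennreal (p h y))"
    using pair_measure_density[of "\<lambda>_. 1" P "\<lambda>(y, h). ennreal (p h y)" "lborel \<Otimes>\<^sub>M C", OF _ _ LCs.sigma_finite_measure_axioms sf]
    by (simp add: density_1 split_def)
  have "mutual_information (exp 1) borel (borel \<Otimes>\<^sub>M borel) X (\<lambda>\<omega>. (Y \<omega>, Z \<omega>))
     = KL_divergence (exp 1) (density ?M (\<lambda>z. ennreal (case z of (x, y, h) \<Rightarrow> p h y)))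
         (density ?M (\<lambda>z. ennreal (case z of (x, y, h) \<Rightarrow> g h x y)))"
    unfolding mutual_information_def distr_X distr_YZ distr_XYZ prod by (simp add: split_def)
  also have "\<dots> = (\<integral>z. (case z of (x, y, h) \<Rightarrow> g h x y) *
       log (exp 1) ((case z of (x, y, h) \<Rightarrow> g h x y) / (case z of (x, y, h) \<Rightarrow> p h y)) \<partial>?M)"
    using g_pos p_pos by (intro M.KL_density_density) (auto intro!: AE_I2 simp: less_imp_le split_def g_nonzero p_nonzero)
  also have "\<dots> = (\<integral>z. ln ((case z of (x, y, h) \<Rightarrow> g h x y) / (case z of (x, y, h) \<Rightarrow> p h y))
      \<partial>density ?M (\<lambda>z. ennreal (case z of (x, y, h) \<Rightarrow> g h x y)))"
    using g_pos by (subst integral_density) (auto intro!: AE_I2 simp: less_imp_le split_def log_ln[symmetric])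
  also have "density ?M (\<lambda>z. ennreal (case z of (x, y, h) \<Rightarrow> g h x y))
     = distr \<Omega> (borel \<Otimes>\<^sub>M (borel \<Otimes>\<^sub>M borel)) (\<lambda>\<omega>. (X \<omega>, Y \<omega>, Z \<omega>))"
    unfolding distr_XYZ by (simp add: split_def)
  also have "(\<integral>z. ln ((case z of (x, y, h) \<Rightarrow> g h x y) / (case z of (x, y, h) \<Rightarrow> p h y)) \<partial>\<dots>)
     = expectation (\<lambda>\<omega>. ln (g (Z \<omega>) (X \<omega>) (Y \<omega>) / p (Z \<omega>) (Y \<omega>)))"
    by (subst integral_distr) auto
  finally show ?thesis
    unfolding conditional_mutual_information_def mutual_information_XZ by simp
qed

text \<open>Gibbs' inequality. A divergent integral has the value 0, so this case needs the separate
  argument that the right-hand side is nonnegative.\<close>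

lemma conditional_mutual_information_le:
  assumes q [measurable]: "(\<lambda>(h, y). q h y) \<in> borel_measurable (borel \<Otimes>\<^sub>M borel)"
    and q_pos: "\<And>h y. q h y > 0" and q_one: "\<And>h. (\<integral>\<^sup>+y. ennreal (q h y) \<partial>lborel) = 1"
    and int: "integrable \<Omega> (\<lambda>\<omega>. ln (g (Z \<omega>) (X \<omega>) (Y \<omega>) / q (Z \<omega>) (Y \<omega>)))"
  shows "conditional_mutual_information (exp 1) borel borel borel X Y Z
     \<le> expectation (\<lambda>\<omega>. ln (g (Z \<omega>) (X \<omega>) (Y \<omega>) / q (Z \<omega>) (Y \<omega>)))" (is "_ \<le> expectation ?L")
proof -
  have [measurable (raw)]: "(\<lambda>x. q (a x) (c x)) \<in> borel_measurable M"
    if "a \<in> borel_measurable M" "c \<in> borel_measurable M" for a c and M :: "'z measure"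
    using measurable_compose[OF _ q, of "\<lambda>x. (a x, c x)" M] that by simp
  let ?W = "\<lambda>\<omega>. ln (g (Z \<omega>) (X \<omega>) (Y \<omega>) / p (Z \<omega>) (Y \<omega>))"
  show ?thesis
  proof (cases "integrable \<Omega> ?W")
    case True
    \<comment> \<open>Under the law of output and state the density \<open>p\<close> cancels, so
      this ratio has mean 1, and its logarithm is exactly the difference of the two
      integrands.\<close>
    let ?U = "\<lambda>\<omega>. q (Z \<omega>) (Y \<omega>) / p (Z \<omega>) (Y \<omega>)"
    have ln: "ln (?U \<omega>) = ?W \<omega> - ?L \<omega>" for \<omega>
      using g_nonzero p_nonzero q_pos[of "Z \<omega>" "Y \<omega>"] by (simp add: ln_div)
    have "(\<integral>\<^sup>+\<omega>. ennreal (?U \<omega>) \<partial>\<Omega>) = (\<integral>\<^sup>+h. \<integral>\<^sup>+y. ennreal (p h y) * ennreal (q h y / p h y) \<partial>lborel \<partial>C)"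
      using nn_integral_law_YZ[of "\<lambda>(y, h). ennreal (q h y / p h y)"] by simp
    also have "\<dots> = (\<integral>\<^sup>+h. \<integral>\<^sup>+y. ennreal (q h y) \<partial>lborel \<partial>C)"
      using p_pos by (simp add: ennreal_mult'[symmetric] less_imp_le g_nonzero p_nonzero)
    also have "\<dots> = 1" using C.emeasure_space_1 by (simp add: q_one)
    finally have "expectation (\<lambda>\<omega>. ln (?U \<omega>)) \<le> 0"
      using True int q_pos p_pos by (intro expectation_ln_le_0) (auto simp: ln)
    then show ?thesis
      using True int unfolding conditional_mutual_information_eq_expectation by (simp add: ln)
  next
    case False
    \<comment> \<open>With \<open>g\<close> in place of \<open>p\<close> the ratio has mean 1 even
      for fixed input and state. Gibbs' inequality then says that the mean of ln (g / q) is
      nonnegative.\<close>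
    let ?U = "\<lambda>\<omega>. q (Z \<omega>) (Y \<omega>) / g (Z \<omega>) (X \<omega>) (Y \<omega>)"
    have ln: "ln (?U \<omega>) = - ?L \<omega>" for \<omega>
      using g_nonzero q_pos[of "Z \<omega>" "Y \<omega>"] by (simp add: ln_div)
    have "(\<integral>\<^sup>+\<omega>. ennreal (?U \<omega>) \<partial>\<Omega>) = (\<integral>\<^sup>+h. \<integral>\<^sup>+x. \<integral>\<^sup>+y. ennreal (g h x y) * ennreal (q h y / g h x y) \<partial>lborel \<partial>P \<partial>C)"
      using law[of "\<lambda>(x, y, h). ennreal (q h y / g h x y)"] by simp
    also have "\<dots> = (\<integral>\<^sup>+h. \<integral>\<^sup>+x. \<integral>\<^sup>+y. ennreal (q h y) \<partial>lborel \<partial>P \<partial>C)"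
      using g_pos by (simp add: ennreal_mult'[symmetric] less_imp_le g_nonzero p_nonzero)
    also have "\<dots> = 1" using C.emeasure_space_1 P.emeasure_space_1 by (simp add: q_one)
    finally have "expectation (\<lambda>\<omega>. ln (?U \<omega>)) \<le> 0"
      using int q_pos g_pos by (intro expectation_ln_le_0) (auto simp: ln)
    then have "0 \<le> expectation ?L" by (simp add: ln)
    then show ?thesis
      using False unfolding conditional_mutual_information_eq_expectation by (simp add: not_integrable_integral_eq)
  qed
qed

text \<open>Agreement almost everywhere is all that is available later, where densities are compared
  through the measures they define. Since the output has a density given the state, the exceptional
  outputs have probability 0.\<close>

lemma conditional_mutual_information_eqI:
  assumes q [measurable]: "(\<lambda>(h, y). q h y) \<in> borel_measurable (borel \<Otimes>\<^sub>M borel)"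
    and eq: "\<And>h. AE y in lborel. q h y = p h y"
  shows "conditional_mutual_information (exp 1) borel borel borel X Y Z
     = expectation (\<lambda>\<omega>. ln (g (Z \<omega>) (X \<omega>) (Y \<omega>) / q (Z \<omega>) (Y \<omega>)))"
proof -
  have [measurable (raw)]: "(\<lambda>x. q (a x) (c x)) \<in> borel_measurable M"
    if "a \<in> borel_measurable M" "c \<in> borel_measurable M" for a c and M :: "'z measure"
    using measurable_compose[OF _ q, of "\<lambda>x. (a x, c x)" M] that by simp
  have "(\<integral>\<^sup>+\<omega>. (if q (Z \<omega>) (Y \<omega>) = p (Z \<omega>) (Y \<omega>) then 0 else 1) \<partial>\<Omega>)
     = (\<integral>\<^sup>+h. \<integral>\<^sup>+y. ennreal (p h y) * (if q h y = p h y then 0 else 1) \<partial>lborel \<partial>C)"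
    using nn_integral_law_YZ[of "\<lambda>(y, h). if q h y = p h y then 0 else 1"] by simp
  also have "\<dots> = (\<integral>\<^sup>+h. 0 \<partial>C)"
  proof (intro nn_integral_cong)
    fix h
    have "(\<integral>\<^sup>+y. ennreal (p h y) * (if q h y = p h y then 0 else 1) \<partial>lborel) = (\<integral>\<^sup>+(y::'y). 0 \<partial>lborel)"
      using eq[of h] by (intro nn_integral_cong_AE) (auto elim!: eventually_mono)
    then show "(\<integral>\<^sup>+y. ennreal (p h y) * (if q h y = p h y then 0 else 1) \<partial>lborel) = 0" by simp
  qed
  finally have "AE \<omega> in \<Omega>. (if q (Z \<omega>) (Y \<omega>) = p (Z \<omega>) (Y \<omega>) then 0 else 1 :: ennreal) = 0"
    by (subst nn_integral_0_iff_AE[symmetric]) auto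
  then show ?thesis
    unfolding conditional_mutual_information_eq_expectation
    by (intro integral_cong_AE) (auto elim!: eventually_mono split: if_splits)
qed

end

section \<open>The dual-hop channel\<close>

lemma measurable_det [measurable (raw)]:
  fixes f :: "'a \<Rightarrow> complex^'n^'n"
  assumes [measurable]: "f \<in> borel_measurable M"
  shows "(\<lambda>x. det (f x)) \<in> borel_measurable M"
  unfolding det_def by measurable

lemma measurable_matrix_mult [measurable (raw)]:
  fixes f :: "'a \<Rightarrow> complex^'n^'m" and g :: "'a \<Rightarrow> complex^'l^'n"
  assumes [measurable]: "f \<in> borel_measurable M" "g \<in> borel_measurable M"
  shows "(\<lambda>x. f x ** g x) \<in> borel_measurable M"
  unfolding matrix_matrix_mult_def by measurable

lemma measurable_ctranspose [measurable (raw)]: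
  fixes f :: "'a \<Rightarrow> complex^'n^'m"
  assumes [measurable]: "f \<in> borel_measurable M"
  shows "(\<lambda>x. ctranspose (f x)) \<in> borel_measurable M"
  unfolding ctranspose_def by measurable

lemma measurable_lndet [measurable (raw)]:
  fixes f :: "'a \<Rightarrow> complex^'n^'n"
  assumes [measurable]: "f \<in> borel_measurable M"
  shows "(\<lambda>x. lndet (f x)) \<in> borel_measurable M"
  unfolding lndet_def by measurable

lemma measurable_inv_quad_joint:
  fixes f :: "'a \<Rightarrow> complex^'n^'n"
  assumes [measurable]: "f \<in> borel_measurable M" "y \<in> borel_measurable M" and "\<And>x. posdef (f x)"
  shows "(\<lambda>x. inv_quad (f x) (y x)) \<in> borel_measurable M"
proof -
  have [measurable]: "(\<lambda>x. (\<chi> i j. if j = k then y x $ i else f x $ i $ j) :: complex^'n^'n) \<in> borel_measurable M" for k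
    by (intro borel_measurable_vec_lambda) simp
  show ?thesis
    unfolding inv_quad_cramer[OF posdef_invertible[OF assms(3)]] by measurable
qed

lemma measurable_gauss_density_joint:
  fixes f :: "'a \<Rightarrow> complex^'n^'n"
  assumes [measurable]: "f \<in> borel_measurable M" "y \<in> borel_measurable M" and "\<And>x. posdef (f x)"
  shows "(\<lambda>x. gauss_density (f x) (y x)) \<in> borel_measurable M"
proof -
  note [measurable] = measurable_inv_quad_joint[OF assms]
  show ?thesis unfolding gauss_density_def by measurable
qed

lemma ctranspose_mult: "ctranspose (A ** B) = ctranspose B ** ctranspose A"
  by (simp add: ctranspose_def matrix_matrix_mult_def vec_eq_iff mult.commute)

lemma gram_scaleR: "(c *\<^sub>R A) ** ctranspose (c *\<^sub>R A) = c\<^sup>2 *\<^sub>R (A ** ctranspose A)"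
  by (simp add: vec_eq_iff ctranspose_def matrix_matrix_mult_def scaleR_sum_right power2_eq_square)

lemma scaleR_matrix_vector_mult: "(c *\<^sub>R A) *v x = c *\<^sub>R (A *v (x :: complex^'n))"
  and matrix_vector_mult_scaleR_right: "A *v (c *\<^sub>R x) = c *\<^sub>R (A *v (x :: complex^'n))"
  by (simp_all add: matrix_vector_mult_def vec_eq_iff scaleR_sum_right)

lemma matrix_mult_mat_one: "mat 1 ** ctranspose (mat 1 :: complex^'n^'n) = mat 1"
proof -
  have "ctranspose (mat 1 :: complex^'n^'n) = mat 1"
    by (auto simp: ctranspose_def mat_def vec_eq_iff)
  then show ?thesis by simp
qed

text \<open>With \<open>b = 1\<close> this covers \<open>\<Phi>\<close> and \<open>\<Phi> + f\<^sub>4 G\<close>, with \<open>b = B\<close> the covariance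
  matrices of the noise and of the received vector.\<close>

definition amp_cov :: "real \<Rightarrow> real \<Rightarrow> real \<Rightarrow> (complex^'k^'m) \<times> (complex^'m^'n) \<Rightarrow> complex^'n^'n" where
  "amp_cov b c d H = mat (of_real b) + c *\<^sub>R (snd H ** ctranspose (snd H))
     + d *\<^sub>R ((snd H ** fst H) ** ctranspose (snd H ** fst H))"

lemma posdef_amp_cov: "b > 0 \<Longrightarrow> c \<ge> 0 \<Longrightarrow> d \<ge> 0 \<Longrightarrow> posdef (amp_cov b c d H)"
  unfolding amp_cov_def by (intro posdef_add_gram posdef_scalar)

lemma measurable_amp_cov [measurable (raw)]:
  assumes [measurable]: "H \<in> borel_measurable M"
  shows "(\<lambda>x. amp_cov b c d (H x)) \<in> borel_measurable M"
proof -
  have "(\<lambda>x. fst (H x)) \<in> borel_measurable M" "(\<lambda>x. snd (H x)) \<in> borel_measurable M"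
    using measurable_compose[OF assms, of fst borel] measurable_compose[OF assms, of snd borel]
    by (simp_all add: borel_prod[symmetric])
  note [measurable] = this
  show ?thesis unfolding amp_cov_def by measurable
qed

text \<open>The offset \<open>s\<close> holds the signal and the noise terms not yet integrated
  out.\<close>

lemma nn_integral_gauss_measure_shift_step:
  fixes A :: "complex^'j^'n"
  assumes "posdef S" and [measurable]: "F \<in> borel_measurable borel" and "v \<ge> 0"
  shows "(\<integral>\<^sup>+x. \<integral>\<^sup>+w. F (s + A *v x + w) \<partial>gauss_measure S \<partial>cn_vec (\<lambda>_. v))
       = (\<integral>\<^sup>+w. F (s + w) \<partial>gauss_measure (S + v *\<^sub>R (A ** ctranspose A)))"
  using nn_integral_gauss_measure_add_cn_vec_const[OF assms(1) _ assms(3), of "\<lambda>w. F (s + w)" A]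
  by (simp add: add.assoc)

text \<open>The output is linear in the six noise terms, which are absorbed into one Gaussian vector
  from the innermost integral outwards.\<close>

lemma nn_integral_noise:
  fixes H1 :: "complex^'k^'m" and H2 :: "complex^'m^'n"
  assumes [measurable]: "F \<in> borel_measurable borel"
    and v: "v1 \<ge> 0" "v2 \<ge> 0" "v3 \<ge> 0" "v4 \<ge> 0" "\<nu> \<ge> 0"
  shows "(\<integral>\<^sup>+n1. \<integral>\<^sup>+n2. F (hop_output (sqrt \<nu> *\<^sub>R hop_output x (H1, n1)) (H2, n2))
       \<partial>(cn_vec (\<lambda>_. v3) \<Otimes>\<^sub>M (cn_vec (\<lambda>_. v4) \<Otimes>\<^sub>M cn_vec (\<lambda>_. 1)))
       \<partial>(cn_vec (\<lambda>_. v1) \<Otimes>\<^sub>M (cn_vec (\<lambda>_. v2) \<Otimes>\<^sub>M cn_vec (\<lambda>_. 1))))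
    = (\<integral>\<^sup>+w. F ((sqrt \<nu> *\<^sub>R (H2 ** H1)) *v x + w) \<partial>gauss_measure (amp_cov (v4 + 1) (v3 + \<nu> * (v2 + 1)) (\<nu> * v1) (H1, H2)))"
proof -
  let ?r = "sqrt \<nu>"
  let ?A = "?r *\<^sub>R (H2 ** H1)" and ?B = "?r *\<^sub>R H2" and ?I = "mat 1 :: complex^'n^'n"
  \<comment> \<open>Starting from the thermal noise of the base station, the updates add in turn its
    receive distortion, the relay's transmit distortion, the amplified thermal noise and receive
    distortion of the relay, and the users' transmit distortion.\<close>
  define S1 where "S1 = ?I + v4 *\<^sub>R (?I ** ctranspose ?I)"
  define S2 where "S2 = S1 + v3 *\<^sub>R (H2 ** ctranspose H2)"
  define S3 where "S3 = S2 + 1 *\<^sub>R (?B ** ctranspose ?B)"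
  define S4 where "S4 = S3 + v2 *\<^sub>R (?B ** ctranspose ?B)"
  define S5 where "S5 = S4 + v1 *\<^sub>R (?A ** ctranspose ?A)"
  have p0: "posdef ?I" using posdef_scalar[of 1] by simp
  have p: "posdef S1" "posdef S2" "posdef S3" "posdef S4" "posdef S5"
    unfolding S5_def S4_def S3_def S2_def S1_def using v by (intro posdef_add_gram p0; simp)+
  have S5: "S5 = amp_cov (v4 + 1) (v3 + \<nu> * (v2 + 1)) (\<nu> * v1) (H1, H2)"
    unfolding S5_def S4_def S3_def S2_def S1_def amp_cov_def gram_scaleR matrix_mult_mat_one using v
    by (simp add: vec_eq_iff mat_def complex_eq_iff algebra_simps)
  have I: "cn_vec (\<lambda>_::'n. 1) = gauss_measure ?I" using gauss_measure_mat[of 1, where 'n='n] by simp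
  interpret N1: prob_space "cn_vec (\<lambda>_. 1) :: (complex^'m) measure" by (rule prob_space_cn_vec)
  interpret N2: prob_space "cn_vec (\<lambda>_. v2) :: (complex^'m) measure" by (rule prob_space_cn_vec)
  interpret N3: prob_space "cn_vec (\<lambda>_. 1) :: (complex^'n) measure" by (rule prob_space_cn_vec)
  interpret N4: prob_space "cn_vec (\<lambda>_. v4) :: (complex^'n) measure" by (rule prob_space_cn_vec)
  interpret N21: prob_space "cn_vec (\<lambda>_. v2) \<Otimes>\<^sub>M cn_vec (\<lambda>_. 1) :: ((complex^'m) \<times> (complex^'m)) measure"
    by (intro prob_space_pair prob_space_cn_vec)
  interpret N43: prob_space "cn_vec (\<lambda>_. v4) \<Otimes>\<^sub>M cn_vec (\<lambda>_. 1) :: ((complex^'n) \<times> (complex^'n)) measure"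
    by (intro prob_space_pair prob_space_cn_vec)
  interpret C1: prob_space "gauss_measure S2" by (rule prob_space_gauss_measure[OF p(2)])
  have lin: "hop_output (?r *\<^sub>R hop_output x (H1, n1)) (H2, n2)
    = ?A *v x + ?A *v fst n1 + ?B *v fst (snd n1) + ?B *v snd (snd n1) + H2 *v fst n2 + ?I *v fst (snd n2) + snd (snd n2)" for n1 n2
    by (simp add: hop_output_eq matrix_vector_right_distrib matrix_vector_mul_assoc[symmetric]
      scaleR_matrix_vector_mult matrix_vector_mult_scaleR_right scaleR_add_right)
  have inner: "(\<integral>\<^sup>+n2. F (hop_output (?r *\<^sub>R hop_output x (H1, n1)) (H2, n2))
       \<partial>(cn_vec (\<lambda>_. v3) \<Otimes>\<^sub>M (cn_vec (\<lambda>_. v4) \<Otimes>\<^sub>M cn_vec (\<lambda>_. 1))))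
     = (\<integral>\<^sup>+w. F (?A *v x + ?A *v fst n1 + ?B *v fst (snd n1) + ?B *v snd (snd n1) + w) \<partial>gauss_measure S2)" (is "?L = _") for n1
  proof -
    define s where "s = ?A *v x + ?A *v fst n1 + ?B *v fst (snd n1) + ?B *v snd (snd n1)"
    have "?L = (\<integral>\<^sup>+d. \<integral>\<^sup>+e. \<integral>\<^sup>+f. F (s + H2 *v d + ?I *v e + f) \<partial>gauss_measure ?I \<partial>cn_vec (\<lambda>_. v4) \<partial>cn_vec (\<lambda>_. v3))"
      unfolding lin s_def[symmetric] I[symmetric]
      by (subst N43.nn_integral_fst[symmetric], measurable, intro nn_integral_cong, subst N3.nn_integral_fst[symmetric]) auto
    also have "\<dots> = (\<integral>\<^sup>+w. F (s + w) \<partial>gauss_measure S2)"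
      by (simp only: nn_integral_gauss_measure_shift_step[OF p0 assms(1) v(4)] S1_def[symmetric]
        nn_integral_gauss_measure_shift_step[OF p(1) assms(1) v(3)] S2_def[symmetric])
    finally show ?thesis by (simp add: s_def)
  qed
  have "(\<integral>\<^sup>+n1. \<integral>\<^sup>+w. F (?A *v x + ?A *v fst n1 + ?B *v fst (snd n1) + ?B *v snd (snd n1) + w) \<partial>gauss_measure S2
       \<partial>(cn_vec (\<lambda>_. v1) \<Otimes>\<^sub>M (cn_vec (\<lambda>_. v2) \<Otimes>\<^sub>M cn_vec (\<lambda>_. 1))))
    = (\<integral>\<^sup>+a. \<integral>\<^sup>+b. \<integral>\<^sup>+c. \<integral>\<^sup>+w. F (?A *v x + ?A *v a + ?B *v b + ?B *v c + w) \<partial>gauss_measure S2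
       \<partial>cn_vec (\<lambda>_. 1) \<partial>cn_vec (\<lambda>_. v2) \<partial>cn_vec (\<lambda>_. v1))"
    by (subst N21.nn_integral_fst[symmetric], measurable, intro nn_integral_cong, subst N1.nn_integral_fst[symmetric]) auto
  also have "\<dots> = (\<integral>\<^sup>+w. F (?A *v x + w) \<partial>gauss_measure S5)"
    using v by (simp only: nn_integral_gauss_measure_shift_step[OF p(2) assms(1) zero_le_one] S3_def[symmetric]
      nn_integral_gauss_measure_shift_step[OF p(3) assms(1) v(2)] S4_def[symmetric]
      nn_integral_gauss_measure_shift_step[OF p(4) assms(1) v(1)] S5_def[symmetric])
  finally show ?thesis unfolding inner S5 .
qed

text \<open>Produces the order required by \<open>law\<close> in \<open>channel_law\<close>:
  channels outermost, then the input, then the noise to be integrated for fixed channels.\<close>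

lemma nn_integral_dual_reorder:
  assumes prob: "prob_space P" "prob_space R1" "prob_space N1" "prob_space R2" "prob_space N2"
    and G [measurable]: "G \<in> borel_measurable ((P \<Otimes>\<^sub>M (R1 \<Otimes>\<^sub>M N1)) \<Otimes>\<^sub>M (R2 \<Otimes>\<^sub>M N2))"
  shows "(\<integral>\<^sup>+z. G z \<partial>((P \<Otimes>\<^sub>M (R1 \<Otimes>\<^sub>M N1)) \<Otimes>\<^sub>M (R2 \<Otimes>\<^sub>M N2)))
    = (\<integral>\<^sup>+h. \<integral>\<^sup>+x. \<integral>\<^sup>+n1. \<integral>\<^sup>+n2. G ((x, (fst h, n1)), (snd h, n2)) \<partial>N2 \<partial>N1 \<partial>P \<partial>(R1 \<Otimes>\<^sub>M R2))"
proof -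
  interpret P: prob_space P by fact
  interpret R1: prob_space R1 by fact
  interpret N1: prob_space N1 by fact
  interpret R2: prob_space R2 by fact
  interpret N2: prob_space N2 by fact
  interpret RN1: prob_space "R1 \<Otimes>\<^sub>M N1" by (intro prob_space_pair prob)
  interpret RN2: prob_space "R2 \<Otimes>\<^sub>M N2" by (intro prob_space_pair prob)
  interpret NR: pair_sigma_finite N1 R2 ..
  interpret PR1: pair_sigma_finite P R1 ..
  interpret PR2: pair_sigma_finite P R2 ..
  have "(\<integral>\<^sup>+z. G z \<partial>((P \<Otimes>\<^sub>M (R1 \<Otimes>\<^sub>M N1)) \<Otimes>\<^sub>M (R2 \<Otimes>\<^sub>M N2)))
     = (\<integral>\<^sup>+u. \<integral>\<^sup>+v. G (u, v) \<partial>(R2 \<Otimes>\<^sub>M N2) \<partial>(P \<Otimes>\<^sub>M (R1 \<Otimes>\<^sub>M N1)))"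
    by (subst RN2.nn_integral_fst[symmetric]) auto
  also have "\<dots> = (\<integral>\<^sup>+u. \<integral>\<^sup>+h2. \<integral>\<^sup>+n2. G (u, (h2, n2)) \<partial>N2 \<partial>R2 \<partial>(P \<Otimes>\<^sub>M (R1 \<Otimes>\<^sub>M N1)))"
    by (intro nn_integral_cong, subst N2.nn_integral_fst[symmetric]) auto
  also have "\<dots> = (\<integral>\<^sup>+x. \<integral>\<^sup>+v. \<integral>\<^sup>+h2. \<integral>\<^sup>+n2. G ((x, v), (h2, n2)) \<partial>N2 \<partial>R2 \<partial>(R1 \<Otimes>\<^sub>M N1) \<partial>P)"
    by (subst RN1.nn_integral_fst[symmetric]) auto
  also have "\<dots> = (\<integral>\<^sup>+x. \<integral>\<^sup>+h1. \<integral>\<^sup>+n1. \<integral>\<^sup>+h2. \<integral>\<^sup>+n2. G ((x, (h1, n1)), (h2, n2)) \<partial>N2 \<partial>R2 \<partial>N1 \<partial>R1 \<partial>P)"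
    by (intro nn_integral_cong, subst N1.nn_integral_fst[symmetric]) auto
  also have "\<dots> = (\<integral>\<^sup>+x. \<integral>\<^sup>+h1. \<integral>\<^sup>+h2. \<integral>\<^sup>+n1. \<integral>\<^sup>+n2. G ((x, (h1, n1)), (h2, n2)) \<partial>N2 \<partial>N1 \<partial>R2 \<partial>R1 \<partial>P)"
    by (intro nn_integral_cong NR.Fubini'[symmetric]) measurable
  also have "\<dots> = (\<integral>\<^sup>+h1. \<integral>\<^sup>+x. \<integral>\<^sup>+h2. \<integral>\<^sup>+n1. \<integral>\<^sup>+n2. G ((x, (h1, n1)), (h2, n2)) \<partial>N2 \<partial>N1 \<partial>R2 \<partial>P \<partial>R1)"
    by (rule PR1.Fubini'[symmetric]) measurable
  also have "\<dots> = (\<integral>\<^sup>+h1. \<integral>\<^sup>+h2. \<integral>\<^sup>+x. \<integral>\<^sup>+n1. \<integral>\<^sup>+n2. G ((x, (h1, n1)), (h2, n2)) \<partial>N2 \<partial>N1 \<partial>P \<partial>R2 \<partial>R1)"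
    by (intro nn_integral_cong PR2.Fubini'[symmetric]) measurable
  also have "\<dots> = (\<integral>\<^sup>+h. \<integral>\<^sup>+x. \<integral>\<^sup>+n1. \<integral>\<^sup>+n2. G ((x, (fst h, n1)), (snd h, n2)) \<partial>N2 \<partial>N1 \<partial>P \<partial>(R1 \<Otimes>\<^sub>M R2))"
    by (subst R2.nn_integral_fst[symmetric]) auto
  finally show ?thesis .
qed

section \<open>Integrability and scaling of the log-determinants\<close>

lemma integrable_rayleigh_norm_sq: "integrable (rayleigh :: (complex^'c^'r) measure) (\<lambda>H. (norm H)\<^sup>2)"
proof -
  have "integrable rayleigh (\<lambda>H::complex^'c^'r. Re (H $ i $ k * cnj (H $ i $ k)))" for i k
    using rayleigh_moments(2)[where i=i and k=k and j=i and l=k] by (intro integrable_Re) (auto simp: has_bochner_integral_iff)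
  moreover have "(norm H)\<^sup>2 = (\<Sum>i\<in>UNIV. \<Sum>k\<in>UNIV. Re (H $ i $ k * cnj (H $ i $ k)))" for H :: "complex^'c^'r"
    by (simp add: norm_vec_def L2_set_def sum_nonneg complex_norm_square[symmetric])
  ultimately show ?thesis by simp
qed

lemma norm_matrix_entry_le: "cmod (H $ i $ k) \<le> norm H"
  using Finite_Cartesian_Product.norm_nth_le[of "H $ i" k] Finite_Cartesian_Product.norm_nth_le[of H i] by linarith

lemma norm_matrix_mult_entry_le:
  fixes A :: "complex^'l^'n" and B :: "complex^'k^'l"
  shows "cmod ((A ** B) $ i $ j) \<le> CARD('l) * (norm A * norm B)"
proof -
  have "cmod ((A ** B) $ i $ j) \<le> (\<Sum>l\<in>UNIV. cmod (A $ i $ l * B $ l $ j))"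
    by (simp add: matrix_matrix_mult_def norm_sum)
  also have "\<dots> \<le> (\<Sum>l\<in>(UNIV::'l set). norm A * norm B)"
    by (intro sum_mono) (simp add: norm_mult mult_mono norm_matrix_entry_le)
  finally show ?thesis by simp
qed

lemma norm_ctranspose: "norm (ctranspose A) = norm A"
  unfolding norm_vec_def L2_set_def by (simp add: sum_nonneg ctranspose_def) (rule sum.swap)

text \<open>A crude Leibniz bound is good enough, as only the logarithm of the determinant has to be
  integrable.\<close>

lemma cmod_det_le:
  fixes A :: "complex^'n^'n"
  assumes "\<And>i j. cmod (A $ i $ j) \<le> c"
  shows "cmod (det A) \<le> fact CARD('n) * c ^ CARD('n)"
proof -
  have "cmod (det A) \<le> (\<Sum>p\<in>{p. p permutes (UNIV :: 'n set)}. cmod (of_int (sign p) * (\<Prod>i\<in>UNIV. A $ i $ p i)))"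
    unfolding det_def by (rule norm_sum)
  also have "\<dots> \<le> (\<Sum>p\<in>{p. p permutes (UNIV :: 'n set)}. c ^ CARD('n))"
  proof (intro sum_mono)
    fix p :: "'n \<Rightarrow> 'n"
    have "(\<Prod>i\<in>UNIV. cmod (A $ i $ p i)) \<le> (\<Prod>i\<in>(UNIV::'n set). c)"
      using assms by (intro prod_mono) auto
    then show "cmod (of_int (sign p) * (\<Prod>i\<in>UNIV. A $ i $ p i)) \<le> c ^ CARD('n)"
      by (simp add: norm_mult prod_norm[symmetric] sign_def)
  qed
  also have "\<dots> = fact CARD('n) * c ^ CARD('n)"
    by (simp add: card_permutations)
  finally show ?thesis .
qed

text \<open>Gram summands cannot decrease the determinant, so it is at least 1. Above, ln b <= b - 1
  trades the logarithm of the entry bound for the bound itself, whose mean is finite because the two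
  channels are independent with finite second moments.\<close>

lemma integrable_lndet_amp_cov:
  assumes "c \<ge> 0" "d \<ge> 0"
  shows "integrable (rayleigh \<Otimes>\<^sub>M rayleigh :: ((complex^'k^'m) \<times> (complex^'m^'n)) measure)
    (\<lambda>H. lndet (amp_cov 1 c d H))"
proof (rule Bochner_Integration.integrable_bound)
  let ?m = "real CARD('m)" and ?k = "real CARD('k)" and ?n = "real CARD('n)"
  \<comment> \<open>Bounds every entry of the matrix: an entry of H2 H2^H is a sum of
    \<open>?m\<close> products, and in the last term there are \<open>?k\<close> products of two
    entries of H2 H1, each a sum of \<open>?m\<close> products.\<close>
  let ?b = "\<lambda>H :: (complex^'k^'m) \<times> (complex^'m^'n).
     1 + (c * ?m) * (norm (snd H))\<^sup>2 + (d * ?k * ?m\<^sup>2) * ((norm (fst H))\<^sup>2 * (norm (snd H))\<^sup>2)"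
  let ?f = "\<lambda>H. ln (fact CARD('n)) + ?n * ?b H"
  note i2 = has_bochner_integral_integrable[OF integrable_rayleigh_norm_sq]
  note sf = prob_space_imp_sigma_finite[OF prob_space_rayleigh]
  interpret prob_space "rayleigh \<Otimes>\<^sub>M rayleigh :: ((complex^'k^'m) \<times> (complex^'m^'n)) measure"
    by (intro prob_space_pair prob_space_rayleigh)
  have "integrable (rayleigh \<Otimes>\<^sub>M rayleigh) (\<lambda>H :: (complex^'k^'m) \<times> (complex^'m^'n). (norm (snd H))\<^sup>2)"
    by (rule has_bochner_integral_snd[OF prob_space_rayleigh prob_space_rayleigh i2,
        unfolded has_bochner_integral_iff, THEN conjunct1])
  moreover have "integrable (rayleigh \<Otimes>\<^sub>M rayleigh) (\<lambda>H :: (complex^'k^'m) \<times> (complex^'m^'n). (norm (fst H))\<^sup>2 * (norm (snd H))\<^sup>2)"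
    by (rule has_bochner_integral_pair_mult[OF sf sf i2 i2, unfolded has_bochner_integral_iff, THEN conjunct1])
  ultimately show "integrable (rayleigh \<Otimes>\<^sub>M rayleigh) ?f" by simp
  show "(\<lambda>H. lndet (amp_cov 1 c d H :: complex^'n^'n)) \<in> borel_measurable (rayleigh \<Otimes>\<^sub>M rayleigh)"
    by (intro measurable_lndet measurable_amp_cov) (simp add: measurable_cong_sets[OF sets_pair_measure_cong[OF sets_rayleigh sets_rayleigh] refl] borel_prod)
  have "norm (lndet (amp_cov 1 c d H :: complex^'n^'n)) \<le> norm (?f H)" for H :: "(complex^'k^'m) \<times> (complex^'m^'n)"
  proof -
    let ?T = "amp_cov 1 c d H :: complex^'n^'n" and ?H1 = "fst H" and ?H2 = "snd H"
    have e1: "cmod ((?H2 ** ctranspose ?H2) $ i $ j) \<le> ?m * (norm ?H2)\<^sup>2" for i j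
      using norm_matrix_mult_entry_le[of ?H2 "ctranspose ?H2" i j] by (simp add: norm_ctranspose power2_eq_square)
    have e2: "cmod (((?H2 ** ?H1) ** ctranspose (?H2 ** ?H1)) $ i $ j) \<le> ?k * ?m\<^sup>2 * ((norm ?H1)\<^sup>2 * (norm ?H2)\<^sup>2)" for i j
    proof -
      have "cmod (((?H2 ** ?H1) ** ctranspose (?H2 ** ?H1)) $ i $ j) \<le> (\<Sum>l\<in>UNIV. cmod ((?H2 ** ?H1) $ i $ l * cnj ((?H2 ** ?H1) $ j $ l)))"
        unfolding matrix_matrix_mult_def[of "?H2 ** ?H1"] by (simp add: norm_sum ctranspose_def)
      also have "\<dots> \<le> (\<Sum>l\<in>(UNIV::'k set). (?m * (norm ?H2 * norm ?H1)) * (?m * (norm ?H2 * norm ?H1)))"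
        unfolding norm_mult complex_mod_cnj by (intro sum_mono mult_mono norm_matrix_mult_entry_le) auto
      finally show ?thesis by (simp add: power2_eq_square mult_ac)
    qed
    have ent: "cmod (?T $ i $ j) \<le> ?b H" for i j
    proof -
      have "cmod (?T $ i $ j) \<le> cmod ((mat 1 :: complex^'n^'n) $ i $ j) + c * cmod ((?H2 ** ctranspose ?H2) $ i $ j)
         + d * cmod (((?H2 ** ?H1) ** ctranspose (?H2 ** ?H1)) $ i $ j)"
        unfolding amp_cov_def using assms
        by (simp, intro order_trans[OF norm_triangle_ineq] add_mono order_trans[OF norm_triangle_ineq]) simp_all
      also have "\<dots> \<le> 1 + c * (?m * (norm ?H2)\<^sup>2) + d * (?k * ?m\<^sup>2 * ((norm ?H1)\<^sup>2 * (norm ?H2)\<^sup>2))"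
        using assms by (intro add_mono mult_left_mono e1 e2) (auto simp: mat_def)
      finally show ?thesis by (simp add: mult_ac)
    qed
    have b1: "?b H \<ge> 1" using assms by simp
    have T1: "posdef (mat (of_real 1) + c *\<^sub>R (?H2 ** ctranspose ?H2))"
      using assms by (intro posdef_add_gram posdef_scalar) auto
    have "1 = Re (det (mat (of_real 1) :: complex^'n^'n))" by simp
    also have "\<dots> \<le> Re (det (mat (of_real 1) + c *\<^sub>R (?H2 ** ctranspose ?H2)))"
      using assms by (intro det_add_gram_ge posdef_scalar) auto
    also have "\<dots> \<le> Re (det ?T)"
      unfolding amp_cov_def by (intro det_add_gram_ge T1 assms)
    finally have lo: "1 \<le> Re (det ?T)" .
    have "Re (det ?T) \<le> fact CARD('n) * ?b H ^ CARD('n)"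
      using cmod_det_le[of ?T "?b H", OF ent] complex_Re_le_cmod[of "det ?T"] by linarith
    then have "lndet ?T \<le> ln (fact CARD('n) * ?b H ^ CARD('n))"
      unfolding lndet_def using lo b1 by (subst ln_le_cancel_iff) (auto intro!: mult_pos_pos zero_less_power)
    also have "\<dots> = ln (fact CARD('n)) + ?n * ln (?b H)"
      using b1 by (subst ln_mult) (auto simp: ln_realpow)
    also have "\<dots> \<le> ?f H"
      using b1 ln_le_minus_one[of "?b H"] by (intro add_left_mono mult_left_mono) auto
    finally have "lndet ?T \<le> ?f H" .
    moreover have "0 \<le> lndet ?T" unfolding lndet_def using lo by simp
    ultimately show ?thesis by simp
  qed
  then show "AE H in rayleigh \<Otimes>\<^sub>M rayleigh. norm (lndet (amp_cov 1 c d H :: complex^'n^'n)) \<le> norm (?f H)"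
    by simp
qed

lemma matrix_mat_mult: "mat c ** A = (\<chi> i j. c * A $ i $ j)" for c :: "'a::semiring_1"
  by (simp add: vec_eq_iff matrix_matrix_mult_def mat_def if_distrib if_distribR cong: if_cong)

lemma matrix_mult_mat_of_real: "A ** mat (complex_of_real c) = c *\<^sub>R A"
  by (simp add: vec_eq_iff matrix_matrix_mult_def mat_def if_distrib if_distribR complex_eq_iff cong: if_cong)

lemma scaleR_matrix_mult: "(c *\<^sub>R A) ** B = c *\<^sub>R (A ** (B :: complex^'l^'n))"
  by (simp add: vec_eq_iff matrix_matrix_mult_def scaleR_sum_right)

lemma matrix_add_mult_distrib: "(A + B) ** C = A ** C + B ** (C :: complex^'l^'n)"
  by (simp add: vec_eq_iff matrix_matrix_mult_def distrib_right sum.distrib)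

text \<open>Relates the physical noise covariance B \<open>\<Phi>\<close> to the normalised
  \<open>\<Phi>\<close>. The additive constant cancels in differences.\<close>

lemma lndet_amp_cov_scale:
  assumes "b > 0" "c \<ge> 0" "d \<ge> 0"
  shows "lndet (amp_cov b (b * c) (b * d) H :: complex^'n^'n) = CARD('n) * ln b + lndet (amp_cov 1 c d H :: complex^'n^'n)"
proof -
  let ?T = "amp_cov 1 c d H :: complex^'n^'n"
  have eq: "amp_cov b (b * c) (b * d) H = mat (complex_of_real b) ** ?T"
    unfolding matrix_mat_mult by (auto simp: amp_cov_def vec_eq_iff mat_def complex_eq_iff algebra_simps)
  have "0 < Re (det ?T)" using posdef_det[OF posdef_amp_cov[of 1 c d H]] assms by simp
  moreover have "Re (det (amp_cov b (b * c) (b * d) H)) = b ^ CARD('n) * Re (det ?T)"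
    unfolding eq det_mul det_mat by (simp flip: of_real_power)
  ultimately show ?thesis
    using assms by (simp add: lndet_def ln_mult ln_realpow)
qed

lemma integrable_lndet_amp_cov':
  assumes "b > 0" "c \<ge> 0" "d \<ge> 0"
  shows "integrable (rayleigh \<Otimes>\<^sub>M rayleigh :: ((complex^'k^'m) \<times> (complex^'m^'n)) measure)
    (\<lambda>H. lndet (amp_cov b c d H))"
proof -
  interpret prob_space "rayleigh \<Otimes>\<^sub>M rayleigh :: ((complex^'k^'m) \<times> (complex^'m^'n)) measure"
    by (intro prob_space_pair prob_space_rayleigh)
  have "lndet (amp_cov b c d H) = CARD('n) * ln b + lndet (amp_cov 1 (c / b) (d / b) H)"
    for H :: "(complex^'k^'m) \<times> (complex^'m^'n)"
    using lndet_amp_cov_scale[of b "c / b" "d / b" H] assms by simp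
  then show ?thesis
    using integrable_lndet_amp_cov[of "c / b" "d / b", where 'k='k and 'm='m and 'n='n] assms by simp
qed

section \<open>The rate of the amplify-and-forward channel and its capacity\<close>

lemma trace_mat: "trace (mat c :: 'a::semiring_1^'n^'n) = of_nat CARD('n) * c"
  by (simp add: trace_def mat_def)

lemma gauss_density_le: "posdef S \<Longrightarrow> gauss_density S y \<le> 1 / (pi ^ CARD('n) * Re (det (S :: complex^'n^'n)))"
  using hdot_inv_eq(2)[of S y] posdef_det[of S] unfolding gauss_density_def
  by (intro divide_right_mono) auto

lemma ln_gauss_density:
  fixes S :: "complex^'n^'n"
  assumes "posdef S"
  shows "ln (gauss_density S y) = - inv_quad S y - CARD('n) * ln pi - lndet S"
  using posdef_det[OF assms] by (simp add: gauss_density_def ln_div ln_mult ln_realpow lndet_def)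

lemma amp_cov_add_gram:
  "amp_cov b c (d + e) H = amp_cov b c d H + e *\<^sub>R ((snd H ** fst H) ** ctranspose (snd H ** fst H))"
  by (simp add: amp_cov_def scaleR_add_left)

text \<open>The noise covariance has weight \<open>b\<close> on the identity (receive distortion and
  thermal noise of the base station), \<open>c\<close> on H2 H2^H (transmit distortion, amplified
  receive distortion and thermal noise of the relay) and \<open>d\<close> on H2 H1 H1^H H2^H
  (amplified transmit distortion of the users). The signal raises the last weight by
  \<open>\<nu> * \<mu>\<close>. The factors \<open>CARD('k) * \<mu>\<close> and
  \<open>CARD('m) * q\<close> are the traces of the two transmit covariances.\<close>

lemma ergodic_rate_amplify_forward:
  fixes P :: "(complex^'k) measure" and \<nu> \<mu> q \<delta>t1 \<delta>r1 \<delta>t2 \<delta>r2 :: real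
  assumes P: "prob_space P" "sets P = sets borel" "has_cov P (\<lambda>x. x) (mat (of_real \<mu>))"
    and relay: "relay_cov \<nu> \<delta>t1 \<delta>r1 P = (mat (of_real q) :: complex^'m^'m)"
    and nonneg: "\<mu> \<ge> 0" "\<nu> \<ge> 0" "q \<ge> 0"
  defines "b \<equiv> \<delta>r2\<^sup>2 * (real CARD('m) * q) + 1"
    and "c \<equiv> \<delta>t2\<^sup>2 * q + \<nu> * (\<delta>r1\<^sup>2 * (real CARD('k) * \<mu>) + 1)"
    and "d \<equiv> \<nu> * (\<delta>t1\<^sup>2 * \<mu>)"
  defines "I \<equiv> (\<integral>H. lndet (amp_cov b c (d + \<nu> * \<mu>) H) - lndet (amp_cov b c d H)
      \<partial>(rayleigh \<Otimes>\<^sub>M rayleigh :: ((complex^'k^'m) \<times> (complex^'m^'n)) measure))"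
  shows "ergodic_rate \<nu> \<delta>t1 \<delta>r1 \<delta>t2 \<delta>r2 TYPE('m) TYPE('n) P \<le> I"
    and "P = cn_vec (\<lambda>_. \<mu>) \<Longrightarrow> ergodic_rate \<nu> \<delta>t1 \<delta>r1 \<delta>t2 \<delta>r2 TYPE('m) TYPE('n) P = I"
proof -
  let ?\<Omega> = "dual_hop \<nu> \<delta>t1 \<delta>r1 \<delta>t2 \<delta>r2 P :: (((complex^'k) \<times> (complex^'k^'m) \<times> (complex^'k) \<times> (complex^'m) \<times> (complex^'m)) \<times>
     ((complex^'m^'n) \<times> (complex^'m) \<times> (complex^'n) \<times> (complex^'n))) measure"
  let ?C = "rayleigh \<Otimes>\<^sub>M rayleigh :: ((complex^'k^'m) \<times> (complex^'m^'n)) measure"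
  let ?X = "(\<lambda>((x1, _), _). x1) :: ((complex^'k) \<times> (complex^'k^'m) \<times> (complex^'k) \<times> (complex^'m) \<times> (complex^'m)) \<times>
     ((complex^'m^'n) \<times> (complex^'m) \<times> (complex^'n) \<times> (complex^'n)) \<Rightarrow> complex^'k"
  let ?Y = "\<lambda>((x1, e1), e2). hop_output (sqrt \<nu> *\<^sub>R hop_output x1 e1) e2 :: complex^'n"
  let ?Z = "\<lambda>((_, H1, _), (H2, _)). (H1 :: complex^'k^'m, H2 :: complex^'m^'n)"
  define A where "A H = sqrt \<nu> *\<^sub>R (snd H ** fst H)" for H :: "(complex^'k^'m) \<times> (complex^'m^'n)"
  define \<Sigma> where "\<Sigma> H = amp_cov b c d H" for H :: "(complex^'k^'m) \<times> (complex^'m^'n)"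
  define S where "S H = amp_cov b c (d + \<nu> * \<mu>) H" for H :: "(complex^'k^'m) \<times> (complex^'m^'n)"
  define g where "g H x y = gauss_density (\<Sigma> H) (y - A H *v x)" for H x y
  define N1 where "N1 = (cn_vec (\<lambda>_. \<delta>t1\<^sup>2 * \<mu>) \<Otimes>\<^sub>M (cn_vec (\<lambda>_. \<delta>r1\<^sup>2 * (real CARD('k) * \<mu>)) \<Otimes>\<^sub>M cn_vec (\<lambda>_. 1))
    :: ((complex^'k) \<times> (complex^'m) \<times> (complex^'m)) measure)"
  define N2 where "N2 = (cn_vec (\<lambda>_. \<delta>t2\<^sup>2 * q) \<Otimes>\<^sub>M (cn_vec (\<lambda>_. \<delta>r2\<^sup>2 * (real CARD('m) * q)) \<Otimes>\<^sub>M cn_vec (\<lambda>_. 1))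
    :: ((complex^'m) \<times> (complex^'n) \<times> (complex^'n)) measure)"
  have pos: "b > 0" "c \<ge> 0" "d \<ge> 0" "d + \<nu> * \<mu> \<ge> 0"
    using nonneg by (auto simp: b_def c_def d_def intro!: add_nonneg_pos)
  have p\<Sigma>: "posdef (\<Sigma> H)" and pS: "posdef (S H)" for H
    using pos by (auto simp: \<Sigma>_def S_def intro!: posdef_amp_cov)
  have S_eq: "S H = \<Sigma> H + \<mu> *\<^sub>R (A H ** ctranspose (A H))" for H
    using nonneg by (simp add: S_def \<Sigma>_def A_def amp_cov_add_gram gram_scaleR mult.commute)
  have \<Omega>: "?\<Omega> = (P \<Otimes>\<^sub>M (rayleigh \<Otimes>\<^sub>M N1)) \<Otimes>\<^sub>M (rayleigh \<Otimes>\<^sub>M N2)"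
    unfolding dual_hop_def first_hop_def hop_def relay has_cov_second_moment[OF P(3)] N1_def N2_def trace_mat
    by (simp add: mat_def)
  have prob: "prob_space N1" "prob_space N2" "prob_space ?\<Omega>" "prob_space ?C"
    unfolding \<Omega> unfolding N1_def N2_def by (intro prob_space_pair prob_space_cn_vec prob_space_rayleigh P(1))+
  note [measurable_cong] = P(2)
  have sC [measurable_cong]: "sets ?C = sets borel"
    unfolding borel_prod[symmetric] by (intro sets_pair_measure_cong sets_rayleigh)
  have sN [measurable_cong]: "sets N1 = sets (borel \<Otimes>\<^sub>M borel \<Otimes>\<^sub>M borel)" "sets N2 = sets (borel \<Otimes>\<^sub>M borel \<Otimes>\<^sub>M borel)"
    unfolding N1_def N2_def by (intro sets_pair_measure_cong sets_cn_vec)+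
  have XYZ: "?X \<in> borel_measurable ?\<Omega>" "?Y \<in> borel_measurable ?\<Omega>" "?Z \<in> borel_measurable ?\<Omega>"
  proof -
    have eq: "?X = (\<lambda>\<omega>. fst (fst \<omega>))"
      "?Y = (\<lambda>\<omega>. hop_output (sqrt \<nu> *\<^sub>R hop_output (fst (fst \<omega>)) (snd (fst \<omega>))) (snd \<omega>))"
      "?Z = (\<lambda>\<omega>. (fst (snd (fst \<omega>)), fst (snd \<omega>)))"
      by (auto simp: fun_eq_iff)
    show "?X \<in> borel_measurable ?\<Omega>"
      unfolding eq unfolding \<Omega> by measurable
    show "?Y \<in> borel_measurable ?\<Omega>"
      unfolding eq unfolding \<Omega> hop_output_eq by measurable
    show "?Z \<in> borel_measurable ?\<Omega>"
      unfolding eq unfolding \<Omega> borel_prod[symmetric] by measurable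
  qed
  have A_meas: "(\<lambda>x. A (h x)) \<in> borel_measurable M" if "h \<in> borel_measurable M" for h and M :: "'z measure"
  proof -
    have "(\<lambda>x. fst (h x)) \<in> borel_measurable M" "(\<lambda>x. snd (h x)) \<in> borel_measurable M"
      using measurable_compose[OF that, of fst borel] measurable_compose[OF that, of snd borel]
      by (simp_all add: borel_prod[symmetric])
    note [measurable] = this
    show ?thesis unfolding A_def by measurable
  qed
  note [measurable (raw)] = A_meas
  have gm: "(\<lambda>(h, x, y). g h x y) \<in> borel_measurable (borel \<Otimes>\<^sub>M borel \<Otimes>\<^sub>M borel)"
    unfolding g_def split_def
    by (intro measurable_gauss_density_joint p\<Sigma>) (simp_all add: \<Sigma>_def)
  \<comment> \<open>For fixed channels and input both noise integrals collapse to one Gaussian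
    vector with covariance \<open>\<Sigma> h\<close>.\<close>
  have law: "(\<integral>\<^sup>+\<omega>. F (?X \<omega>, ?Y \<omega>, ?Z \<omega>) \<partial>?\<Omega>) = (\<integral>\<^sup>+h. \<integral>\<^sup>+x. \<integral>\<^sup>+w. F (x, A h *v x + w, h) \<partial>gauss_measure (\<Sigma> h) \<partial>P \<partial>?C)"
    if [measurable]: "F \<in> borel_measurable (borel \<Otimes>\<^sub>M borel \<Otimes>\<^sub>M borel)" for F :: "_ \<Rightarrow> ennreal"
  proof -
    have [measurable]: "(\<lambda>\<omega>. F (?X \<omega>, ?Y \<omega>, ?Z \<omega>)) \<in> borel_measurable ?\<Omega>"
      using measurable_compose[OF _ that, of "\<lambda>\<omega>. (?X \<omega>, ?Y \<omega>, ?Z \<omega>)" ?\<Omega>] XYZ by simp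
    have "(\<integral>\<^sup>+\<omega>. F (?X \<omega>, ?Y \<omega>, ?Z \<omega>) \<partial>?\<Omega>) = (\<integral>\<^sup>+h. \<integral>\<^sup>+x. \<integral>\<^sup>+n1. \<integral>\<^sup>+n2.
       F (x, hop_output (sqrt \<nu> *\<^sub>R hop_output x (fst h, n1)) (snd h, n2), h) \<partial>N2 \<partial>N1 \<partial>P \<partial>?C)"
      unfolding \<Omega> by (subst nn_integral_dual_reorder) (auto simp: P(1) prob prob_space_rayleigh \<Omega>[symmetric] simp del: hop_output.simps)
    also have "\<dots> = (\<integral>\<^sup>+h. \<integral>\<^sup>+x. \<integral>\<^sup>+w. F (x, A h *v x + w, h) \<partial>gauss_measure (\<Sigma> h) \<partial>P \<partial>?C)"
    proof (intro nn_integral_cong)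
      fix h :: "(complex^'k^'m) \<times> (complex^'m^'n)" and x
      show "(\<integral>\<^sup>+n1. \<integral>\<^sup>+n2. F (x, hop_output (sqrt \<nu> *\<^sub>R hop_output x (fst h, n1)) (snd h, n2), h) \<partial>N2 \<partial>N1)
        = (\<integral>\<^sup>+w. F (x, A h *v x + w, h) \<partial>gauss_measure (\<Sigma> h))"
        unfolding N1_def N2_def using nonneg
        by (subst nn_integral_noise[where F="\<lambda>y. F (x, y, h)"]) (auto simp: A_def \<Sigma>_def b_def c_def d_def)
    qed
    finally show ?thesis .
  qed
  interpret CL: channel_law ?\<Omega> P ?C ?X ?Y ?Z g
  proof (intro channel_law.intro channel_law_axioms.intro prob P(1,2) sC XYZ gm)
    fix h x y
    show "g h x y > 0" unfolding g_def by (rule gauss_density_pos[OF p\<Sigma>])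
    interpret prob_space "gauss_measure (\<Sigma> h)" by (rule prob_space_gauss_measure[OF p\<Sigma>])
    show "(\<integral>\<^sup>+y. ennreal (g h x y) \<partial>lborel) = 1"
      using nn_integral_gauss_measure_translate[where F="\<lambda>_. 1" and s="A h *v x" and S="\<Sigma> h"] emeasure_space_1 by (simp add: g_def)
    interpret P: prob_space P by (rule P(1))
    show "integrable P (\<lambda>x. g h x y)"
      using gauss_density_le[OF p\<Sigma>] gauss_density_pos[OF p\<Sigma>] unfolding g_def
      by (intro P.integrable_const_bound[where B="1 / (pi ^ CARD('n) * Re (det (\<Sigma> h)))"]) (auto simp: less_imp_le)
  next
    fix F :: "(complex^'k) \<times> (complex^'n) \<times> ((complex^'k^'m) \<times> (complex^'m^'n)) \<Rightarrow> ennreal"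
    assume F [measurable]: "F \<in> borel_measurable (borel \<Otimes>\<^sub>M borel \<Otimes>\<^sub>M borel)"
    show "(\<integral>\<^sup>+\<omega>. F (?X \<omega>, ?Y \<omega>, ?Z \<omega>) \<partial>?\<Omega>) = (\<integral>\<^sup>+h. \<integral>\<^sup>+x. \<integral>\<^sup>+y. ennreal (g h x y) * F (x, y, h) \<partial>lborel \<partial>P \<partial>?C)"
      unfolding law[OF F] g_def
      by (intro nn_integral_cong nn_integral_gauss_measure_translate) measurable
  qed
  note [measurable] = CL.X CL.Y CL.Z
  let ?q = "\<lambda>h y. gauss_density (S h) y"
  have qm: "(\<lambda>(h, y). ?q h y) \<in> borel_measurable (borel \<Otimes>\<^sub>M borel)"
    unfolding split_def by (intro measurable_gauss_density_joint pS) (simp_all add: S_def)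
  have q_one: "(\<integral>\<^sup>+y. ennreal (?q h y) \<partial>lborel) = 1" for h
    using prob_space.emeasure_space_1[OF prob_space_gauss_measure[OF pS[of h]]] by (simp add: gauss_measure_def emeasure_density)
  have iq: "(\<integral>\<^sup>+w. ennreal (inv_quad (\<Sigma> h) w) \<partial>gauss_measure (\<Sigma> h)) = ennreal CARD('n)" for h
    using integral_inv_quad[OF p\<Sigma> conjunct1[OF has_cov_gauss_measure[OF p\<Sigma>]], of h] hdot_inv_eq(2)[OF p\<Sigma>]
    by (subst nn_integral_eq_integral) (auto simp: has_bochner_integral_iff)
  have iqS: "(\<integral>\<^sup>+x. \<integral>\<^sup>+w. ennreal (inv_quad (S h) (A h *v x + w)) \<partial>gauss_measure (\<Sigma> h) \<partial>P) = ennreal CARD('n)" for h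
  proof -
    interpret prob_space "gauss_measure (\<Sigma> h)" by (rule prob_space_gauss_measure[OF p\<Sigma>])
    note cg = has_cov_gauss_measure[OF p\<Sigma>[of h]]
    have "A h ** mat (of_real \<mu>) ** ctranspose (A h) + \<Sigma> h = S h"
      unfolding S_eq matrix_mult_mat_of_real scaleR_matrix_mult by (rule add.commute)
    then have cov: "has_cov (P \<Otimes>\<^sub>M gauss_measure (\<Sigma> h)) (\<lambda>p. A h *v fst p + snd p) (S h)"
      using has_cov_add_pair[OF P(1) prob_space_axioms has_cov_linear[OF P(3), of "A h"] conjunct1[OF cg] conjunct2[OF cg]] by simp
    have "(\<integral>\<^sup>+x. \<integral>\<^sup>+w. ennreal (inv_quad (S h) (A h *v x + w)) \<partial>gauss_measure (\<Sigma> h) \<partial>P)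
      = (\<integral>\<^sup>+p. ennreal (inv_quad (S h) (A h *v fst p + snd p)) \<partial>(P \<Otimes>\<^sub>M gauss_measure (\<Sigma> h)))"
      by (subst nn_integral_fst[symmetric]) auto
    also have "\<dots> = ennreal CARD('n)"
      using integral_inv_quad[OF pS cov] hdot_inv_eq(2)[OF pS]
      by (subst nn_integral_eq_integral) (auto simp: has_bochner_integral_iff)
    finally show ?thesis .
  qed
  have mq: "(\<lambda>(x, y, h). inv_quad (\<Sigma> h) (y - A h *v x)) \<in> borel_measurable (borel \<Otimes>\<^sub>M borel \<Otimes>\<^sub>M borel)"
    "(\<lambda>(x, y, h). inv_quad (S h) y) \<in> borel_measurable (borel \<Otimes>\<^sub>M borel \<Otimes>\<^sub>M borel)"
    unfolding split_def by (intro measurable_inv_quad_joint p\<Sigma> pS; simp add: \<Sigma>_def S_def)+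
  have "has_bochner_integral ?\<Omega> (\<lambda>\<omega>. inv_quad (\<Sigma> (?Z \<omega>)) (?Y \<omega> - A (?Z \<omega>) *v ?X \<omega>)) CARD('n)"
  proof (rule has_bochner_integral_nn_integral)
    show "(\<lambda>\<omega>. inv_quad (\<Sigma> (?Z \<omega>)) (?Y \<omega> - A (?Z \<omega>) *v ?X \<omega>)) \<in> borel_measurable ?\<Omega>"
      using measurable_compose[OF _ mq(1), of "\<lambda>\<omega>. (?X \<omega>, ?Y \<omega>, ?Z \<omega>)" ?\<Omega>] XYZ by simp
    show "(\<integral>\<^sup>+\<omega>. ennreal (inv_quad (\<Sigma> (?Z \<omega>)) (?Y \<omega> - A (?Z \<omega>) *v ?X \<omega>)) \<partial>?\<Omega>) = ennreal CARD('n)"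
      using law[of "\<lambda>(x, y, h). ennreal (inv_quad (\<Sigma> h) (y - A h *v x))"] measurable_compose[OF mq(1) measurable_ennreal] CL.C.emeasure_space_1
        CL.P.emeasure_space_1
      by (simp add: split_def iq)
  qed (use hdot_inv_eq(2)[OF p\<Sigma>] in auto)
  moreover have "has_bochner_integral ?\<Omega> (\<lambda>\<omega>. inv_quad (S (?Z \<omega>)) (?Y \<omega>)) CARD('n)"
  proof (rule has_bochner_integral_nn_integral)
    show "(\<lambda>\<omega>. inv_quad (S (?Z \<omega>)) (?Y \<omega>)) \<in> borel_measurable ?\<Omega>"
      using measurable_compose[OF _ mq(2), of "\<lambda>\<omega>. (?X \<omega>, ?Y \<omega>, ?Z \<omega>)" ?\<Omega>] XYZ by simp
    show "(\<integral>\<^sup>+\<omega>. ennreal (inv_quad (S (?Z \<omega>)) (?Y \<omega>)) \<partial>?\<Omega>) = ennreal CARD('n)"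
      using law[of "\<lambda>(x, y, h). ennreal (inv_quad (S h) y)"] measurable_compose[OF mq(2) measurable_ennreal] CL.C.emeasure_space_1
      by (simp add: split_def iqS)
  qed (use hdot_inv_eq(2)[OF pS] in auto)
  moreover have "has_bochner_integral ?\<Omega> (\<lambda>\<omega>. lndet (S (?Z \<omega>)) - lndet (\<Sigma> (?Z \<omega>))) I"
  proof -
    have "has_bochner_integral ?C (\<lambda>H. lndet (S H) - lndet (\<Sigma> H)) I"
      unfolding I_def S_def \<Sigma>_def using integrable_lndet_amp_cov'[OF pos(1,2,3)] integrable_lndet_amp_cov'[OF pos(1,2,4)]
      by (intro has_bochner_integral_integrable) auto
    then have d: "has_bochner_integral (distr ?\<Omega> borel ?Z) (\<lambda>H. lndet (S H) - lndet (\<Sigma> H)) I"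
      unfolding CL.distr_Z .
    have m: "(\<lambda>H. lndet (S H) - lndet (\<Sigma> H)) \<in> borel_measurable borel"
      unfolding S_def \<Sigma>_def by measurable
    show ?thesis
      by (rule iffD1[OF has_bochner_integral_distr_iff[OF CL.Z m] d])
  qed
  \<comment> \<open>Both quadratic forms have mean \<open>CARD('n)\<close>, each being taken with
    the inverse of the second moment matrix of its own vector.\<close>
  ultimately have "has_bochner_integral ?\<Omega> (\<lambda>\<omega>. (inv_quad (S (?Z \<omega>)) (?Y \<omega>) - inv_quad (\<Sigma> (?Z \<omega>)) (?Y \<omega> - A (?Z \<omega>) *v ?X \<omega>))
     + (lndet (S (?Z \<omega>)) - lndet (\<Sigma> (?Z \<omega>)))) ((real CARD('n) - real CARD('n)) + I)"
    by (intro has_bochner_integral_add has_bochner_integral_diff)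
  moreover have "(inv_quad (S h) y - inv_quad (\<Sigma> h) (y - A h *v x)) + (lndet (S h) - lndet (\<Sigma> h)) = ln (g h x y / ?q h y)" for h x y
    using gauss_density_pos[OF p\<Sigma>[of h]] gauss_density_pos[OF pS[of h]] by (simp add: g_def ln_div ln_gauss_density[OF p\<Sigma>] ln_gauss_density[OF pS] less_imp_neq[symmetric])
  ultimately have E: "has_bochner_integral ?\<Omega> (\<lambda>\<omega>. ln (g (?Z \<omega>) (?X \<omega>) (?Y \<omega>) / ?q (?Z \<omega>) (?Y \<omega>))) I"
    by simp
  show "ergodic_rate \<nu> \<delta>t1 \<delta>r1 \<delta>t2 \<delta>r2 TYPE('m) TYPE('n) P \<le> I"
    using CL.conditional_mutual_information_le[OF qm gauss_density_pos[OF pS] q_one] E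
    unfolding ergodic_rate_def by (simp add: has_bochner_integral_iff)
  show "ergodic_rate \<nu> \<delta>t1 \<delta>r1 \<delta>t2 \<delta>r2 TYPE('m) TYPE('n) P = I" if G: "P = cn_vec (\<lambda>_. \<mu>)"
  proof -
    \<comment> \<open>A Gaussian input is itself a sequence of rank-one updates, adding
      \<open>\<mu>\<close> times A A^H to the noise covariance. This identifies output measures,
      hence densities almost everywhere.\<close>
    have "AE y in lborel. ?q h y = CL.p h y" for h
    proof -
      interpret PL: pair_sigma_finite P "lborel :: (complex^'n) measure"
        unfolding pair_sigma_finite_def by (simp add: lborel.sigma_finite_measure_axioms prob_space_imp_sigma_finite P(1))
      have gh [measurable]: "(\<lambda>x. g h (u x) (v x)) \<in> borel_measurable M"
        if "u \<in> borel_measurable M" "v \<in> borel_measurable M" for u v and M :: "'z measure"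
        by (intro CL.measurable_g that) simp
      have ph [measurable]: "CL.p h \<in> borel_measurable borel"
        using CL.measurable_p[of "\<lambda>_. h" borel "\<lambda>y. y"] by simp
      have "density lborel (\<lambda>y. ennreal (?q h y)) = density lborel (\<lambda>y. ennreal (CL.p h y))"
      proof (rule measure_eqI_nn_integral)
        fix F :: "complex^'n \<Rightarrow> ennreal" assume F [measurable]: "F \<in> borel_measurable borel"
        have "(\<integral>\<^sup>+y. F y \<partial>density lborel (\<lambda>y. ennreal (CL.p h y))) = (\<integral>\<^sup>+y. \<integral>\<^sup>+x. ennreal (g h x y) * F y \<partial>P \<partial>lborel)"
          by (simp add: nn_integral_density nn_integral_multc CL.nn_integral_g)
        also have "\<dots> = (\<integral>\<^sup>+x. \<integral>\<^sup>+y. ennreal (g h x y) * F y \<partial>lborel \<partial>P)"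
          by (rule PL.Fubini') measurable
        also have "\<dots> = (\<integral>\<^sup>+x. \<integral>\<^sup>+w. F (A h *v x + w) \<partial>gauss_measure (\<Sigma> h) \<partial>P)"
          unfolding g_def by (simp add: nn_integral_gauss_measure_translate)
        also have "\<dots> = (\<integral>\<^sup>+w. F w \<partial>gauss_measure (S h))"
          unfolding G S_eq by (rule nn_integral_gauss_measure_add_cn_vec_const[OF p\<Sigma> F nonneg(1)])
        finally show "(\<integral>\<^sup>+y. F y \<partial>density lborel (\<lambda>y. ennreal (?q h y))) = (\<integral>\<^sup>+y. F y \<partial>density lborel (\<lambda>y. ennreal (CL.p h y)))"
          by (simp add: gauss_measure_def)
      qed simp_all
      then have "AE y in lborel. ennreal (?q h y) = ennreal (CL.p h y)"
        by (intro sigma_finite_measure.density_unique[OF lborel.sigma_finite_measure_axioms]) measurable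
      then show ?thesis
        using gauss_density_pos[OF pS[of h]] CL.p_pos[of h] by (auto elim!: eventually_mono simp: less_imp_le)
    qed
    then show ?thesis
      using CL.conditional_mutual_information_eqI[OF qm] E
      unfolding ergodic_rate_def by (simp add: has_bochner_integral_iff)
  qed
qed

text \<open>The integrability claims give the formula its content, since a divergent integral would
  silently have the value 0.\<close>

theorem lemma1:
  fixes \<rho> \<alpha> \<delta>t1 \<delta>r1 \<delta>t2 \<delta>r2 K M N \<mu> \<mu>' \<nu> B f1 f2 f3 f4 C1 C2 :: real
    and G \<Phi> :: "(complex^'k^'m) \<times> (complex^'m^'n) \<Rightarrow> complex^'n^'n"
    and channels :: "((complex^'k^'m) \<times> (complex^'m^'n)) measure"
  assumes "K = real CARD('k)" and "M = real CARD('m)" and "N = real CARD('n)"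
    and "\<rho> > 0" and "\<alpha> > 0"
    and "\<delta>t1 \<ge> 0" and "\<delta>r1 \<ge> 0" and "\<delta>t2 \<ge> 0" and "\<delta>r2 \<ge> 0"
    and "\<mu> = \<rho> / K"
    and "\<mu>' = \<mu> + \<delta>t1\<^sup>2 * \<mu> + \<delta>r1\<^sup>2 * \<mu> + 1 / K"
    and "\<nu> = \<alpha> / (K * M * \<mu>')"
    and "B = \<delta>r2\<^sup>2 * \<mu>' * \<nu> * K * M + 1"
    and "f1 = (f2 + f4) / f3"
    and "f2 = f4 * \<delta>t1\<^sup>2"
    and "f3 = \<nu> * (\<delta>t2\<^sup>2 * \<mu>' * K + \<delta>r1\<^sup>2 * \<mu> * K + 1) / B"
    and "f4 = \<mu> * \<nu> / B"
    and "G = (\<lambda>(H1, H2). H2 ** H1 ** ctranspose H1 ** ctranspose H2)"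
    and "\<Phi> = (\<lambda>(H1, H2). f2 *\<^sub>R G (H1, H2) + f3 *\<^sub>R (H2 ** ctranspose H2) + mat 1)"
    and "channels = rayleigh \<Otimes>\<^sub>M rayleigh"
    and "C1 = 1 / N * (\<integral>H. lndet (\<Phi> H + (\<mu> * \<nu> / B) *\<^sub>R G H) \<partial>channels)"
    and "C2 = 1 / N * (\<integral>H. lndet (\<Phi> H) \<partial>channels)"
  shows
   "integrable channels (\<lambda>H. lndet (mat 1 + (\<mu> * \<nu> / B) *\<^sub>R (G H ** matrix_inv (\<Phi> H)))) \<and>
    integrable channels (\<lambda>H. lndet (\<Phi> H + (\<mu> * \<nu> / B) *\<^sub>R G H)) \<and>
    integrable channels (\<lambda>H. lndet (\<Phi> H)) \<and>
    ergodic_capacity \<nu> \<delta>t1 \<delta>r1 \<delta>t2 \<delta>r2 \<mu> (mat (complex_of_real (\<mu>' * \<nu> * K)) :: complex^'m^'m)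
       TYPE('k) TYPE('n) / ereal N
     = ereal (1 / N * (\<integral>H. lndet (mat 1 + (\<mu> * \<nu> / B) *\<^sub>R (G H ** matrix_inv (\<Phi> H))) \<partial>channels)) \<and>
    1 / N * (\<integral>H. lndet (mat 1 + (\<mu> * \<nu> / B) *\<^sub>R (G H ** matrix_inv (\<Phi> H))) \<partial>channels) = C1 - C2"
proof -
  let ?C = "rayleigh \<Otimes>\<^sub>M rayleigh :: ((complex^'k^'m) \<times> (complex^'m^'n)) measure"
  let ?T = "\<lambda>H. lndet (mat 1 + (\<mu> * \<nu> / B) *\<^sub>R (G H ** matrix_inv (\<Phi> H)))"
  note KMN = assms(1-3)
  have KMN_pos: "K > 0" "M > 0" "N > 0" using KMN by simp_all
  have \<mu>: "\<mu> > 0" using assms KMN_pos by simp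
  have \<mu>': "\<mu>' > 0"
    unfolding assms(11) using \<mu> KMN_pos by (intro add_nonneg_pos) auto
  have \<nu>: "\<nu> > 0" unfolding assms(12) using \<open>\<alpha> > 0\<close> KMN_pos \<mu>' by simp
  have B: "B > 0" unfolding assms(13) using \<mu>' \<nu> KMN_pos by (intro add_nonneg_pos) auto
  have f: "f3 \<ge> 0" "f4 \<ge> 0" "f2 \<ge> 0"
    unfolding assms(15-17) using \<mu> \<mu>' \<nu> B KMN_pos by (auto intro!: divide_nonneg_pos mult_nonneg_nonneg add_nonneg_nonneg)
  have G: "G H = (snd H ** fst H) ** ctranspose (snd H ** fst H)" for H
    unfolding assms(18) by (simp add: split_def ctranspose_mult matrix_mul_assoc)
  have \<Phi>: "\<Phi> H = amp_cov 1 f3 f2 H" for H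
    unfolding assms(19) by (cases H) (simp add: amp_cov_def G add_ac)
  have \<Phi>G: "\<Phi> H + (\<mu> * \<nu> / B) *\<^sub>R G H = amp_cov 1 f3 (f2 + f4) H" for H
    unfolding \<Phi> amp_cov_add_gram G assms(17) ..
  have pos: "posdef (\<Phi> H)" "posdef (\<Phi> H + (\<mu> * \<nu> / B) *\<^sub>R G H)" for H
    unfolding \<Phi>G unfolding \<Phi> using f by (auto intro: posdef_amp_cov)
  \<comment> \<open>Multiplying by \<open>\<Phi> H\<close> from the right removes the inverse. The
    matrix inside \<open>?T\<close> is in general not Hermitian, so its determinant is treated as a
    quotient of two positive ones; \<open>det (\<Phi> H)\<close> being real lets the real part pass
    through the product.\<close>
  have T: "?T H = lndet (\<Phi> H + (\<mu> * \<nu> / B) *\<^sub>R G H) - lndet (\<Phi> H)" for H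
  proof -
    have inv: "matrix_inv (\<Phi> H) ** \<Phi> H = mat 1"
      using someI_ex[OF posdef_invertible[OF pos(1), unfolded invertible_def], of H] by (simp add: matrix_inv_def)
    have "(mat 1 + (\<mu> * \<nu> / B) *\<^sub>R (G H ** matrix_inv (\<Phi> H))) ** \<Phi> H = \<Phi> H + (\<mu> * \<nu> / B) *\<^sub>R G H"
      by (simp add: matrix_add_mult_distrib scaleR_matrix_mult matrix_mul_assoc[symmetric] inv)
    then have "det (mat 1 + (\<mu> * \<nu> / B) *\<^sub>R (G H ** matrix_inv (\<Phi> H))) * det (\<Phi> H) = det (\<Phi> H + (\<mu> * \<nu> / B) *\<^sub>R G H)"
      by (simp flip: det_mul)
    then have "Re (det (mat 1 + (\<mu> * \<nu> / B) *\<^sub>R (G H ** matrix_inv (\<Phi> H)))) * Re (det (\<Phi> H)) = Re (det (\<Phi> H + (\<mu> * \<nu> / B) *\<^sub>R G H))"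
      using posdef_det[OF pos(1), of H] by (metis Im_complex_of_real minus_complex.sel(1) mult_zero_right diff_zero times_complex.sel(1))
    then have "Re (det (mat 1 + (\<mu> * \<nu> / B) *\<^sub>R (G H ** matrix_inv (\<Phi> H))))
        = Re (det (\<Phi> H + (\<mu> * \<nu> / B) *\<^sub>R G H)) / Re (det (\<Phi> H))"
      using posdef_det[OF pos(1), of H] by (simp add: field_simps)
    then show ?thesis
      using posdef_det[OF pos(1), of H] posdef_det[OF pos(2), of H] unfolding lndet_def
      by (simp only: ln_div) auto
  qed
  have int: "integrable ?C (\<lambda>H. lndet (\<Phi> H + (\<mu> * \<nu> / B) *\<^sub>R G H))" "integrable ?C (\<lambda>H. lndet (\<Phi> H))"
    unfolding \<Phi>G unfolding \<Phi> using f by (auto intro!: integrable_lndet_amp_cov)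
  define q where "q = \<mu>' * \<nu> * K"
  have q: "q \<ge> 0" unfolding q_def using \<mu>' \<nu> KMN_pos by simp
  \<comment> \<open>\<open>K * \<mu>'\<close> is the total signal and distortion power plus 1: the
    summand \<open>1 / K\<close> in \<open>\<mu>'\<close> stands for the unit thermal noise at the
    relay.\<close>
  have qQ: "q = \<nu> * ((1 + \<delta>t1\<^sup>2 + \<delta>r1\<^sup>2) * (real CARD('k) * \<mu>) + 1)"
    unfolding q_def assms(11) KMN(1)[symmetric] using KMN_pos by (simp add: field_simps)
  have b: "\<delta>r2\<^sup>2 * (real CARD('m) * q) + 1 = B"
    unfolding q_def assms(13) KMN(2)[symmetric] by (simp add: mult_ac)
  \<comment> \<open>The weights of the physical noise covariance are \<open>B\<close> times those in
    \<open>\<Phi>\<close>, which is where the denominators in \<open>f3\<close> and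
    \<open>f4\<close> originate.\<close>
  have c: "\<delta>t2\<^sup>2 * q + \<nu> * (\<delta>r1\<^sup>2 * (real CARD('k) * \<mu>) + 1) = B * f3"
    unfolding q_def assms(16) KMN(1)[symmetric] using B by (simp add: field_simps)
  have d: "\<nu> * (\<delta>t1\<^sup>2 * \<mu>) = B * f2" "B * f2 + \<nu> * \<mu> = B * (f2 + f4)"
    unfolding assms(15,17) using B by (simp_all add: field_simps)
  define I where "I = (\<integral>H. ?T H \<partial>?C)"
  have I: "I = (\<integral>H. lndet (amp_cov B (B * f3) (B * (f2 + f4)) H) - lndet (amp_cov B (B * f3) (B * f2) H) \<partial>?C)"
    unfolding I_def T \<Phi>G unfolding \<Phi> using B f by (simp add: lndet_amp_cov_scale)
  let ?Q = "mat (complex_of_real (\<mu>' * \<nu> * K)) :: complex^'m^'m"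
  have Q: "?Q = mat (of_real (\<nu> * ((1 + \<delta>t1\<^sup>2 + \<delta>r1\<^sup>2) * (real CARD('k) * \<mu>) + 1)))"
    unfolding q_def[symmetric] qQ ..
  have rate_le: "ergodic_rate \<nu> \<delta>t1 \<delta>r1 \<delta>t2 \<delta>r2 TYPE('m) TYPE('n) P \<le> I"
    and rate_eq: "P = cn_vec (\<lambda>_. \<mu>) \<Longrightarrow> ergodic_rate \<nu> \<delta>t1 \<delta>r1 \<delta>t2 \<delta>r2 TYPE('m) TYPE('n) P = I"
    if P: "P \<in> admissible_inputs \<nu> \<delta>t1 \<delta>r1 \<mu> ?Q" for P :: "(complex^'k) measure"
  proof -
    note a = admissible_has_cov[OF P[unfolded Q] \<nu>]
    have r: "relay_cov \<nu> \<delta>t1 \<delta>r1 P = (mat (of_real q) :: complex^'m^'m)"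
      using P by (simp add: admissible_inputs_def q_def)
    note e = ergodic_rate_amplify_forward[OF a r less_imp_le[OF \<mu>] less_imp_le[OF \<nu>] q, of \<delta>t2 \<delta>r2, where 'n='n, unfolded b d c, folded I]
    show "ergodic_rate \<nu> \<delta>t1 \<delta>r1 \<delta>t2 \<delta>r2 TYPE('m) TYPE('n) P \<le> I"
      and "P = cn_vec (\<lambda>_. \<mu>) \<Longrightarrow> ergodic_rate \<nu> \<delta>t1 \<delta>r1 \<delta>t2 \<delta>r2 TYPE('m) TYPE('n) P = I"
      using e by auto
  qed
  have gauss: "(cn_vec (\<lambda>_. \<mu>) :: (complex^'k) measure) \<in> admissible_inputs \<nu> \<delta>t1 \<delta>r1 \<mu> ?Q"
    unfolding Q by (rule cn_vec_admissible[OF less_imp_le[OF \<mu>]])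
  have cap: "ergodic_capacity \<nu> \<delta>t1 \<delta>r1 \<delta>t2 \<delta>r2 \<mu> ?Q TYPE('k) TYPE('n) = ereal I"
    unfolding ergodic_capacity_def
  proof (rule antisym)
    show "(SUP P\<in>admissible_inputs \<nu> \<delta>t1 \<delta>r1 \<mu> ?Q. ereal (ergodic_rate \<nu> \<delta>t1 \<delta>r1 \<delta>t2 \<delta>r2 TYPE('m) TYPE('n) (P :: (complex^'k) measure))) \<le> ereal I"
      by (rule SUP_least) (simp add: rate_le)
    show "ereal I \<le> (SUP P\<in>admissible_inputs \<nu> \<delta>t1 \<delta>r1 \<mu> ?Q. ereal (ergodic_rate \<nu> \<delta>t1 \<delta>r1 \<delta>t2 \<delta>r2 TYPE('m) TYPE('n) (P :: (complex^'k) measure)))"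
      using gauss rate_eq[OF gauss refl] by (intro SUP_upper2[where i="cn_vec (\<lambda>_. \<mu>)"]) auto
  qed
  have "1 / N * I = C1 - C2"
    unfolding I_def T assms(21,22) assms(20) using int by (simp add: right_diff_distrib diff_divide_distrib)
  moreover have "integrable ?C ?T" unfolding T using int by simp
  moreover have "ereal I / ereal N = ereal (1 / N * I)" using KMN_pos by simp
  ultimately show ?thesis
    using int cap unfolding assms(20) I_def by simp
qed

end
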